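(* Let $n\ge 2$, $1<p\le 2$ and $2\le q\le\frac{n-1}{n+1}\,p'$. Let $v$ be the piecewise power weight on $\mathbb{R}^n$ $$v(x)=\begin{cases}|x|^\alpha,& |x|\le 1,\\ |x|^\beta,& |x|>1,\end{cases}$$ with $\alpha<n(p-1)$ and $\beta\ge 0$, and let $w_0(\rho)=\max\{\rho^\alpha,\rho^\beta\}$ for $\rho>0$. Let $u(x)=u_0(|x|)$ be a non-negative measurable radial weight on $\mathbb{R}^n$ that satisfies $$\int_0^\infty\rho^{\,n-1-\frac{qn}{p'}}\,u_0(\rho)\,w_0^{q/p}(\rho)\,d\rho<\infty .$$ Then there is a constant $C$ such that for every $f\in C_0^\infty(\mathbb{R}^n)$ $$\|u^{1/q}\,\widehat f\,\|_q\le C\|v^{1/p}f\|_p .$$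
   Context: The Fourier transform is $\widehat f(\xi)=\int_{\mathbb{R}^n}e^{ix\xi}f(x)\,dx$. $\|\cdot\|_p$ is the norm of $L^p(\mathbb{R}^n)$ and $p'=p/(p-1)$. *)

theory Defs
  imports "HOL-Analysis.Analysis"
begin

definition conj_exponent :: "real \<Rightarrow> real" where
  "conj_exponent p = p / (p - 1)"

text \<open>The $L^p$ norm, $1 \le p < \infty$, with respect to Lebesgue measure, as an extended
  non-negative real: its value is infinite when the function is not $p$-integrable.\<close>

definition Lp_norm :: "real \<Rightarrow> ('a::euclidean_space \<Rightarrow> complex) \<Rightarrow> ennreal" where
  "Lp_norm p g =
     (let I = (\<integral>\<^sup>+ x. ennreal (cmod (g x) powr p) \<partial>lebesgue)
      in if I = \<infinity> then \<infinity> else ennreal (enn2real I powr (1 / p)))"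

definition fourier :: "('a::euclidean_space \<Rightarrow> complex) \<Rightarrow> 'a \<Rightarrow> complex" where
  "fourier f \<xi> = (LINT x|lebesgue. exp (\<i> * complex_of_real (x \<bullet> \<xi>)) * f x)"

text \<open>\<open>times_differentiable k f\<close>: all iterated directional derivatives of order less than \<open>k\<close>
  are (Frechet) differentiable everywhere, and those of order \<open>k\<close> are continuous,
  i.e. \<open>f\<close> is of class $C^k$ over the reals.\<close>

primrec times_differentiable ::
    "nat \<Rightarrow> ('a::euclidean_space \<Rightarrow> complex) \<Rightarrow> bool" where
  "times_differentiable 0 f \<longleftrightarrow> continuous_on UNIV f"
| "times_differentiable (Suc k) f \<longleftrightarrow>
     f differentiable_on UNIV \<and>
     (\<forall>h. times_differentiable k (\<lambda>x. frechet_derivative f (at x) h))"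

definition test_functions :: "('a::euclidean_space \<Rightarrow> complex) set" where
  "test_functions =
     {f. (\<forall>k. times_differentiable k f) \<and> compact (closure {x. f x \<noteq> 0})}"

text \<open>Since \<open>0 powr a = 0\<close>, the weight is \<open>0\<close> at the origin whatever \<open>\<alpha>\<close> is;
  this is a null set and does not affect any norm.\<close>

definition power_weight :: "real \<Rightarrow> real \<Rightarrow> 'a::euclidean_space \<Rightarrow> real" where
  "power_weight \<alpha> \<beta> x = (if norm x \<le> 1 then norm x powr \<alpha> else norm x powr \<beta>)"

definition max_weight :: "real \<Rightarrow> real \<Rightarrow> real \<Rightarrow> real" where
  "max_weight \<alpha> \<beta> \<rho> = max (\<rho> powr \<alpha>) (\<rho> powr \<beta>)"

end

theory Submission
  imports Defs "HOL-Probability.Probability" "HOL-Real_Asymp.Real_Asymp"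
begin

text \<open>
  Split \<open>f\<close> at \<open>|x| = 1/\<rho>\<close> to estimate its transform on the sphere of radius \<open>\<rho>\<close>: the inner part is
  controlled by Hoelder's inequality, because \<open>\<alpha> < n(p - 1)\<close> makes \<open>v\<^bsup>-p'/p\<^esup>\<close> integrable at the
  origin, and the outer part by the Stein--Tomas restriction theorem, because there \<open>1 \<le> w\<^sub>0(\<rho>) v\<close>.
  No surface measure is used: spheres are replaced by thin shells with bounds uniform in the
  thickness, and a measure that is dominated on short intervals is dominated on all Borel sets.

  The endpoint \<open>r = 2(n+1)/(n+3)\<close> of the restriction theorem rests on
  \<open>2\<delta>/(\<delta>\<^sup>2 + \<tau>\<^sup>2) = 2 Re \<integral>\<^sub>0\<^sup>\<infinity> exp((i\<tau> - \<delta>)s) ds\<close> at \<open>\<tau> = |\<xi>|\<^sup>2 - 1\<close>. With the factor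
  \<open>exp(-|\<xi>|\<^sup>2)\<close> the part \<open>s \<approx> 2\<^sup>j\<close> is an integral of complex Gaussians, so van der Corput's lemma bounds
  its Fourier transform by \<open>2\<^bsup>-j(n-1)/2\<^esup>\<close>, while its \<open>L\<^sup>2\<close> bounds involve the unknown best constant
  \<open>A\<close> of the inequality itself. Decomposing \<open>f\<close> into level sets and playing both bounds against each
  other gives off-diagonal decay and \<open>A \<le> C \<surd>A\<close>. Exponents \<open>p < r\<close> follow by interpolation
  with the trivial bound from \<open>L\<^sup>1\<close> to \<open>L\<^sup>\<infinity>\<close>.\<close>

section \<open>Oscillatory Gaussian integrals\<close>

text \<open>At the endpoint r the two bounds on a dyadic piece interpolate to a bound without decay
  in j, so the pieces cannot be summed by interpolation alone. Level sets by themselves do not cure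
  this: if both functions are measured in L^1 and then both in L^2, the powers of 2^k and 2^l cancel
  exactly at the balancing scale, and nothing decays in |k - l|. The cure is asymmetry. For levels l
  \<le> k the higher one is measured by its energy, that is by A and its L^r norm, and only the
  lower one in L^2; the exponents no longer cancel and leave the factor 2 powr (- ((r - 1) / n) * (k
  - l)). The price is a factor sqrt A, because the energy enters through Cauchy--Schwarz, and A
  \<le> C sqrt A closes up once A is known to be finite. The energy called for at scale j has
  thickness max \<delta> (1 / 2^j), never thinner than \<delta>, so the hypothesis on A is available
  at every scale. The factor exp(-|\<xi>|^2) makes each piece integrable and turns it into Gaussians
  of complex parameter 1 - i s.\<close>

lemma integrable_gauss_moment:
  "integrable lborel (\<lambda>x::real. exp (- x\<^sup>2) * \<bar>x\<bar> ^ k)"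
proof -
  have "integrable lborel (\<lambda>x. std_normal_density (0 + sqrt 2 * x) * \<bar>0 + sqrt 2 * x\<bar> ^ k)"
    by (rule lborel_integrable_real_affine[OF integrable_std_normal_moment_abs]) simp
  then have "integrable lborel (\<lambda>x. (sqrt (2 * pi) / sqrt 2 ^ k) * (std_normal_density (0 + sqrt 2 * x) * \<bar>0 + sqrt 2 * x\<bar> ^ k))"
    by (rule integrable_mult_right)
  also have "(\<lambda>x. (sqrt (2 * pi) / sqrt 2 ^ k) * (std_normal_density (0 + sqrt 2 * x) * \<bar>0 + sqrt 2 * x\<bar> ^ k))
      = (\<lambda>x. exp (- x\<^sup>2) * \<bar>x\<bar> ^ k)"
    by (auto simp: std_normal_density_def abs_mult power_mult_distrib real_sqrt_mult field_simps)
  finally show ?thesis .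
qed

lemma integral_gauss: "(LINT x|lborel. exp (- x\<^sup>2)) = sqrt pi"
proof -
  have "(LINT x|lborel. std_normal_density x) = sqrt 2 * (LINT x|lborel. std_normal_density (0 + sqrt 2 * x))"
    by (subst lborel_integral_real_affine[where c="sqrt 2" and t=0]) auto
  moreover have "(LINT x|lborel. std_normal_density x) = 1"
    using integral_std_normal_moment_even[of 0] by simp
  moreover have "std_normal_density (0 + sqrt 2 * x) = (1 / sqrt (2 * pi)) * exp (- x\<^sup>2)" for x
    by (simp add: std_normal_density_def power_mult_distrib)
  ultimately have "1 = sqrt 2 * (LINT x|lborel. (1 / sqrt (2 * pi)) * exp (- x\<^sup>2))"
    by (simp only:)
  also have "\<dots> = (LINT x|lborel. exp (- x\<^sup>2)) / sqrt pi"
    by (simp add: real_sqrt_mult)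
  finally show ?thesis by (simp add: field_simps)
qed

text \<open>Integration by parts on the whole line in its barest form; it serves to derive the
  moment identities of the complex Gaussian.\<close>

lemma integral_derivative_UNIV_eq_0:
  fixes \<Phi> \<phi> :: "real \<Rightarrow> complex"
  assumes d: "\<And>x. (\<Phi> has_vector_derivative \<phi> x) (at x)"
    and c: "continuous_on UNIV \<phi>" and i: "integrable lborel \<phi>"
    and l: "(\<Phi> \<longlongrightarrow> 0) at_bot" "(\<Phi> \<longlongrightarrow> 0) at_top"
  shows "(LINT x|lborel. \<phi> x) = 0"
proof -
  have "(LBINT x=-\<infinity>..\<infinity>. \<phi> x) = 0 - 0"
  proof (rule interval_integral_FTC_integrable)
    show "((\<Phi> \<circ> real_of_ereal) \<longlongrightarrow> 0) (at_right (- \<infinity>))"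
      using l(1) by (simp add: ereal_tendsto_simps1)
    show "((\<Phi> \<circ> real_of_ereal) \<longlongrightarrow> 0) (at_left \<infinity>)"
      using l(2) by (simp add: ereal_tendsto_simps1)
    show "set_integrable lborel (einterval (-\<infinity>) \<infinity>) \<phi>"
      using i by (simp add: set_integrable_def einterval_def)
  qed (use d c in \<open>auto simp: continuous_on_eq_continuous_at\<close>)
  then show ?thesis
    by (simp add: interval_lebesgue_integral_def einterval_def set_lebesgue_integral_def)
qed

text \<open>The Gaussian of complex parameter z = 1 - i s together with the character of frequency
  x. Since Re z = 1, its modulus does not depend on s and x, so one integrable majorant serves every
  limit and derivative in the parameters.\<close>

definition gauss_osc :: "real \<Rightarrow> real \<Rightarrow> real \<Rightarrow> complex" where
  "gauss_osc s x t = exp (- (1 - \<i> * s) * t\<^sup>2 + \<i> * x * t)"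

lemma norm_gauss_osc: "cmod (gauss_osc s x t) = exp (- t\<^sup>2)"
  by (simp add: gauss_osc_def norm_exp_eq_Re flip: of_real_power)

lemma gauss_osc_measurable [measurable]: "gauss_osc s x \<in> borel_measurable borel"
  unfolding gauss_osc_def by (intro borel_measurable_continuous_onI continuous_intros)

lemma integrable_gauss_osc_moment:
  "integrable lborel (\<lambda>t. complex_of_real t ^ k * gauss_osc s x t)"
proof (rule Bochner_Integration.integrable_bound[OF integrable_gauss_moment[of k]])
  show "AE t in lborel. norm (complex_of_real t ^ k * gauss_osc s x t) \<le> norm (exp (- t\<^sup>2) * \<bar>t\<bar> ^ k)"
    by (auto simp: norm_mult norm_power norm_gauss_osc)
qed (measurable)

lemma integrable_gauss_osc: "integrable lborel (gauss_osc s x)"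
  using integrable_gauss_osc_moment[of 0 s x] by simp

definition gauss_ft :: "real \<Rightarrow> real \<Rightarrow> complex" where
  "gauss_ft s x = (LINT t|lborel. gauss_osc s x t)"

lemma gauss_osc_deriv:
  "(gauss_osc s x has_vector_derivative (\<i> * x - 2 * (1 - \<i> * s) * t) * gauss_osc s x t) (at t)"
proof -
  have "((\<lambda>z. exp (- (1 - \<i> * s) * z\<^sup>2 + \<i> * x * z)) has_field_derivative
     (\<i> * x - 2 * (1 - \<i> * s) * t) * exp (- (1 - \<i> * s) * t\<^sup>2 + \<i> * x * t)) (at (complex_of_real t))"
    by (auto intro!: derivative_eq_intros simp: algebra_simps)
  from field_vector_diff_chain_at[OF has_vector_derivative_of_real[OF DERIV_ident] this]
  show ?thesis unfolding gauss_osc_def[abs_def] by (simp add: o_def)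
qed

lemma gauss_osc_tendsto_0:
  assumes "F = at_bot \<or> F = at_top"
  shows "((\<lambda>t. complex_of_real t ^ k * gauss_osc s x t) \<longlongrightarrow> 0) F"
proof (rule tendsto_norm_zero_cancel)
  have *: "((\<lambda>t::real. \<bar>t\<bar> ^ k * exp (- t\<^sup>2)) \<longlongrightarrow> 0) at_top"
  proof (rule tendsto_sandwich[of "\<lambda>_. 0" _ _ "\<lambda>t. t ^ k / exp t"])
    show "\<forall>\<^sub>F t::real in at_top. \<bar>t\<bar> ^ k * exp (- t\<^sup>2) \<le> t ^ k / exp t"
      using eventually_ge_at_top[of 1]
      by eventually_elim (auto simp: exp_minus field_simps power2_eq_square)
    show "((\<lambda>t::real. t ^ k / exp t) \<longlongrightarrow> 0) at_top" by (rule tendsto_power_div_exp_0)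
  qed auto
  have "((\<lambda>t::real. \<bar>t\<bar> ^ k * exp (- t\<^sup>2)) \<longlongrightarrow> 0) at_bot"
    using * by (subst filterlim_at_bot_mirror) simp
  with * assms show "((\<lambda>t. norm (complex_of_real t ^ k * gauss_osc s x t)) \<longlongrightarrow> 0) F"
    by (auto simp: norm_mult norm_power norm_gauss_osc)
qed

text \<open>The t-derivative of the integrand is (i x - 2 z t) times the integrand, with z = 1 - i
  s. It integrates to 0, and this is solved for the first moment.\<close>

lemma gauss_osc_first_moment:
  "(LINT t|lborel. complex_of_real t * gauss_osc s x t) = \<i> * x / (2 * (1 - \<i> * s)) * gauss_ft s x"
proof -
  let ?z = "1 - \<i> * complex_of_real s"
  have z: "?z \<noteq> 0" by (auto simp: complex_eq_iff)
  have i1: "integrable lborel (\<lambda>t. complex_of_real t * gauss_osc s x t)"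
    using integrable_gauss_osc_moment[of 1 s x] by simp
  have "(LINT t|lborel. (\<i> * x - 2 * ?z * t) * gauss_osc s x t) = 0"
  proof (rule integral_derivative_UNIV_eq_0[OF gauss_osc_deriv])
    show "continuous_on UNIV (\<lambda>t. (\<i> * x - 2 * ?z * t) * gauss_osc s x t)"
      unfolding gauss_osc_def by (intro continuous_intros)
    show "integrable lborel (\<lambda>t. (\<i> * x - 2 * ?z * t) * gauss_osc s x t)"
      using i1 integrable_gauss_osc[of s x] by (simp add: ring_distribs mult.assoc)
  qed (use gauss_osc_tendsto_0[of _ 0 s x] in auto)
  then have "\<i> * x * gauss_ft s x - 2 * ?z * (LINT t|lborel. complex_of_real t * gauss_osc s x t) = 0"
    using i1 integrable_gauss_osc[of s x] by (simp add: gauss_ft_def left_diff_distrib mult.assoc)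
  then show ?thesis using z by (simp add: field_simps)
qed

text \<open>The same argument for the derivative of t times the integrand at x = 0. Up to the factor
  i, the second moment is the s-derivative of the transform at the origin.\<close>

lemma gauss_osc_second_moment:
  "(LINT t|lborel. (complex_of_real t)\<^sup>2 * gauss_osc s 0 t) = gauss_ft s 0 / (2 * (1 - \<i> * s))"
proof -
  let ?z = "1 - \<i> * complex_of_real s"
  have z: "?z \<noteq> 0" by (auto simp: complex_eq_iff)
  note i = integrable_gauss_osc_moment[of 2 s 0] integrable_gauss_osc[of s 0]
  have "(LINT t|lborel. gauss_osc s 0 t - 2 * ?z * ((complex_of_real t)\<^sup>2 * gauss_osc s 0 t)) = 0"
  proof (rule integral_derivative_UNIV_eq_0[where \<Phi>="\<lambda>t. complex_of_real t * gauss_osc s 0 t"])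
    fix t :: real
    have "((\<lambda>t. complex_of_real t * gauss_osc s 0 t) has_vector_derivative
      complex_of_real t * ((\<i> * 0 - 2 * ?z * t) * gauss_osc s 0 t) + complex_of_real 1 * gauss_osc s 0 t) (at t)"
      using gauss_osc_deriv[of s 0 t]
      by (intro has_vector_derivative_mult has_vector_derivative_of_real) (auto intro: derivative_eq_intros)
    then show "((\<lambda>t. complex_of_real t * gauss_osc s 0 t) has_vector_derivative
      gauss_osc s 0 t - 2 * ?z * ((complex_of_real t)\<^sup>2 * gauss_osc s 0 t)) (at t)"
      by (simp add: algebra_simps power2_eq_square)
  next
    show "continuous_on UNIV (\<lambda>t. gauss_osc s 0 t - 2 * ?z * ((complex_of_real t)\<^sup>2 * gauss_osc s 0 t))"
      unfolding gauss_osc_def by (intro continuous_intros)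
    show "integrable lborel (\<lambda>t. gauss_osc s 0 t - 2 * ?z * ((complex_of_real t)\<^sup>2 * gauss_osc s 0 t))"
      using i by (intro Bochner_Integration.integrable_diff integrable_mult_right) auto
  qed (use gauss_osc_tendsto_0[of _ 1 s 0] in auto)
  then have "gauss_ft s 0 - 2 * ?z * (LINT t|lborel. (complex_of_real t)\<^sup>2 * gauss_osc s 0 t) = 0"
    using i by (simp add: gauss_ft_def)
  then show ?thesis using z by (simp add: field_simps)
qed

lemma iexp_quadratic_approx: "cmod (exp (\<i> * complex_of_real y) - 1 - \<i> * y) \<le> y\<^sup>2 / 2"
  using iexp_approx1[of y 1] by (simp add: power2_eq_square diff_diff_eq)

text \<open>A remainder of second order in h identifies the derivative. In this form differentiation
  under the integral sign needs only a finite moment and no convergence theorem.\<close>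

lemma has_vector_derivative_quadratic_bound:
  fixes f :: "real \<Rightarrow> complex"
  assumes "\<And>h. norm (f (x + h) - f x - of_real h * f') \<le> C * h\<^sup>2"
  shows "(f has_vector_derivative f') (at x)"
  unfolding has_vector_derivative_def
proof (rule has_derivativeI)
  show "bounded_linear (\<lambda>x. x *\<^sub>R f')" by (rule bounded_linear_scaleR_left)
  have "((\<lambda>y. C * \<bar>y - x\<bar>) \<longlongrightarrow> C * \<bar>x - x\<bar>) (at x)"
    by (intro tendsto_intros)
  then have l: "((\<lambda>y. C * \<bar>y - x\<bar>) \<longlongrightarrow> 0) (at x)" by simp
  show "((\<lambda>y. (f y - f x - (y - x) *\<^sub>R f') /\<^sub>R norm (y - x)) \<longlongrightarrow> 0) (at x)"
  proof (rule Lim_null_comparison[OF _ l])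
    show "\<forall>\<^sub>F y in at x. norm ((f y - f x - (y - x) *\<^sub>R f') /\<^sub>R norm (y - x)) \<le> C * \<bar>y - x\<bar>"
    proof (rule always_eventually, rule allI)
      fix y :: real
      have "norm (f y - f x - (y - x) *\<^sub>R f') \<le> C * \<bar>y - x\<bar> * \<bar>y - x\<bar>"
        using assms[of "y - x"] by (simp add: scaleR_conv_of_real power2_eq_square mult.assoc)
      then show "norm ((f y - f x - (y - x) *\<^sub>R f') /\<^sub>R norm (y - x)) \<le> C * \<bar>y - x\<bar>"
        by (cases "y = x") (simp_all add: divide_le_eq divide_inverse_commute[symmetric])
    qed
  qed
qed

text \<open>The hypothesis covers the two directions needed: a step in s multiplies the integrand by
  iexp (h t^2), a step in x by iexp (h t). The second-order remainder of the exponential is at most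
  h^2 t^(2m) / 2 times the Gaussian, whose moment is finite, so m = 2 and m = 1 are treated at
  once.\<close>

lemma gauss_ft_integral_deriv:
  assumes gh: "\<And>h t. gauss_osc (s + a * h) (x + b * h) t = iexp (h * t ^ m) * gauss_osc s x t"
  shows "((\<lambda>h. gauss_ft (s + a * h) (x + b * h)) has_vector_derivative
     \<i> * (LINT t|lborel. complex_of_real t ^ m * gauss_osc s x t)) (at 0)"
proof (rule has_vector_derivative_quadratic_bound)
  fix h :: real
  note i = integrable_gauss_osc integrable_gauss_osc_moment[of m s x]
  have b: "norm ((iexp (h * t ^ m) - 1 - \<i> * (h * t^m)) * gauss_osc s x t)
        \<le> h\<^sup>2 / 2 * (exp (- t\<^sup>2) * \<bar>t\<bar> ^ (2 * m))" for t
  proof -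
    have "(h * t ^ m)\<^sup>2 / 2 * exp (- t\<^sup>2) = h\<^sup>2 / 2 * (exp (- t\<^sup>2) * \<bar>t\<bar> ^ (2 * m))"
      by (simp add: power_mult_distrib power_even_abs power_mult[symmetric] mult.commute[of m])
    then show ?thesis
      using mult_right_mono[OF iexp_quadratic_approx[of "h * t ^ m"], of "exp (- t\<^sup>2)"]
      by (simp add: norm_mult norm_gauss_osc)
  qed
  have "gauss_ft (s + a * (0 + h)) (x + b * (0 + h)) - gauss_ft (s + a * 0) (x + b * 0) -
       of_real h * (\<i> * (LINT t|lborel. complex_of_real t ^ m * gauss_osc s x t))
    = (LINT t|lborel. gauss_osc (s + a * h) (x + b * h) t - gauss_osc s x t - of_real h * (\<i> * (of_real t ^ m * gauss_osc s x t)))"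
    using i by (simp add: gauss_ft_def)
  also have "\<dots> = (LINT t|lborel. (iexp (h * t ^ m) - 1 - \<i> * (h * t^m)) * gauss_osc s x t)"
    unfolding gh by (simp add: algebra_simps)
  also have "norm \<dots> \<le> (LINT t|lborel. h\<^sup>2 / 2 * (exp (- t\<^sup>2) * \<bar>t\<bar> ^ (2 * m)))"
  proof (rule Bochner_Integration.integral_norm_bound_integral)
    show "integrable lborel (\<lambda>t. (iexp (h * t ^ m) - 1 - \<i> * (h * t^m)) * gauss_osc s x t)"
    proof (rule Bochner_Integration.integrable_bound[OF integrable_mult_right[OF integrable_gauss_moment[of "2 * m"], where c="h\<^sup>2 / 2"]])
      show "AE t in lborel. norm ((iexp (h * t ^ m) - 1 - \<i> * (h * t^m)) * gauss_osc s x t)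
        \<le> norm (h\<^sup>2 / 2 * (exp (- t\<^sup>2) * \<bar>t\<bar> ^ (2 * m)))"
        using b by (auto simp: abs_mult)
    qed measurable
    show "norm ((iexp (h * t ^ m) - 1 - \<i> * (h * t^m)) * gauss_osc s x t)
        \<le> h\<^sup>2 / 2 * (exp (- t\<^sup>2) * \<bar>t\<bar> ^ (2 * m))" for t
      by (rule b)
  qed (intro integrable_mult_right integrable_gauss_moment)
  also have "\<dots> = (LINT t|lborel. (exp (- t\<^sup>2) * \<bar>t\<bar> ^ (2 * m))) / 2 * h\<^sup>2"
    by simp
  finally show "norm (gauss_ft (s + a * (0 + h)) (x + b * (0 + h)) - gauss_ft (s + a * 0) (x + b * 0) -
       of_real h * (\<i> * (LINT t|lborel. complex_of_real t ^ m * gauss_osc s x t)))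
    \<le> (LINT t|lborel. (exp (- t\<^sup>2) * \<bar>t\<bar> ^ (2 * m))) / 2 * h\<^sup>2" .
qed

lemma gauss_ft_deriv_fst:
  "((\<lambda>s. gauss_ft s 0) has_vector_derivative (\<i> / (2 * (1 - \<i> * s)) * gauss_ft s 0)) (at s)"
proof -
  have "((\<lambda>h. gauss_ft (s + 1 * h) (0 + 0 * h)) has_vector_derivative
     \<i> * (LINT t|lborel. complex_of_real t ^ 2 * gauss_osc s 0 t)) (at 0)"
    by (rule gauss_ft_integral_deriv) (simp add: gauss_osc_def algebra_simps flip: exp_add)
  then have "((\<lambda>h. gauss_ft (s + h) 0) has_vector_derivative \<i> / (2 * (1 - \<i> * s)) * gauss_ft s 0) (at (s - s))"
    by (simp add: gauss_osc_second_moment)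
  moreover have "((\<lambda>x. x - s) has_vector_derivative 1) (at s)"
    by (auto intro!: derivative_eq_intros)
  ultimately show ?thesis
    using vector_diff_chain_at[of "\<lambda>x. x - s" 1 s "\<lambda>h. gauss_ft (s + h) 0"] by (simp add: o_def)
qed

lemma gauss_ft_deriv_snd:
  "((\<lambda>x. gauss_ft s x) has_vector_derivative (- x / (2 * (1 - \<i> * s)) * gauss_ft s x)) (at x)"
proof -
  have "((\<lambda>h. gauss_ft (s + 0 * h) (x + 1 * h)) has_vector_derivative
     \<i> * (LINT t|lborel. complex_of_real t ^ 1 * gauss_osc s x t)) (at 0)"
    by (rule gauss_ft_integral_deriv) (simp add: gauss_osc_def algebra_simps flip: exp_add)
  then have "((\<lambda>h. gauss_ft s (x + h)) has_vector_derivative - x / (2 * (1 - \<i> * s)) * gauss_ft s x) (at (x - x))"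
    by (simp add: gauss_osc_first_moment flip: mult.assoc)
  moreover have "((\<lambda>y. y - x) has_vector_derivative 1) (at x)"
    by (auto intro!: derivative_eq_intros)
  ultimately show ?thesis
    using vector_diff_chain_at[of "\<lambda>y. y - x" 1 x "\<lambda>h. gauss_ft s (x + h)"] by (simp add: o_def)
qed

text \<open>In x the transform G solves the linear equation G' = - x / (2 z) G with z = 1 - i s, so
  its product with exp (x^2 / (4 z)) has derivative zero. This takes the place of a shift of
  contour.\<close>

lemma gauss_ft_eq: "gauss_ft s x = gauss_ft s 0 * exp (- x\<^sup>2 / (4 * (1 - \<i> * s)))"
proof -
  let ?z = "1 - \<i> * complex_of_real s"
  have z: "?z \<noteq> 0" by (auto simp: complex_eq_iff)
  have "\<exists>c. \<forall>x\<in>UNIV. gauss_ft s x * exp ((complex_of_real x)\<^sup>2 / (4 * ?z)) = c"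
  proof (rule has_vector_derivative_zero_constant)
    fix x :: real
    have "((\<lambda>w. exp (w\<^sup>2 / (4 * ?z))) has_field_derivative x / (2 * ?z) * exp (x\<^sup>2 / (4 * ?z))) (at (complex_of_real x))"
    proof -
      have "complex_of_real x / (2 * w) = 2 * complex_of_real x / (4 * w)" for w by simp
      from this[of ?z] show ?thesis
        using z by (auto intro!: derivative_eq_intros simp del: right_diff_distrib_numeral)
    qed
    from field_vector_diff_chain_at[OF has_vector_derivative_of_real[OF DERIV_ident] this]
    have "((\<lambda>x. exp ((complex_of_real x)\<^sup>2 / (4 * ?z))) has_vector_derivative x / (2 * ?z) * exp (x\<^sup>2 / (4 * ?z))) (at x)"
      by (simp add: o_def)
    from has_vector_derivative_mult[OF gauss_ft_deriv_snd[of s x] this]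
    show "((\<lambda>x. gauss_ft s x * exp ((complex_of_real x)\<^sup>2 / (4 * ?z))) has_vector_derivative 0) (at x within UNIV)"
      by (simp add: algebra_simps)
  qed auto
  then obtain c where c: "\<And>x. gauss_ft s x * exp (complex_of_real x ^ 2 / (4 * ?z)) = c" by auto
  from c[of x] c[of 0] show ?thesis
    by (simp add: exp_minus field_simps)
qed

text \<open>The exact value would be sqrt (pi / z) with a choice of branch. The modulus avoids the
  choice: |G|^2 sqrt (1 + s^2) has derivative zero, and at s = 0 it is the square of the real
  Gaussian integral.\<close>

lemma norm_gauss_ft_0: "(cmod (gauss_ft s 0))\<^sup>2 * sqrt (1 + s\<^sup>2) = pi"
proof -
  define G where "G \<equiv> \<lambda>s. gauss_ft s 0"
  have dG: "(G has_vector_derivative (\<i> / (2 * (1 - \<i> * s)) * G s)) (at s)" for s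
    unfolding G_def by (rule gauss_ft_deriv_fst)
  have "\<exists>c. \<forall>s\<in>UNIV. (G s \<bullet> G s) * sqrt (1 + s\<^sup>2) = c"
  proof (rule has_vector_derivative_zero_constant)
    fix s :: real
    have p: "0 < 1 + s\<^sup>2" by (simp add: add_pos_nonneg)
    \<comment> \<open>Twice the real part, - s / (1 + s^2), is the logarithmic derivative of |G|^2,
      opposite to that of sqrt (1 + s^2).\<close>
    have "\<i> / (2 * (1 - \<i> * s)) = Complex (- s / (2 * (1 + s\<^sup>2))) (1 / (2 * (1 + s\<^sup>2)))"
      using p by (auto simp: complex_eq_iff Re_divide Im_divide power2_eq_square field_simps)
    then have e: "G s \<bullet> (\<i> / (2 * (1 - \<i> * s)) * G s) = - s / (2 * (1 + s\<^sup>2)) * (G s \<bullet> G s)"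
      by (simp only:) (simp add: inner_complex_def algebra_simps add_divide_distrib)
    have "((\<lambda>s. G s \<bullet> G s) has_real_derivative 2 * (G s \<bullet> (\<i> / (2 * (1 - \<i> * s)) * G s))) (at s)"
      unfolding has_field_derivative_def
      by (rule has_derivative_eq_rhs[OF has_derivative_inner[OF dG[of s, unfolded has_vector_derivative_def] dG[of s, unfolded has_vector_derivative_def]]])
        (simp add: fun_eq_iff inner_commute)
    moreover have "((\<lambda>s. sqrt (1 + s\<^sup>2)) has_real_derivative s / sqrt (1 + s\<^sup>2)) (at s)"
      using p by (auto intro!: derivative_eq_intros simp: field_simps)
    ultimately have "((\<lambda>s. (G s \<bullet> G s) * sqrt (1 + s\<^sup>2)) has_real_derivative
        2 * (G s \<bullet> (\<i> / (2 * (1 - \<i> * s)) * G s)) * sqrt (1 + s\<^sup>2) + s / sqrt (1 + s\<^sup>2) * (G s \<bullet> G s)) (at s)"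
      by (rule DERIV_mult)
    also have "2 * (G s \<bullet> (\<i> / (2 * (1 - \<i> * s)) * G s)) * sqrt (1 + s\<^sup>2) + s / sqrt (1 + s\<^sup>2) * (G s \<bullet> G s) = 0"
      unfolding e using p real_sqrt_mult_self[of "1 + s\<^sup>2"] by (simp add: field_simps)
    finally show "((\<lambda>s. (G s \<bullet> G s) * sqrt (1 + s\<^sup>2)) has_vector_derivative 0) (at s within UNIV)"
      by (simp add: has_real_derivative_iff_has_vector_derivative)
  qed auto
  then obtain c where c: "\<And>s. (G s \<bullet> G s) * sqrt (1 + s\<^sup>2) = c" by auto
  have "G 0 = complex_of_real (LINT x|lborel. exp (- x\<^sup>2))"
    unfolding G_def gauss_ft_def gauss_osc_def by (simp flip: exp_of_real integral_complex_of_real)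
  then have "G 0 \<bullet> G 0 = pi"
    by (simp add: integral_gauss inner_complex_def)
  with c[of 0] c[of s] show ?thesis by (simp add: G_def power2_norm_eq_inner)
qed

section \<open>Van der Corput's lemma and the dyadic kernels\<close>

text \<open>With \<open>g = \<phi>' / (l + \<phi>'\<^sup>2)\<close>, the derivative of \<open>a g exp(i\<phi>)\<close> equals \<open>i a exp(i\<phi>)\<close> up to terms dominated
  by the derivative of \<open>arctan (\<phi>' / \<surd>l)\<close>, so no case distinction on stationary points is needed.\<close>

lemma van_der_corput:
  fixes a a' :: "real \<Rightarrow> complex" and \<phi> \<phi>' \<phi>'' :: "real \<Rightarrow> real"
  assumes cd: "c \<le> d" and l: "0 < l" and K: "0 \<le> K" "0 \<le> M"
    and da: "\<And>t. t \<in> {c..d} \<Longrightarrow> (a has_vector_derivative a' t) (at t)"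
    and d1: "\<And>t. t \<in> {c..d} \<Longrightarrow> (\<phi> has_real_derivative \<phi>' t) (at t)"
    and d2: "\<And>t. t \<in> {c..d} \<Longrightarrow> (\<phi>' has_real_derivative \<phi>'' t) (at t)"
    and ca: "continuous_on {c..d} a'" and c2: "continuous_on {c..d} \<phi>''"
    and M: "\<And>t. t \<in> {c..d} \<Longrightarrow> cmod (a t) \<le> M"
    and M': "\<And>t. t \<in> {c..d} \<Longrightarrow> cmod (a' t) \<le> M'"
    and neg: "\<And>t. t \<in> {c..d} \<Longrightarrow> \<phi>'' t \<le> 0"
    and low: "\<And>t. t \<in> {c..d} \<Longrightarrow> l \<le> K * (- \<phi>'' t + l * (\<phi>' t)\<^sup>2)"
  shows "cmod (integral {c..d} (\<lambda>t. a t * exp (\<i> * \<phi> t)))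
     \<le> M * (1 + (1 + K) * pi) / sqrt l + (M' / (2 * sqrt l) + M * K * l) * (d - c)"
proof -
  define D where "D t = l + (\<phi>' t)\<^sup>2" for t
  define g where "g t = \<phi>' t / D t" for t
  define g' where "g' t = \<phi>'' t * (l - (\<phi>' t)\<^sup>2) / (D t)\<^sup>2" for t
  define W where "W t = a t * g t * exp (\<i> * \<phi> t)" for t
  define r where "r t = (a' t * g t + a t * g' t - \<i> * a t * (l / D t)) * exp (\<i> * \<phi> t)" for t
  define B where "B t = (M' / (2 * sqrt l) + M * K * l) * t - M * (1 + K) * (arctan (\<phi>' t / sqrt l) / sqrt l)" for t
  define b where "b t = (M' / (2 * sqrt l) + M * K * l) - M * (1 + K) * (\<phi>'' t / D t)" for t
  have D: "0 < D t" for t using l by (simp add: D_def add_pos_nonneg)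
  have sl: "0 < sqrt l" "sqrt l * sqrt l = l" using l by auto
  \<comment> \<open>By the inequality of the means, 2 |\<phi>'| sqrt l \<le> l + \<phi>'^2: the
    summand l in the denominator keeps g bounded where \<phi>' vanishes.\<close>
  have gb: "\<bar>g t\<bar> \<le> 1 / (2 * sqrt l)" for t
  proof -
    have "0 \<le> (\<bar>\<phi>' t\<bar> - sqrt l)\<^sup>2" by simp
    then have "2 * \<bar>\<phi>' t\<bar> * sqrt l \<le> D t" using l by (simp add: D_def power2_diff)
    then show ?thesis using D[of t] sl by (simp add: g_def abs_mult field_simps)
  qed
  have dphi: "((\<lambda>t. exp (\<i> * \<phi> t)) has_vector_derivative (\<i> * \<phi>' t) * exp (\<i> * \<phi> t)) (at t)" if "t \<in> {c..d}" for t
  proof -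
    have "((\<lambda>z. exp (\<i> * z)) has_field_derivative \<i> * exp (\<i> * \<phi> t)) (at (complex_of_real (\<phi> t)))"
      by (auto intro!: derivative_eq_intros)
    from field_vector_diff_chain_at[OF has_vector_derivative_of_real[OF d1[OF that]] this]
    show ?thesis by (simp add: o_def mult_ac)
  qed
  have dg: "(g has_real_derivative g' t) (at t)" if "t \<in> {c..d}" for t
  proof -
    have "((\<lambda>t. \<phi>' t / (l + (\<phi>' t)\<^sup>2)) has_real_derivative g' t) (at t)"
      unfolding g'_def D_def using D[of t]
      by (auto intro!: derivative_eq_intros d2[OF that] simp: D_def power2_eq_square field_simps)
    then show ?thesis by (simp add: g_def[abs_def] D_def)
  qed
  have dW: "(W has_vector_derivative (\<i> * a t * exp (\<i> * \<phi> t) + r t)) (at t)" if "t \<in> {c..d}" for t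
  proof -
    have e: "\<phi>' t * g t = 1 - l / D t" using D[of t] by (simp add: g_def D_def field_simps power2_eq_square)
    have "(W has_vector_derivative (a t * g t) * ((\<i> * \<phi>' t) * exp (\<i> * \<phi> t)) + (a t * complex_of_real (g' t) + a' t * g t) * exp (\<i> * \<phi> t)) (at t)"
      unfolding W_def[abs_def]
      by (intro has_vector_derivative_mult da dphi that has_vector_derivative_of_real dg)
    also have "(a t * g t) * ((\<i> * \<phi>' t) * exp (\<i> * \<phi> t)) = \<i> * a t * complex_of_real (\<phi>' t * g t) * exp (\<i> * \<phi> t)"
      by simp
    also have "\<dots> = \<i> * a t * exp (\<i> * \<phi> t) - \<i> * a t * (l / D t) * exp (\<i> * \<phi> t)"
      unfolding e by (simp add: algebra_simps)
    finally show ?thesis by (simp add: r_def algebra_simps)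
  qed
  have dB: "(B has_real_derivative b t) (at t)" if "t \<in> {c..d}" for t
  proof -
    have "((\<lambda>t. arctan (\<phi>' t / sqrt l) / sqrt l) has_real_derivative (\<phi>'' t / sqrt l * inverse (1 + (\<phi>' t / sqrt l)\<^sup>2)) / sqrt l) (at t)"
      using DERIV_cdivide[OF DERIV_chain2[OF DERIV_arctan DERIV_cdivide[OF d2[OF that]]], of "sqrt l" "sqrt l"]
      by (simp only: mult.commute)
    also have "(\<phi>'' t / sqrt l * inverse (1 + (\<phi>' t / sqrt l)\<^sup>2)) / sqrt l = \<phi>'' t / D t"
    proof -
      have "1 + (\<phi>' t / sqrt l)\<^sup>2 = D t / l" using l by (simp add: D_def power_divide add_divide_distrib)
      then show ?thesis using sl(2) l by (simp add: field_simps)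
    qed
    finally have A: "((\<lambda>t. arctan (\<phi>' t / sqrt l) / sqrt l) has_real_derivative \<phi>'' t / D t) (at t)" .
    have "(B has_real_derivative (M' / (2 * sqrt l) + M * K * l) * 1 - M * (1 + K) * (\<phi>'' t / D t)) (at t)"
      unfolding B_def[abs_def] by (intro DERIV_diff DERIV_cmult DERIV_ident A)
    then show ?thesis by (simp add: b_def)
  qed
  have rb: "cmod (r t) \<le> b t" if t: "t \<in> {c..d}" for t
  proof -
    have n: "cmod (exp (\<i> * \<phi> t)) = 1" by simp
    have 1: "cmod (a' t * g t) \<le> M' * (1 / (2 * sqrt l))"
      using mult_mono[OF M'[OF t] gb[of t] order_trans[OF norm_ge_zero M'[OF t]]] by (simp add: norm_mult)
    have gt: "\<bar>g' t\<bar> \<le> - \<phi>'' t / D t"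
    proof -
      have "\<bar>l - (\<phi>' t)\<^sup>2\<bar> \<le> D t" using l by (auto simp: D_def abs_le_iff)
      then have "(- \<phi>'' t) * \<bar>l - (\<phi>' t)\<^sup>2\<bar> \<le> (- \<phi>'' t) * D t"
        using neg[OF t] by (intro mult_left_mono) auto
      then have "(- \<phi>'' t) * \<bar>l - (\<phi>' t)\<^sup>2\<bar> / (D t)\<^sup>2 \<le> (- \<phi>'' t) * D t / (D t)\<^sup>2"
        by (intro divide_right_mono) auto
      also have "\<dots> = - \<phi>'' t / D t" using D[of t] by (simp add: power2_eq_square)
      finally show ?thesis using neg[OF t] by (simp add: g'_def abs_mult)
    qed
    have 2: "cmod (a t * g' t) \<le> M * (- \<phi>'' t / D t)"
      using mult_mono[OF M[OF t] gt K(2)] by (simp add: norm_mult)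
    \<comment> \<open>The error term i a l / D stems from \<phi>' g = 1 - l / D. The hypothesis
      \<open>low\<close> trades l / D for a multiple of - \<phi>'' / D, which is minus the
      derivative of an arctangent up to normalisation, plus the constant K l.\<close>
    have "l / D t \<le> K * (- \<phi>'' t + l * (\<phi>' t)\<^sup>2) / D t"
      using low[OF t] D[of t] by (intro divide_right_mono) auto
    also have "\<dots> = K * (- \<phi>'' t / D t) + K * l * ((\<phi>' t)\<^sup>2 / D t)"
      using D[of t] by (simp add: field_simps)
    also have "\<dots> \<le> K * (- \<phi>'' t / D t) + K * l * 1"
      using D[of t] l K by (intro add_left_mono mult_left_mono) (auto simp: D_def)
    finally have lt: "\<bar>l / D t\<bar> \<le> K * (- \<phi>'' t / D t) + K * l" using l D[of t] by simp
    have 3: "cmod (\<i> * a t * (l / D t)) \<le> M * (K * (- \<phi>'' t / D t) + K * l)"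
      using mult_mono[OF M[OF t] lt K(2)] unfolding norm_mult norm_of_real by simp
    have "cmod (r t) \<le> cmod (a' t * g t) + cmod (a t * g' t) + cmod (\<i> * a t * (l / D t))"
      unfolding r_def norm_mult[of _ "exp _"] n
      using norm_triangle_ineq4[of "a' t * g t + a t * g' t" "\<i> * a t * (l / D t)"] norm_triangle_ineq[of "a' t * g t" "a t * g' t"] by simp
    also have "\<dots> \<le> b t" using 1 2 3 by (simp add: b_def algebra_simps add_divide_distrib diff_divide_distrib)
    finally show ?thesis .
  qed
  have cont: "continuous_on {c..d} a" "continuous_on {c..d} \<phi>" "continuous_on {c..d} \<phi>'" "continuous_on {c..d} g"
    using da d1 d2 dg has_vector_derivative_continuous DERIV_isCont
    by (meson continuous_at_imp_continuous_on)+
  have D': "D t \<noteq> 0" for t using D[of t] by simp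
  have cD: "continuous_on {c..d} D"
    unfolding D_def[abs_def] by (intro continuous_intros cont)
  have cg': "continuous_on {c..d} g'"
    unfolding g'_def[abs_def] using D'
    by (intro continuous_intros cont c2 cD) auto
  have cr: "continuous_on {c..d} r"
    unfolding r_def[abs_def] using D'
    by (intro continuous_intros cont c2 ca cg' cD) auto
  have "((\<lambda>t. \<i> * a t * exp (\<i> * \<phi> t) + r t) has_integral (W d - W c)) {c..d}"
    using dW by (intro fundamental_theorem_of_calculus cd) (auto intro: has_vector_derivative_at_within)
  moreover have ri: "r integrable_on {c..d}" using cr by (rule integrable_continuous_real)
  ultimately have "((\<lambda>t. \<i> * a t * exp (\<i> * \<phi> t) + r t - r t) has_integral (W d - W c - integral {c..d} r)) {c..d}"
    by (intro has_integral_diff) (auto simp: integrable_integral)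
  then have "((\<lambda>t. (-\<i>) * (\<i> * a t * exp (\<i> * \<phi> t))) has_integral (-\<i>) * (W d - W c - integral {c..d} r)) {c..d}"
    by (intro has_integral_mult_right) simp
  then have "integral {c..d} (\<lambda>t. a t * exp (\<i> * \<phi> t)) = (-\<i>) * (W d - W c - integral {c..d} r)"
    by (intro integral_unique) (simp add: mult.assoc[symmetric])
  then have "cmod (integral {c..d} (\<lambda>t. a t * exp (\<i> * \<phi> t))) \<le> cmod (W d) + cmod (W c) + cmod (integral {c..d} r)"
    using norm_triangle_ineq4[of "W d - W c" "integral {c..d} r"] norm_triangle_ineq4[of "W d" "W c"] by (simp add: norm_mult)
  moreover have "cmod (integral {c..d} r) \<le> B d - B c"
  proof -
    have bi: "(b has_integral (B d - B c)) {c..d}"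
      using dB by (intro fundamental_theorem_of_calculus cd)
        (auto intro: has_vector_derivative_at_within simp: has_real_derivative_iff_has_vector_derivative)
    then have "cmod (integral {c..d} r) \<le> integral {c..d} b"
      using rb ri by (intro integral_norm_bound_integral) auto
    then show ?thesis using bi by (simp add: integral_unique)
  qed
  moreover have "cmod (W t) \<le> M * (1 / (2 * sqrt l))" if "t \<in> {c..d}" for t
    using mult_mono[OF M[OF that] gb[of t] K(2)] by (simp add: W_def norm_mult)
  then have "cmod (W d) \<le> M * (1 / (2 * sqrt l))" "cmod (W c) \<le> M * (1 / (2 * sqrt l))" using cd by auto
  \<comment> \<open>The arctangent varies by at most pi whatever the size of \<phi>'; this makes the
    bound independent of the phase.\<close>
  moreover have "B d - B c \<le> (M' / (2 * sqrt l) + M * K * l) * (d - c) + M * (1 + K) * (pi / sqrt l)"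
  proof -
    have "arctan (\<phi>' c / sqrt l) - arctan (\<phi>' d / sqrt l) \<le> pi"
      using arctan_bounded[of "\<phi>' c / sqrt l"] arctan_bounded[of "\<phi>' d / sqrt l"] by simp
    then have "(arctan (\<phi>' c / sqrt l) - arctan (\<phi>' d / sqrt l)) / sqrt l \<le> pi / sqrt l"
      using sl by (intro divide_right_mono) auto
    then have "M * (1 + K) * ((arctan (\<phi>' c / sqrt l) - arctan (\<phi>' d / sqrt l)) / sqrt l) \<le> M * (1 + K) * (pi / sqrt l)"
      using K by (intro mult_left_mono) auto
    then show ?thesis by (simp add: B_def algebra_simps diff_divide_distrib)
  qed
  ultimately have "cmod (integral {c..d} (\<lambda>t. a t * exp (\<i> * \<phi> t))) \<le> 2 * (M * (1 / (2 * sqrt l))) + ((M' / (2 * sqrt l) + M * K * l) * (d - c) + M * (1 + K) * (pi / sqrt l))"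
    by linarith
  also have "\<dots> = M * (1 + (1 + K) * pi) / sqrt l + (M' / (2 * sqrt l) + M * K * l) * (d - c)"
    by (simp add: add_divide_distrib ring_distribs)
  finally show ?thesis .
qed

text \<open>The Fourier transform, at a point with |x|^2 = R in dimension n, of exp (-|\<xi>|^2) exp
  ((i (|\<xi>|^2 - 1) - \<delta>) s): a scalar times the Gaussian of parameter 1 - i s. Integrated
  over a dyadic interval of s it becomes the kernel of one dyadic piece.\<close>

definition osc_kernel :: "nat \<Rightarrow> real \<Rightarrow> real \<Rightarrow> real \<Rightarrow> complex" where
  "osc_kernel n \<delta> R s = exp (- (\<delta> + \<i>) * s) * gauss_ft s 0 ^ n * exp (- R / (4 * (1 - \<i> * s)))"

lemma continuous_gauss_ft_0 [continuous_intros]: "continuous_on A (\<lambda>s. gauss_ft s 0)"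
  using gauss_ft_deriv_fst has_vector_derivative_continuous
  by (meson continuous_at_imp_continuous_on)

lemma one_minus_i_neq_0 [simp]: "1 - \<i> * complex_of_real s \<noteq> 0"
  by (auto simp: complex_eq_iff)

lemma continuous_osc_kernel: "continuous_on A (osc_kernel n \<delta> R)"
  unfolding osc_kernel_def by (intro continuous_intros) auto

lemma norm_gauss_ft_0_le:
  shows "cmod (gauss_ft s 0) \<le> 2" "0 < s \<Longrightarrow> cmod (gauss_ft s 0) \<le> 2 / sqrt s"
proof -
  have p: "pi \<le> 4" using pi_less_4 by simp
  have "1 \<le> sqrt (1 + s\<^sup>2)" by simp
  then have "(cmod (gauss_ft s 0))\<^sup>2 * 1 \<le> (cmod (gauss_ft s 0))\<^sup>2 * sqrt (1 + s\<^sup>2)"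
    by (intro mult_left_mono) auto
  then have "(cmod (gauss_ft s 0))\<^sup>2 \<le> 2\<^sup>2" using norm_gauss_ft_0[of s] p by simp
  then show "cmod (gauss_ft s 0) \<le> 2" by (rule power2_le_imp_le) simp
  assume s: "0 < s"
  have "s \<le> sqrt (1 + s\<^sup>2)" by (rule real_le_rsqrt) simp
  then have "(cmod (gauss_ft s 0))\<^sup>2 * s \<le> (cmod (gauss_ft s 0))\<^sup>2 * sqrt (1 + s\<^sup>2)"
    by (intro mult_left_mono) auto
  then have "(cmod (gauss_ft s 0))\<^sup>2 * s \<le> 4" using norm_gauss_ft_0[of s] p by simp
  then have "(cmod (gauss_ft s 0))\<^sup>2 \<le> (2 / sqrt s)\<^sup>2" using s by (simp add: power_divide field_simps)
  then show "cmod (gauss_ft s 0) \<le> 2 / sqrt s" by (rule power2_le_imp_le) (use s in simp)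
qed

lemma inverse_one_minus_i: "1 / (1 - \<i> * complex_of_real s) = (1 + \<i> * s) / (1 + s\<^sup>2)"
proof -
  have "1 + (complex_of_real s)\<^sup>2 \<noteq> 0"
    by (metis add.commute of_real_1 of_real_add of_real_eq_0_iff of_real_power power_one sum_power2_eq_zero_iff zero_neq_one)
  then show ?thesis by (simp add: field_simps power2_eq_square)
qed

lemma osc_kernel_exponent:
  "- complex_of_real R / (4 * (1 - \<i> * complex_of_real s)) = - complex_of_real R / 4 * ((1 + \<i> * s) / complex_of_real (1 + s\<^sup>2))"
proof -
  have "- complex_of_real R / (4 * w) = - complex_of_real R / 4 * (1 / w)" for w by simp
  then show ?thesis by (simp only: inverse_one_minus_i)
qed

lemma norm_osc_kernel_le:
  assumes "0 \<le> \<delta>" "0 \<le> R" "0 \<le> s"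
  shows "cmod (osc_kernel n \<delta> R s) \<le> 2 ^ n"
proof -
  have "Re (- complex_of_real R / (4 * (1 - \<i> * s))) = - R / (4 * (1 + s\<^sup>2))"
    unfolding osc_kernel_exponent by (simp del: of_real_add of_real_power)
  also have "\<dots> \<le> 0" using assms by (simp add: divide_nonpos_pos add_pos_nonneg)
  finally have "exp (Re (- complex_of_real R / (4 * (1 - \<i> * s)))) \<le> 1" by simp
  moreover have "exp (- \<delta> * s) \<le> 1" using assms by simp
  moreover have "cmod (gauss_ft s 0) ^ n \<le> 2 ^ n" using norm_gauss_ft_0_le(1) by (intro power_mono) auto
  ultimately have "exp (- \<delta> * s) * cmod (gauss_ft s 0) ^ n * exp (Re (- complex_of_real R / (4 * (1 - \<i> * s)))) \<le> 1 * 2 ^ n * 1"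
    by (intro mult_mono) auto
  then show ?thesis by (simp add: osc_kernel_def norm_mult norm_power norm_exp_eq_Re)
qed

text \<open>This is the hypothesis \<open>low\<close> of van der Corput's lemma for the phase - s -
  R s / (4 (1 + s^2)), with l = 1 / J and K = 8. If R \<le> 2 s^2, the slope is at most - 1/2 and
  its square alone suffices; otherwise the curvature is at least of order 1 / J. The restriction 2
  \<le> s makes s^2 - 3 comparable to s^2.\<close>

lemma osc_kernel_phase_lower:
  fixes s J R :: real
  assumes s: "2 \<le> s" "s \<le> J" and R: "0 \<le> R"
  shows "1 / J \<le> 8 * (R / 2 * s * (s\<^sup>2 - 3) / (1 + s\<^sup>2) ^ 3 + 1 / J * (- 1 + R / 4 * ((s\<^sup>2 - 1) / (1 + s\<^sup>2)\<^sup>2))\<^sup>2)"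
proof (cases "R \<le> 2 * s\<^sup>2")
  case True
  have s4: "4 \<le> s\<^sup>2" using s power_mono[of 2 s 2] by simp
  have "(s\<^sup>2 - 1) / (1 + s\<^sup>2)\<^sup>2 \<le> 1 / s\<^sup>2"
  proof -
    have "(s\<^sup>2 - 1) * s\<^sup>2 \<le> 1 * (1 + s\<^sup>2)\<^sup>2" by (simp add: power2_eq_square algebra_simps)
    then have "(s\<^sup>2 - 1) * s\<^sup>2 / (1 + s\<^sup>2)\<^sup>2 \<le> 1" using s4 by (subst divide_le_eq_1_pos) auto
    then show ?thesis using s4 by (subst pos_le_divide_eq) auto
  qed
  then have "R / 4 * ((s\<^sup>2 - 1) / (1 + s\<^sup>2)\<^sup>2) \<le> R / 4 * (1 / s\<^sup>2)" using R by (intro mult_left_mono) auto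
  also have "\<dots> \<le> 1 / 2" using True s4 by (simp add: divide_le_eq)
  finally have "1 / 2 \<le> 1 - R / 4 * ((s\<^sup>2 - 1) / (1 + s\<^sup>2)\<^sup>2)" by simp
  then have "(1 / 2)\<^sup>2 \<le> (1 - R / 4 * ((s\<^sup>2 - 1) / (1 + s\<^sup>2)\<^sup>2))\<^sup>2" by (intro power_mono) auto
  then have "1 / 4 \<le> (- 1 + R / 4 * ((s\<^sup>2 - 1) / (1 + s\<^sup>2)\<^sup>2))\<^sup>2" by (simp add: power2_commute[of 1] power_one_over)
  then have "1 / J * (1 / 4) \<le> 1 / J * (- 1 + R / 4 * ((s\<^sup>2 - 1) / (1 + s\<^sup>2)\<^sup>2))\<^sup>2" using s by (intro mult_left_mono) auto
  moreover have "0 \<le> R / 2 * s * (s\<^sup>2 - 3) / (1 + s\<^sup>2) ^ 3" using s s4 R by simp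
  moreover have "0 < 1 / J" using s by simp
  moreover have "j \<le> 8 * (A + B)" if "j * (1 / 4) \<le> B" "0 \<le> A" "0 < j" for j A B :: real
  proof -
    have "j \<le> 4 * B" using that by simp
    then show ?thesis using that by argo
  qed
  ultimately show ?thesis by blast
next
  case False
  have s4: "4 \<le> s\<^sup>2" using s power_mono[of 2 s 2] by simp
  have "(1 + s\<^sup>2) ^ 3 \<le> (5 / 4 * s\<^sup>2) ^ 3" using s4 by (intro power_mono) auto
  also have "\<dots> = 125 / 64 * (s * s * s * s\<^sup>2) * s" by (simp add: power2_eq_square power3_eq_cube)
  also have "\<dots> \<le> 125 / 64 * (s * s * s * s\<^sup>2) * J" using s by (intro mult_left_mono) auto
  finally have 1: "(1 + s\<^sup>2) ^ 3 \<le> 125 / 64 * (s * s * s * s\<^sup>2) * J" .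
  have "s\<^sup>2 * s * (s\<^sup>2 / 4) \<le> R / 2 * s * (s\<^sup>2 - 3)"
    using False s4 s R by (intro mult_mono) auto
  moreover have "s\<^sup>2 * s * (s\<^sup>2 / 4) = s * s * s * s\<^sup>2 / 4" by (simp add: power2_eq_square)
  ultimately have "s * s * s * s\<^sup>2 / 4 \<le> R / 2 * s * (s\<^sup>2 - 3)" by metis
  then have "8 * (s * s * s * s\<^sup>2 / 4) * J \<le> 8 * (R / 2 * s * (s\<^sup>2 - 3)) * J" using s
    by (intro mult_right_mono mult_left_mono) auto
  moreover have "0 \<le> (s * s * s * s\<^sup>2) * J" using s by simp
  moreover have "C \<le> Q" if "8 * (T / 4) * J \<le> Q" "0 \<le> T * J" "C \<le> 125 / 64 * T * J" for C T Q :: real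
  proof -
    have "8 * (T / 4) * J = 2 * (T * J)" "125 / 64 * T * J = 125 / 64 * (T * J)" by simp_all
    with that show ?thesis by argo
  qed
  ultimately have "(1 + s\<^sup>2) ^ 3 \<le> 8 * (R / 2 * s * (s\<^sup>2 - 3)) * J" using 1 by blast
  then have "1 / J \<le> 8 * (R / 2 * s * (s\<^sup>2 - 3) / (1 + s\<^sup>2) ^ 3)"
  proof -
    assume a: "(1 + s\<^sup>2) ^ 3 \<le> 8 * (R / 2 * s * (s\<^sup>2 - 3)) * J"
    have D: "0 < (1 + s\<^sup>2) ^ 3" using s4 by simp
    have J: "0 < J" using s by simp
    have "(1 + s\<^sup>2) ^ 3 / ((1 + s\<^sup>2) ^ 3 * J) \<le> 8 * (R / 2 * s * (s\<^sup>2 - 3)) * J / ((1 + s\<^sup>2) ^ 3 * J)"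
      using D J by (intro divide_right_mono a) auto
    then show ?thesis using D J by (simp del: power_Suc)
  qed
  moreover have "0 \<le> 1 / J * (- 1 + R / 4 * ((s\<^sup>2 - 1) / (1 + s\<^sup>2)\<^sup>2))\<^sup>2" using s by simp
  ultimately show ?thesis by simp
qed

text \<open>The amplitude \<open>a\<close> collects the decaying exponentials and the power of the
  Gaussian transform, the phase the pure oscillation. On [J/2, J] the amplitude is of size J powr (-
  n / 2) and its derivative is smaller by a factor 1 / J, so van der Corput's lemma with l = 1 / J
  costs sqrt J where the trivial estimate costs J. No bound may depend on \<delta> or R. The
  assumption 4 \<le> J keeps the interval inside s \<ge> 2.\<close>

lemma osc_kernel_dyadic_bound_large:
  assumes J: "4 \<le> J" and \<delta>: "0 \<le> \<delta>" and R: "0 \<le> R"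
  shows "cmod (integral {J/2..J} (osc_kernel n \<delta> R)) \<le> (2 * sqrt 2) ^ n * (50 + n) * sqrt J / sqrt J ^ n"
proof -
  define a where "a s = exp (- complex_of_real \<delta> * s) * gauss_ft s 0 ^ n * exp (- complex_of_real (R / (4 * (1 + s\<^sup>2))))" for s :: real
  \<comment> \<open>The logarithmic derivative of the amplitude, one summand for each of its three
    factors.\<close>
  define e where "e s = - complex_of_real \<delta> + n * \<i> / (2 * (1 - \<i> * s)) + complex_of_real (R * s / (2 * (1 + s\<^sup>2)\<^sup>2))" for s :: real
  define \<phi> where "\<phi> s = - s - R * s / (4 * (1 + s\<^sup>2))" for s :: real
  define M where "M = (2 * sqrt 2) ^ n / sqrt J ^ n"
  have M0: "0 \<le> M" using J by (simp add: M_def)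
  have ps: "0 < 1 + s\<^sup>2" for s :: real by (simp add: add_pos_nonneg)
  then have ps': "1 + s\<^sup>2 \<noteq> 0" for s :: real by (metis less_irrefl)
  have ker: "osc_kernel n \<delta> R s = a s * exp (\<i> * \<phi> s)" for s
  proof -
    have "- complex_of_real R / (4 * (1 - \<i> * complex_of_real s)) = - complex_of_real R / 4 * ((1 + \<i> * s) / complex_of_real (1 + s\<^sup>2))"
      by (rule osc_kernel_exponent)
    also have "\<dots> = - complex_of_real (R / (4 * (1 + s\<^sup>2))) - \<i> * complex_of_real (R * s / (4 * (1 + s\<^sup>2)))"
      by (simp add: add_divide_distrib ring_distribs)
    finally have X: "- complex_of_real R / (4 * (1 - \<i> * complex_of_real s)) = - complex_of_real (R / (4 * (1 + s\<^sup>2))) - \<i> * complex_of_real (R * s / (4 * (1 + s\<^sup>2)))" .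
    have "exp (- (\<delta> + \<i>) * s) * exp (- complex_of_real R / (4 * (1 - \<i> * complex_of_real s)))
      = exp (- complex_of_real \<delta> * s) * exp (- complex_of_real (R / (4 * (1 + s\<^sup>2)))) * exp (\<i> * \<phi> s)"
      unfolding X mult_exp_exp \<phi>_def by (rule arg_cong[where f=exp]) (simp add: algebra_simps)
    then show ?thesis by (simp add: osc_kernel_def a_def mult_ac)
  qed
  have G: "((\<lambda>s. gauss_ft s 0 ^ m) has_vector_derivative m * (\<i> / (2 * (1 - \<i> * s))) * gauss_ft s 0 ^ m) (at s)" for m s
  proof -
    have "((\<lambda>z. z ^ m) has_field_derivative m * gauss_ft s 0 ^ (m - 1)) (at (gauss_ft s 0))"
      by (auto intro!: derivative_eq_intros)
    from field_vector_diff_chain_at[OF gauss_ft_deriv_fst this]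
    have "((\<lambda>s. gauss_ft s 0 ^ m) has_vector_derivative (\<i> / (2 * (1 - \<i> * s)) * gauss_ft s 0) * (m * gauss_ft s 0 ^ (m - 1))) (at s)"
      by (simp add: o_def)
    moreover have "(\<i> / (2 * (1 - \<i> * s)) * gauss_ft s 0) * (m * gauss_ft s 0 ^ (m - 1)) = m * (\<i> / (2 * (1 - \<i> * s))) * gauss_ft s 0 ^ m"
      by (cases m) (simp_all add: mult_ac)
    ultimately show ?thesis by metis
  qed
  have da: "(a has_vector_derivative a s * e s) (at s)" for s
  proof -
    have 1: "((\<lambda>s. complex_of_real (exp (- \<delta> * s))) has_vector_derivative complex_of_real (- \<delta> * exp (- \<delta> * s))) (at s)"
      by (rule has_vector_derivative_of_real) (auto intro!: derivative_eq_intros)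
    have "((\<lambda>s. exp (- (R / (4 * (1 + s\<^sup>2))))) has_real_derivative (R * s / (2 * (1 + s\<^sup>2)\<^sup>2)) * exp (- (R / (4 * (1 + s\<^sup>2))))) (at s)"
    proof -
      have d: "((\<lambda>s. - (R / 4) * inverse (1 + s\<^sup>2)) has_real_derivative - (R / 4) * (- (inverse (1 + s\<^sup>2) * (2 * s) * inverse (1 + s\<^sup>2)))) (at s)"
        using ps'[of s] by (auto intro!: derivative_eq_intros)
      have v: "- (R / 4) * (- (inverse Q * (2 * s) * inverse Q)) = R * s / (2 * Q\<^sup>2)" "- (R / (4 * Q)) = - (R / 4) * inverse Q" for Q
        by (cases "Q = 0"; simp add: field_simps power2_eq_square)+
      have "((\<lambda>s. - (R / (4 * (1 + s\<^sup>2)))) has_real_derivative R * s / (2 * (1 + s\<^sup>2)\<^sup>2)) (at s)"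
        unfolding v(2) using d unfolding v(1) .
      from DERIV_chain2[OF DERIV_exp this] show ?thesis by (simp only: mult.commute)
    qed
    then have 2: "((\<lambda>s. complex_of_real (exp (- (R / (4 * (1 + s\<^sup>2)))))) has_vector_derivative complex_of_real ((R * s / (2 * (1 + s\<^sup>2)\<^sup>2)) * exp (- (R / (4 * (1 + s\<^sup>2)))))) (at s)"
      by (rule has_vector_derivative_of_real)
    have ae: "a = (\<lambda>s. complex_of_real (exp (- \<delta> * s)) * gauss_ft s 0 ^ n * complex_of_real (exp (- (R / (4 * (1 + s\<^sup>2))))))"
      by (simp add: a_def fun_eq_iff exp_of_real[symmetric])
    show ?thesis unfolding ae
      by (rule has_vector_derivative_eq_rhs[OF has_vector_derivative_mult[OF has_vector_derivative_mult[OF 1 G] 2]])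
        (simp add: e_def algebra_simps)
  qed
  have na: "cmod (a s) = exp (- \<delta> * s) * cmod (gauss_ft s 0) ^ n * exp (- (R / (4 * (1 + s\<^sup>2))))" for s
    unfolding a_def by (simp add: norm_mult norm_power norm_exp_eq_Re del: of_real_divide of_real_mult flip: of_real_minus of_real_mult)
  have gM: "cmod (gauss_ft s 0) ^ n \<le> M" if "s \<in> {J/2..J}" for s
  proof -
    have "cmod (gauss_ft s 0) \<le> 2 / sqrt s" using norm_gauss_ft_0_le(2)[of s] that J by simp
    also have "\<dots> \<le> 2 / sqrt (J / 2)" using that J by (intro divide_left_mono) auto
    also have "\<dots> = 2 * sqrt 2 / sqrt J" using J by (simp add: real_sqrt_divide)
    finally have "cmod (gauss_ft s 0) ^ n \<le> (2 * sqrt 2 / sqrt J) ^ n" by (intro power_mono) auto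
    then show ?thesis by (simp add: M_def power_divide)
  qed
  \<comment> \<open>The summands of \<open>e\<close> that grow with \<delta> or R are multiplied by
    exponentials decaying in the same quantity; this inequality absorbs them and makes the bound
    uniform in both.\<close>
  have xe: "x * exp (- x) \<le> 1" for x :: real
  proof -
    have "x \<le> exp x" using exp_ge_add_one_self[of x] by linarith
    then show ?thesis by (simp add: exp_minus field_simps)
  qed
  have "cmod (integral {J/2..J} (\<lambda>s. a s * exp (\<i> * \<phi> s)))
     \<le> M * (1 + (1 + 8) * pi) / sqrt (1 / J) + (((3 + n) * M * (2 / J)) / (2 * sqrt (1 / J)) + M * 8 * (1 / J)) * (J - J / 2)"
  proof (rule van_der_corput[where \<phi>' = "\<lambda>s. - 1 + R / 4 * ((s\<^sup>2 - 1) / (1 + s\<^sup>2)\<^sup>2)" and \<phi>'' = "\<lambda>s. - (R / 2 * s * (s\<^sup>2 - 3) / (1 + s\<^sup>2) ^ 3)" and a' = "\<lambda>s. a s * e s"])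
    fix s assume s: "s \<in> {J/2..J}"
    then have s2: "2 \<le> s" using J by auto
    then have s4: "4 \<le> s\<^sup>2" using power_mono[of 2 s 2] by simp
    show "(a has_vector_derivative a s * e s) (at s)" by (rule da)
    show "(\<phi> has_real_derivative - 1 + R / 4 * ((s\<^sup>2 - 1) / (1 + s\<^sup>2)\<^sup>2)) (at s)"
    proof -
      have "((\<lambda>s. - s - R / 4 * (s / (1 + s\<^sup>2))) has_real_derivative - 1 - R / 4 * ((1 * (1 + s\<^sup>2) - s * (0 + 2 * s ^ (2 - 1) * 1)) / ((1 + s\<^sup>2) * (1 + s\<^sup>2)))) (at s)"
        using ps'[of s] by (intro DERIV_diff DERIV_minus DERIV_ident DERIV_cmult DERIV_divide) (auto intro!: derivative_eq_intros)
      moreover have "(\<lambda>s. - s - R / 4 * (s / (1 + s\<^sup>2))) = \<phi>" by (simp add: \<phi>_def fun_eq_iff)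
      moreover have "1 * (1 + s\<^sup>2) - s * (0 + 2 * s ^ (2 - 1) * 1) = - (s\<^sup>2 - 1)" by (simp add: power2_eq_square)
      moreover have "- 1 - R / 4 * (- A / (Q * Q)) = - 1 + R / 4 * (A / Q\<^sup>2)" for A Q by (simp add: power2_eq_square)
      ultimately show ?thesis by (simp only:)
    qed
    show "((\<lambda>s. - 1 + R / 4 * ((s\<^sup>2 - 1) / (1 + s\<^sup>2)\<^sup>2)) has_real_derivative - (R / 2 * s * (s\<^sup>2 - 3) / (1 + s\<^sup>2) ^ 3)) (at s)"
    proof -
      have "((\<lambda>s. - 1 + R / 4 * ((s\<^sup>2 - 1) / (1 + s\<^sup>2)\<^sup>2)) has_real_derivative
          0 + R / 4 * (((2 * s) * (1 + s\<^sup>2)\<^sup>2 - (s\<^sup>2 - 1) * (2 * (1 + s\<^sup>2) * (2 * s))) / ((1 + s\<^sup>2)\<^sup>2 * (1 + s\<^sup>2)\<^sup>2))) (at s)"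
        using ps'[of s] by (intro DERIV_add DERIV_const DERIV_cmult DERIV_divide) (auto intro!: derivative_eq_intros)
      moreover have "(2 * s) * (1 + s\<^sup>2)\<^sup>2 - (s\<^sup>2 - 1) * (2 * (1 + s\<^sup>2) * (2 * s)) = - ((1 + s\<^sup>2) * (2 * (s * (s\<^sup>2 - 3))))"
        by (simp add: power2_eq_square algebra_simps)
      moreover have "0 + R / 4 * (- (Q * (2 * (s * A))) / (Q\<^sup>2 * Q\<^sup>2)) = - (R / 2 * s * A / Q ^ 3)" if "Q \<noteq> 0" for A Q
        using that by (simp add: power2_eq_square power3_eq_cube mult_ac)
      ultimately show ?thesis using ps'[of s] by (simp only: not_False_eq_True)
    qed
    show "- (R / 2 * s * (s\<^sup>2 - 3) / (1 + s\<^sup>2) ^ 3) \<le> 0" using R s2 s4 by simp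
    show "1 / J \<le> 8 * (- (- (R / 2 * s * (s\<^sup>2 - 3) / (1 + s\<^sup>2) ^ 3)) + 1 / J * (- 1 + R / 4 * ((s\<^sup>2 - 1) / (1 + s\<^sup>2)\<^sup>2))\<^sup>2)"
      using osc_kernel_phase_lower[OF s2 _ R, of J] s by simp
    have e1: "exp (- \<delta> * s) \<le> 1" "exp (- (R / (4 * (1 + s\<^sup>2)))) \<le> 1" using \<delta> R s2 by (auto simp: add_nonneg_nonneg)
    have "cmod (a s) \<le> 1 * M * 1" unfolding na by (intro mult_mono e1 gM s) (auto simp: M0)
    then show "cmod (a s) \<le> M" by simp
    let ?X = "exp (- \<delta> * s)" and ?Y = "cmod (gauss_ft s 0) ^ n" and ?Z = "exp (- (R / (4 * (1 + s\<^sup>2))))"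
    have i: "cmod (complex_of_real n * \<i> / (2 * (1 - \<i> * s))) \<le> n / s"
    proof -
      have "s \<le> cmod (1 - \<i> * s)" using abs_Im_le_cmod[of "1 - \<i> * s"] s2 by simp
      then have "n / (2 * cmod (1 - \<i> * s)) \<le> n / (1 * s)" using s2 by (intro frac_le mult_mono) auto
      then show ?thesis unfolding norm_divide norm_mult by simp
    qed
    have "cmod (a s * e s) \<le> cmod (a s) * (\<delta> + n / s + R * s / (2 * (1 + s\<^sup>2)\<^sup>2))"
    proof -
      have "cmod (e s) \<le> \<delta> + n / s + R * s / (2 * (1 + s\<^sup>2)\<^sup>2)"
        unfolding e_def
        apply (rule order_trans[OF norm_triangle_ineq])
        apply (rule add_mono)
        apply (rule order_trans[OF norm_triangle_ineq])
        using i \<delta> R s2 by (auto simp: norm_divide norm_mult simp del: of_real_divide of_real_mult)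
      then show ?thesis by (simp add: norm_mult mult_left_mono)
    qed
    also have "\<dots> = (\<delta> * ?X) * ?Y * ?Z + (n / s) * ?X * ?Y * ?Z + ?X * ?Y * ((R / (4 * (1 + s\<^sup>2))) * ?Z) * (2 * s / (1 + s\<^sup>2))"
    proof -
      have q: "R * s / (2 * Q\<^sup>2) = (R / (4 * Q)) * (2 * s / Q)" for Q by (simp add: power2_eq_square)
      have "X * Y * Z * (d + m + r * t) = (d * X) * Y * Z + m * X * Y * Z + X * Y * (r * Z) * t" for X Y Z d m r t :: real
        by (simp add: algebra_simps)
      then show ?thesis unfolding na q .
    qed
    \<comment> \<open>The three summands of \<open>e\<close> contribute 1/s, n/s and 2/s; hence the
      constant 3 + n.\<close>
    also have "\<dots> \<le> (1 / s) * M * 1 + (n / s) * 1 * M * 1 + 1 * M * 1 * (2 / s)"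
    proof (intro add_mono mult_mono e1 gM s xe)
      show "\<delta> * ?X \<le> 1 / s" using xe[of "\<delta> * s"] s2 by (simp add: field_simps)
      show "2 * s / (1 + s\<^sup>2) \<le> 2 / s" using s2 ps[of s] by (simp add: field_simps power2_eq_square)
    qed (use s2 M0 ps[of s] R \<delta> in \<open>auto simp: add_nonneg_nonneg\<close>)
    also have "\<dots> = ((3 + n) * M) * (1 / s)" using s2 by (simp add: field_simps)
    also have "\<dots> \<le> ((3 + n) * M) * (2 / J)" using s J M0 by (intro mult_left_mono) (auto simp: field_simps)
    finally show "cmod (a s * e s) \<le> (3 + n) * M * (2 / J)" .
  next
    have "continuous_on UNIV a" using da has_vector_derivative_continuous by (blast intro: continuous_at_imp_continuous_on)
    then have "continuous_on {J/2..J} a" by (rule continuous_on_subset) simp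
    then show "continuous_on {J / 2..J} (\<lambda>s. a s * e s)"
      unfolding e_def[abs_def] using ps' by (intro continuous_intros) auto
    show "continuous_on {J / 2..J} (\<lambda>s. - (R / 2 * s * (s\<^sup>2 - 3) / (1 + s\<^sup>2) ^ 3))"
      using ps' by (intro continuous_intros) auto
  qed (use J M0 in auto)
  also have "\<dots> = M * ((1 + 9 * pi) * sqrt J + (3 + n) / 2 * sqrt J + 4)"
    using J by (simp add: real_sqrt_divide field_simps)
  also have "\<dots> \<le> M * ((50 + n) * sqrt J)"
  proof (intro mult_left_mono M0)
    have j: "1 \<le> sqrt J" using J by simp
    have "(1 + 9 * pi) * sqrt J + (3 + n) / 2 * sqrt J + 4 \<le> (1 + 9 * pi) * sqrt J + (3 + n) / 2 * sqrt J + 4 * sqrt J"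
      using j by simp
    also have "\<dots> = (1 + 9 * pi + (3 + n) / 2 + 4) * sqrt J" by (simp add: algebra_simps)
    also have "\<dots> \<le> (50 + n) * sqrt J"
    proof (rule mult_right_mono)
      have "real (3 + n) / 2 = 3 / 2 + real n / 2" by simp
      then show "1 + 9 * pi + real (3 + n) / 2 + 4 \<le> real (50 + n)"
        using pi_less_4 of_nat_0_le_iff[of n, where 'a=real] unfolding of_nat_add of_nat_numeral by argo
    qed (use j in simp)
    finally show "(1 + 9 * pi) * sqrt J + (3 + n) / 2 * sqrt J + 4 \<le> (50 + n) * sqrt J" .
  qed
  finally show ?thesis unfolding ker[abs_def, symmetric] by (simp add: M_def ker)
qed

text \<open>The intervals from \<open>dyadic_lo j\<close> to 2^j are [0, 1], [1, 2], [2, 4] and so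
  on: they tile the half-line, the first one reaching down to 0, so that sums over j
  telescope.\<close>

definition dyadic_lo :: "nat \<Rightarrow> real" where "dyadic_lo j = (if j = 0 then 0 else 2 ^ (j - 1))"

lemma dyadic_lo_bounds: "0 \<le> dyadic_lo j" "dyadic_lo j \<le> 2 ^ j" "2 ^ j - dyadic_lo j \<le> 2 ^ j" "dyadic_lo (Suc j) = 2 ^ j"
  by (auto simp: dyadic_lo_def intro: power_increasing)

text \<open>For j at least 2 this is the previous estimate with J = 2^j. The first two intervals
  have length 1, and there the trivial size 2^n of the kernel suffices.\<close>

lemma osc_kernel_dyadic_bound:
  obtains C where "0 < C" "\<And>j \<delta> R. 0 \<le> \<delta> \<Longrightarrow> 0 \<le> R \<Longrightarrow>
    cmod (integral {dyadic_lo j..2 ^ j} (osc_kernel n \<delta> R)) \<le> C * (sqrt 2 ^ j) / (sqrt 2 ^ j) ^ n"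
proof
  define C where "C = (2 * sqrt 2) ^ n * (50 + real n)"
  show "0 < C" by (simp add: C_def)
  fix j :: nat and \<delta> R :: real assume a: "0 \<le> \<delta>" "0 \<le> R"
  have sq: "sqrt (2 ^ j) = sqrt 2 ^ j" by (rule real_sqrt_power)
  show "cmod (integral {dyadic_lo j..2 ^ j} (osc_kernel n \<delta> R)) \<le> C * (sqrt 2 ^ j) / (sqrt 2 ^ j) ^ n"
  proof (cases "j < 2")
    case False
    then have "(2::real) ^ 2 \<le> 2 ^ j" by (intro power_increasing) auto
    moreover have "dyadic_lo j = 2 ^ j / 2" using False by (cases j) (auto simp: dyadic_lo_def)
    ultimately have "4 \<le> (2::real) ^ j" "dyadic_lo j = 2 ^ j / 2" by auto
    then show ?thesis
      using osc_kernel_dyadic_bound_large[of "2 ^ j" \<delta> R n, unfolded sq] a by (simp only: C_def of_nat_add of_nat_numeral)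
  next
    case True
    have "cmod (integral {dyadic_lo j..2 ^ j} (osc_kernel n \<delta> R)) \<le> 2 ^ n * (2 ^ j - dyadic_lo j)"
      using a dyadic_lo_bounds
      by (intro integral_bound continuous_osc_kernel norm_osc_kernel_le) (auto intro: order_trans)
    also have "\<dots> \<le> 2 ^ n * 1" using True by (intro mult_left_mono) (auto simp: dyadic_lo_def less_2_cases_iff)
    also have "\<dots> \<le> C * (sqrt 2 ^ j) / (sqrt 2 ^ j) ^ n"
    proof -
      have j: "j = 0 \<or> j = 1" using True by auto
      have s: "(1::real) \<le> sqrt 2" by simp
      have "2 ^ n * (sqrt 2 ^ j) ^ n \<le> 2 ^ n * sqrt 2 ^ n"
        using j s by (intro mult_left_mono power_mono) auto
      also have "\<dots> \<le> C * 1"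
        unfolding C_def power_mult_distrib using s mult_left_mono[of 1 "50 + real n" "2 ^ n * sqrt 2 ^ n"] by simp
      also have "\<dots> \<le> C * sqrt 2 ^ j" using \<open>0 < C\<close> s by (intro mult_left_mono one_le_power) auto
      finally show ?thesis by (simp add: le_divide_eq)
    qed
    finally show ?thesis .
  qed
qed

section \<open>Quadratic forms in the Fourier transform\<close>

lemma has_bochner_integral_prod_Basis:
  fixes h :: "'a::euclidean_space \<Rightarrow> real \<Rightarrow> complex"
  assumes h: "\<And>b. b \<in> Basis \<Longrightarrow> integrable lborel (h b)"
  shows "integrable lborel (\<lambda>x::'a. \<Prod>b\<in>Basis. h b (x \<bullet> b))"
    and "(LINT x|lborel. (\<Prod>b\<in>Basis. h b (x \<bullet> b))) = (\<Prod>b\<in>(Basis :: 'a set). (LINT t|lborel. h b t))"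
proof -
  interpret product_sigma_finite "\<lambda>b::'a. lborel :: real measure" ..
  let ?T = "\<lambda>f. \<Sum>b\<in>Basis. f b *\<^sub>R b :: 'a"
  have T [measurable]: "?T \<in> (\<Pi>\<^sub>M b\<in>Basis. lborel) \<rightarrow>\<^sub>M borel" by measurable
  have hm [measurable]: "b \<in> Basis \<Longrightarrow> h b \<in> borel_measurable borel" for b
    using borel_measurable_integrable[OF h] by simp
  have m: "(\<lambda>x::'a. \<Prod>b\<in>Basis. h b (x \<bullet> b)) \<in> borel_measurable borel"
    by (intro borel_measurable_prod) measurable
  have e: "(\<Prod>b\<in>Basis. h b (?T f \<bullet> b)) = (\<Prod>b\<in>Basis. h b (f b))" for f
    by (intro prod.cong) auto
  show "integrable lborel (\<lambda>x::'a. \<Prod>b\<in>Basis. h b (x \<bullet> b))"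
    unfolding lborel_eq[where 'a='a]
    by (subst integrable_distr_eq[OF T m], subst e, rule product_integrable_prod) (use h in auto)
  show "(LINT x|lborel. (\<Prod>b\<in>Basis. h b (x \<bullet> b))) = (\<Prod>b\<in>(Basis :: 'a set). (LINT t|lborel. h b t))"
    unfolding lborel_eq[where 'a='a]
    by (subst integral_distr[OF T m], subst e, rule product_integral_prod) (use h in auto)
qed

definition gauss_osc_n :: "real \<Rightarrow> 'a \<Rightarrow> 'a::euclidean_space \<Rightarrow> complex" where
  "gauss_osc_n s x \<xi> = exp (- (1 - \<i> * s) * (norm \<xi>)\<^sup>2 + \<i> * (x \<bullet> \<xi>))"

lemma power2_norm_eq_sum_Basis: "(norm x)\<^sup>2 = (\<Sum>b\<in>Basis. (x \<bullet> b)\<^sup>2)" for x :: "'a::euclidean_space"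
  unfolding power2_norm_eq_inner by (subst euclidean_inner) (simp add: power2_eq_square)

lemma gauss_osc_n_prod: "gauss_osc_n s x \<xi> = (\<Prod>b\<in>Basis. gauss_osc s (x \<bullet> b) (\<xi> \<bullet> b))"
proof -
  have "complex_of_real ((norm \<xi>)\<^sup>2) = (\<Sum>b\<in>Basis. (complex_of_real (\<xi> \<bullet> b))\<^sup>2)"
    by (simp add: power2_norm_eq_sum_Basis del: of_real_power) simp
  moreover have "complex_of_real (x \<bullet> \<xi>) = (\<Sum>b\<in>Basis. complex_of_real (x \<bullet> b) * complex_of_real (\<xi> \<bullet> b))"
    by (subst euclidean_inner) simp
  ultimately show ?thesis
    by (simp add: gauss_osc_n_def gauss_osc_def exp_sum[symmetric] sum.distrib sum_distrib_left mult_ac)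
qed

lemma integrable_gauss_osc_n: "integrable lborel (gauss_osc_n s x)"
  using has_bochner_integral_prod_Basis(1)[of "\<lambda>b. gauss_osc s (x \<bullet> b)"]
  by (simp add: gauss_osc_n_prod[abs_def] integrable_gauss_osc)

lemma norm_gauss_osc_n: "cmod (gauss_osc_n s x \<xi>) = exp (- (norm \<xi>)\<^sup>2)"
  by (simp add: gauss_osc_n_def norm_exp_eq_Re flip: of_real_power)

lemma integrable_gauss_n: "integrable lborel (\<lambda>\<xi>::'a::euclidean_space. exp (- (norm \<xi>)\<^sup>2))"
  using integrable_norm[OF integrable_gauss_osc_n[of 0 0]] by (simp add: norm_gauss_osc_n)

lemma integral_gauss_osc_n:
  "(LINT \<xi>|lborel. gauss_osc_n s x \<xi>) = gauss_ft s 0 ^ DIM('a) * exp (- (norm x)\<^sup>2 / (4 * (1 - \<i> * s)))"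
  for x :: "'a::euclidean_space"
proof -
  have "(LINT \<xi>|lborel. gauss_osc_n s x \<xi>) = (\<Prod>b\<in>(Basis::'a set). gauss_ft s (x \<bullet> b))"
    using has_bochner_integral_prod_Basis(2)[of "\<lambda>b. gauss_osc s (x \<bullet> b)"]
    by (simp add: gauss_osc_n_prod[abs_def] integrable_gauss_osc gauss_ft_def)
  also have "\<dots> = gauss_ft s 0 ^ DIM('a) * (\<Prod>b\<in>(Basis::'a set). exp (- (complex_of_real (x \<bullet> b))\<^sup>2 / (4 * (1 - \<i> * s))))"
    by (subst gauss_ft_eq) (simp add: prod.distrib)
  also have "(\<Prod>b\<in>(Basis::'a set). exp (- (complex_of_real (x \<bullet> b))\<^sup>2 / (4 * (1 - \<i> * s)))) = exp (- (norm x)\<^sup>2 / (4 * (1 - \<i> * s)))"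
  proof -
    have "complex_of_real ((norm x)\<^sup>2) = (\<Sum>b\<in>Basis. (complex_of_real (x \<bullet> b))\<^sup>2)"
      by (simp add: power2_norm_eq_sum_Basis del: of_real_power) simp
    then show ?thesis by (simp add: exp_sum[symmetric] sum_negf sum_divide_distrib[symmetric])
  qed
  finally show ?thesis .
qed

lemma iexp_borel [measurable]: "(\<lambda>x. iexp (c * (x \<bullet> y))) \<in> borel_measurable borel"
  for y :: "'a::euclidean_space"
  by (intro borel_measurable_continuous_onI continuous_intros)

lemma fourier_lborel:
  "f \<in> borel_measurable borel \<Longrightarrow> fourier f \<xi> = (LINT x|lborel. iexp (x \<bullet> \<xi>) * f x)"
  unfolding fourier_def using iexp_borel[of 1 \<xi>] by (intro integral_completion) simp

lemma integrable_iexp_mult: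
  fixes f :: "'a::euclidean_space \<Rightarrow> complex"
  assumes "integrable lborel f"
  shows "integrable lborel (\<lambda>x. iexp (c * (x \<bullet> \<xi>)) * f x)"
  by (rule Bochner_Integration.integrable_bound[OF assms])
    (use borel_measurable_integrable[OF assms] in \<open>auto simp: norm_mult\<close>)

lemma norm_fourier_integral_le:
  fixes f :: "'a::euclidean_space \<Rightarrow> complex"
  shows "cmod (LINT x|lborel. iexp (c * (x \<bullet> \<xi>)) * f x) \<le> (LINT x|lborel. cmod (f x))"
  by (rule order_trans[OF integral_norm_bound]) (simp add: norm_mult)

lemma fourier_integral_measurable [measurable]:
  fixes f :: "'a::euclidean_space \<Rightarrow> complex"
  assumes [measurable]: "f \<in> borel_measurable borel"
  shows "(\<lambda>\<xi>. LINT x|lborel. iexp (c * (x \<bullet> \<xi>)) * f x) \<in> borel_measurable borel"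
proof -
  have [measurable]: "(\<lambda>z. iexp (c * (snd z \<bullet> fst z))) \<in> borel_measurable (borel \<Otimes>\<^sub>M (borel :: 'a measure))"
    unfolding borel_prod by (intro borel_measurable_continuous_onI continuous_intros)
  show ?thesis
    by (rule lborel.borel_measurable_lebesgue_integral) (simp add: split_beta')
qed

lemma integrable_mult_bounded:
  fixes M h :: "'a::euclidean_space \<Rightarrow> complex"
  assumes M: "integrable lborel M" and h [measurable]: "h \<in> borel_measurable borel" and "\<And>x. cmod (h x) \<le> B"
  shows "integrable lborel (\<lambda>x. M x * h x)"
proof (rule Bochner_Integration.integrable_bound[OF integrable_mult_right[OF M, of "complex_of_real B"]])
  have [measurable]: "M \<in> borel_measurable borel" using borel_measurable_integrable[OF M] by simp
  show "(\<lambda>x. M x * h x) \<in> borel_measurable lborel" by simp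
  show "AE x in lborel. norm (M x * h x) \<le> norm (complex_of_real B * M x)"
    using assms(3) by (auto simp: norm_mult mult.commute[of "cmod (M _)"] intro!: mult_right_mono order_trans[OF assms(3)])
qed

text \<open>Fubini for f x * M \<xi> times a unimodular factor, which is absolutely integrable. The
  sign c is free because conjugated transforms come with c = -1.\<close>

lemma fourier_multiplication_formula:
  fixes M f :: "'a::euclidean_space \<Rightarrow> complex"
  assumes M: "integrable lborel M" and f: "integrable lborel f"
  shows "(LINT \<xi>|lborel. M \<xi> * (LINT x|lborel. iexp (c * (x \<bullet> \<xi>)) * f x))
     = (LINT x|lborel. f x * (LINT \<xi>|lborel. iexp (c * (x \<bullet> \<xi>)) * M \<xi>))"
proof -
  have [measurable]: "M \<in> borel_measurable borel" "f \<in> borel_measurable borel"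
    using borel_measurable_integrable[OF M] borel_measurable_integrable[OF f] by auto
  have [measurable]: "(\<lambda>z. iexp (c * (fst z \<bullet> snd z))) \<in> borel_measurable (borel \<Otimes>\<^sub>M (borel :: 'a measure))"
    unfolding borel_prod by (intro borel_measurable_continuous_onI continuous_intros)
  let ?H = "\<lambda>x \<xi>. f x * (iexp (c * (x \<bullet> \<xi>)) * M \<xi>)"
  have "integrable (lborel \<Otimes>\<^sub>M lborel) (case_prod ?H)"
  proof (rule lborel_pair.Fubini_integrable)
    show "case_prod ?H \<in> borel_measurable (lborel \<Otimes>\<^sub>M lborel)" by (simp add: split_beta')
    show "integrable lborel (\<lambda>x. LINT y|lborel. norm (case (x, y) of (x, \<xi>) \<Rightarrow> ?H x \<xi>))"
      using f by (simp add: norm_mult)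
    show "AE x in lborel. integrable lborel (\<lambda>y. case (x, y) of (x, \<xi>) \<Rightarrow> ?H x \<xi>)"
    proof (rule AE_I2)
      fix x
      have "integrable lborel (\<lambda>y. f x * (iexp (c * (y \<bullet> x)) * M y))"
        by (intro integrable_mult_right integrable_iexp_mult M)
      then show "integrable lborel (\<lambda>y. case (x, y) of (x, \<xi>) \<Rightarrow> ?H x \<xi>)" by (simp add: inner_commute)
    qed
  qed
  from lborel_pair.Fubini_integral[OF this]
  have "(LINT \<xi>|lborel. LINT x|lborel. ?H x \<xi>) = (LINT x|lborel. LINT \<xi>|lborel. ?H x \<xi>)" .
  moreover have "(LINT \<xi>|lborel. LINT x|lborel. ?H x \<xi>) = (LINT \<xi>|lborel. M \<xi> * (LINT x|lborel. iexp (c * (x \<bullet> \<xi>)) * f x))"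
    by (intro Bochner_Integration.integral_cong refl) (simp add: mult_ac flip: integral_mult_right_zero)
  ultimately show ?thesis by simp
qed

lemma cnj_fourier:
  fixes g :: "'a::euclidean_space \<Rightarrow> complex"
  assumes "g \<in> borel_measurable borel"
  shows "cnj (fourier g \<xi>) = (LINT x|lborel. iexp ((-1) * (x \<bullet> \<xi>)) * cnj (g x))"
  unfolding fourier_lborel[OF assms]
  by (subst integral_bounded_linear'[OF bounded_linear_cnj bounded_linear_cnj, symmetric]) (auto simp: exp_cnj intro: exI[of _ 1])

text \<open>The multiplication formula is used twice, for f with c = 1 and for the conjugate of g
  with c = -1. The multiplier turns into a convolution kernel, its transform at x - y, so that a
  supremum bound on the kernel becomes an L^1 bound on the form.\<close>

lemma fourier_form_eq:
  fixes M f g :: "'a::euclidean_space \<Rightarrow> complex"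
  assumes M: "integrable lborel M" and f: "integrable lborel f" and g: "integrable lborel g"
  shows "(LINT \<xi>|lborel. M \<xi> * fourier f \<xi> * cnj (fourier g \<xi>))
    = (LINT x|lborel. f x * (LINT y|lborel. cnj (g y) * (LINT \<xi>|lborel. iexp ((x - y) \<bullet> \<xi>) * M \<xi>)))"
proof -
  have fm [measurable]: "f \<in> borel_measurable borel" and gm [measurable]: "g \<in> borel_measurable borel"
    using borel_measurable_integrable[OF f] borel_measurable_integrable[OF g] by auto
  have Fg [measurable]: "(\<lambda>\<xi>. cnj (fourier g \<xi>)) \<in> borel_measurable borel"
    unfolding cnj_fourier[OF gm] by (rule fourier_integral_measurable[OF measurable_compose[OF gm]])
      (intro borel_measurable_continuous_onI continuous_intros)
  have Mg: "integrable lborel (\<lambda>\<xi>. M \<xi> * cnj (fourier g \<xi>))"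
    by (rule integrable_mult_bounded[OF M Fg, of "LINT x|lborel. cmod (cnj (g x))"]) (unfold cnj_fourier[OF gm], rule norm_fourier_integral_le)
  have "(LINT \<xi>|lborel. M \<xi> * fourier f \<xi> * cnj (fourier g \<xi>))
      = (LINT \<xi>|lborel. (M \<xi> * cnj (fourier g \<xi>)) * (LINT x|lborel. iexp (1 * (x \<bullet> \<xi>)) * f x))"
    by (simp add: fourier_lborel mult_ac)
  also have "\<dots> = (LINT x|lborel. f x * (LINT \<xi>|lborel. iexp (1 * (x \<bullet> \<xi>)) * (M \<xi> * cnj (fourier g \<xi>))))"
    by (rule fourier_multiplication_formula[OF Mg f])
  also have "\<dots> = (LINT x|lborel. f x * (LINT y|lborel. cnj (g y) * (LINT \<xi>|lborel. iexp ((x - y) \<bullet> \<xi>) * M \<xi>)))"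
  proof (rule Bochner_Integration.integral_cong[OF refl], rule arg_cong2[where f="(*)", OF refl])
    fix x
    have Me: "integrable lborel (\<lambda>\<xi>. iexp (1 * (\<xi> \<bullet> x)) * M \<xi>)"
      by (rule integrable_iexp_mult[OF M])
    have "(LINT \<xi>|lborel. iexp (1 * (x \<bullet> \<xi>)) * (M \<xi> * cnj (fourier g \<xi>)))
      = (LINT \<xi>|lborel. (iexp (1 * (\<xi> \<bullet> x)) * M \<xi>) * (LINT y|lborel. iexp ((-1) * (y \<bullet> \<xi>)) * cnj (g y)))"
      unfolding cnj_fourier[OF gm] by (simp add: inner_commute mult.assoc)
    also have "\<dots> = (LINT y|lborel. cnj (g y) * (LINT \<xi>|lborel. iexp ((-1) * (y \<bullet> \<xi>)) * (iexp (1 * (\<xi> \<bullet> x)) * M \<xi>)))"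
      by (rule fourier_multiplication_formula[OF Me]) (use g in simp)
    also have "\<dots> = (LINT y|lborel. cnj (g y) * (LINT \<xi>|lborel. iexp ((x - y) \<bullet> \<xi>) * M \<xi>))"
    proof -
      have "iexp ((-1) * (y \<bullet> \<xi>)) * (iexp (1 * (\<xi> \<bullet> x)) * m)
        = iexp ((x - y) \<bullet> \<xi>) * m" for y \<xi> m
        unfolding mult.assoc[symmetric] mult_exp_exp by (simp add: inner_diff_left inner_commute algebra_simps)
      then show ?thesis by (simp only:)
    qed
    finally show "(LINT \<xi>|lborel. iexp (1 * (x \<bullet> \<xi>)) * (M \<xi> * cnj (fourier g \<xi>)))
      = (LINT y|lborel. cnj (g y) * (LINT \<xi>|lborel. iexp ((x - y) \<bullet> \<xi>) * M \<xi>))" .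
  qed
  finally show ?thesis .
qed

lemma fourier_form_bound:
  fixes M f g :: "'a::euclidean_space \<Rightarrow> complex"
  assumes M: "integrable lborel M" and f: "integrable lborel f" and g: "integrable lborel g"
    and K: "\<And>x. cmod (LINT \<xi>|lborel. iexp (x \<bullet> \<xi>) * M \<xi>) \<le> K"
  shows "cmod (LINT \<xi>|lborel. M \<xi> * fourier f \<xi> * cnj (fourier g \<xi>)) \<le> K * (LINT x|lborel. cmod (f x)) * (LINT x|lborel. cmod (g x))"
proof -
  have K0: "0 \<le> K" using K[of 0] norm_ge_zero order_trans by blast
  let ?k = "\<lambda>x. LINT \<xi>|lborel. iexp (x \<bullet> \<xi>) * M \<xi>"
  have 1: "cmod (LINT y|lborel. cnj (g y) * ?k (x - y)) \<le> K * (LINT x|lborel. cmod (g x))" for x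
  proof -
    have "cmod (LINT y|lborel. cnj (g y) * ?k (x - y)) \<le> (LINT y|lborel. cmod (cnj (g y) * ?k (x - y)))"
      by (rule integral_norm_bound)
    also have "\<dots> \<le> (LINT y|lborel. K * cmod (g y))"
    proof (rule integral_mono')
      show "integrable lborel (\<lambda>y. K * cmod (g y))" using g by simp
      show "cmod (cnj (g y) * ?k (x - y)) \<le> K * cmod (g y)" for y
        using mult_right_mono[OF K[of "x - y"], of "cmod (g y)"] by (simp add: norm_mult mult.commute)
    qed (use K0 in auto)
    finally show ?thesis by simp
  qed
  have "cmod (LINT x|lborel. f x * (LINT y|lborel. cnj (g y) * ?k (x - y))) \<le> (LINT x|lborel. cmod (f x * (LINT y|lborel. cnj (g y) * ?k (x - y))))"
    by (rule integral_norm_bound)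
  also have "\<dots> \<le> (LINT x|lborel. (K * (LINT x|lborel. cmod (g x))) * cmod (f x))"
  proof (rule integral_mono')
    show "integrable lborel (\<lambda>x. (K * (LINT x|lborel. cmod (g x))) * cmod (f x))" using f by simp
    show "cmod (f x * (LINT y|lborel. cnj (g y) * ?k (x - y))) \<le> (K * (LINT x|lborel. cmod (g x))) * cmod (f x)" for x
      using mult_left_mono[OF 1[of x], of "cmod (f x)"] by (simp add: norm_mult mult.commute)
  qed (use K0 in auto)
  finally show ?thesis using fourier_form_eq[OF M f g] by (simp add: mult_ac)
qed

lemma integral_exp_norm_scaled:
  assumes c: "0 < c"
  shows "integrable lborel (\<lambda>x::'a::euclidean_space. exp (- c * (norm x)\<^sup>2))"
proof -
  have "integrable (density (distr lborel borel (\<lambda>x. 0 + (1 / sqrt c) *\<^sub>R x)) (\<lambda>_. ennreal (\<bar>1 / sqrt c\<bar> ^ DIM('a)))) (\<lambda>x::'a. exp (- c * (norm x)\<^sup>2))"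
    (is "integrable (density ?D _) _")
  proof (subst integrable_density)
    show "integrable ?D (\<lambda>x::'a. (\<bar>1 / sqrt c\<bar> ^ DIM('a)) *\<^sub>R exp (- c * (norm x)\<^sup>2))"
    proof (rule integrable_scaleR_right, subst integrable_distr_eq)
      show "integrable lborel (\<lambda>x::'a. exp (- c * (norm (0 + (1 / sqrt c) *\<^sub>R x))\<^sup>2))"
        using integrable_gauss_n[where 'a='a] c by (simp add: power_divide)
    qed (auto intro!: borel_measurable_continuous_onI continuous_intros)
  qed (auto intro!: borel_measurable_continuous_onI continuous_intros)
  then show ?thesis
    using lborel_affine[of "1 / sqrt c" "0::'a"] c by simp
qed

lemma nn_integral_lborel_translate:
  assumes [measurable]: "h \<in> borel_measurable (borel :: 'a::euclidean_space measure)"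
  shows "(\<integral>\<^sup>+y. h (x - y) \<partial>lborel) = (\<integral>\<^sup>+y. h y \<partial>lborel)"
proof -
  have "(lborel :: 'a measure) = distr lborel borel (\<lambda>y. x + (-1) *\<^sub>R y)"
    using lborel_affine[of "-1" x] by (simp add: density_1)
  then have "(\<integral>\<^sup>+y. h y \<partial>lborel) = (\<integral>\<^sup>+y. h y \<partial>distr lborel borel (\<lambda>y. x + (-1) *\<^sub>R y))" by simp
  also have "\<dots> = (\<integral>\<^sup>+y. h (x - y) \<partial>lborel)" by (subst nn_integral_distr) auto
  finally show ?thesis by simp
qed

text \<open>By Schur's test, which avoids the Plancherel theorem.\<close>

lemma gaussian_plancherel:
  obtains C where "0 < C" "\<And>g :: 'a::euclidean_space \<Rightarrow> complex. integrable lborel g \<Longrightarrow> integrable lborel (\<lambda>x. (cmod (g x))\<^sup>2) \<Longrightarrow>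
    (LINT \<xi>|lborel. exp (- (norm \<xi>)\<^sup>2) * (cmod (fourier g \<xi>))\<^sup>2) \<le> C * (LINT x|lborel. (cmod (g x))\<^sup>2)"
proof
  let ?k = "\<lambda>x::'a. (2::real) ^ DIM('a) * exp (- (1 / 4) * (norm x)\<^sup>2)"
  \<comment> \<open>The summand 1 secures positivity without computing the integral.\<close>
  define C where "C = (LINT x|lborel. ?k x) + 1"
  have k0: "0 \<le> (LINT x|lborel. ?k x)" by (intro integral_nonneg_AE) simp
  then show "0 < C" unfolding C_def by linarith
  fix g :: "'a \<Rightarrow> complex" assume g: "integrable lborel g" and g2: "integrable lborel (\<lambda>x. (cmod (g x))\<^sup>2)"
  have gm [measurable]: "g \<in> borel_measurable borel" using borel_measurable_integrable[OF g] by simp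
  have ki: "integrable lborel ?k" using integral_exp_norm_scaled[of "1/4"] by simp
  have km [measurable]: "?k \<in> borel_measurable borel" using borel_measurable_integrable[OF ki] by simp
  have k: "cmod (LINT \<xi>|lborel. iexp (x \<bullet> \<xi>) * exp (- (norm \<xi>)\<^sup>2)) \<le> ?k x" for x :: 'a
  proof -
    have "(LINT \<xi>|lborel. iexp (x \<bullet> \<xi>) * exp (- (norm \<xi>)\<^sup>2)) = (LINT \<xi>|lborel. gauss_osc_n 0 x \<xi>)"
      by (simp add: gauss_osc_n_def exp_add[symmetric] exp_of_real[symmetric] add.commute)
    also have "\<dots> = gauss_ft 0 0 ^ DIM('a) * exp (- (norm x)\<^sup>2 / 4)"
      by (simp add: integral_gauss_osc_n exp_of_real[symmetric])
    also have "cmod \<dots> \<le> ?k x"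
      using norm_gauss_ft_0_le(1)[of 0] by (auto simp: norm_mult norm_power intro!: mult_right_mono power_mono)
    finally show ?thesis .
  qed
  have Mi: "integrable lborel (\<lambda>\<xi>::'a. complex_of_real (exp (- (norm \<xi>)\<^sup>2)))"
    using integrable_gauss_n[where 'a='a] by simp
  let ?K = "\<lambda>x. LINT \<xi>|lborel. iexp (x \<bullet> \<xi>) * exp (- (norm \<xi>)\<^sup>2)"
  have "complex_of_real (LINT \<xi>|lborel. exp (- (norm \<xi>)\<^sup>2) * (cmod (fourier g \<xi>))\<^sup>2)
      = (LINT \<xi>|lborel. complex_of_real (exp (- (norm \<xi>)\<^sup>2)) * fourier g \<xi> * cnj (fourier g \<xi>))"
    by (subst integral_complex_of_real[symmetric]) (simp add: mult.assoc complex_norm_square[symmetric])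
  also have "\<dots> = (LINT x|lborel. g x * (LINT y|lborel. cnj (g y) * ?K (x - y)))"
    by (rule fourier_form_eq[OF Mi g g])
  finally have e: "\<bar>LINT \<xi>|lborel. exp (- (norm \<xi>)\<^sup>2) * (cmod (fourier g \<xi>))\<^sup>2\<bar>
      = cmod (LINT x|lborel. g x * (LINT y|lborel. cnj (g y) * ?K (x - y)))"
    by (subst norm_of_real[symmetric, where 'a=complex]) (rule arg_cong[where f=cmod])
  have nb: "ennreal (cmod (LINT x|lborel. f x)) \<le> (\<integral>\<^sup>+x. ennreal (cmod (f x)) \<partial>lborel)" for f :: "'a \<Rightarrow> complex"
    by (cases "integrable lborel f") (auto simp: integral_norm_bound_ennreal not_integrable_integral_eq)
  have "ennreal (cmod (LINT x|lborel. g x * (LINT y|lborel. cnj (g y) * ?K (x - y))))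
      \<le> (\<integral>\<^sup>+x. ennreal (cmod (g x * (LINT y|lborel. cnj (g y) * ?K (x - y)))) \<partial>lborel)"
    by (rule nb)
  \<comment> \<open>Schur's test: |g x| |g y| is at most half the sum of the squares. In each half
    the other variable meets the kernel alone, whose integral is translation invariant, so both
    halves cost the same constant.\<close>
  also have "\<dots> \<le> (\<integral>\<^sup>+x. (\<integral>\<^sup>+y. (ennreal (((cmod (g x))\<^sup>2 / 2) * ?k (x - y)) + ennreal (((cmod (g y))\<^sup>2 / 2) * ?k (x - y))) \<partial>lborel) \<partial>lborel)"
  proof (rule nn_integral_mono)
    fix x :: 'a
    have "ennreal (cmod (g x * (LINT y|lborel. cnj (g y) * ?K (x - y)))) = ennreal (cmod (LINT y|lborel. g x * (cnj (g y) * ?K (x - y))))"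
      by simp
    also have "\<dots> \<le> (\<integral>\<^sup>+y. ennreal (cmod (g x * (cnj (g y) * ?K (x - y)))) \<partial>lborel)" by (rule nb)
    also have "\<dots> \<le> (\<integral>\<^sup>+y. (ennreal (((cmod (g x))\<^sup>2 / 2) * ?k (x - y)) + ennreal (((cmod (g y))\<^sup>2 / 2) * ?k (x - y))) \<partial>lborel)"
    proof (rule nn_integral_mono)
      fix y :: 'a
      have "cmod (g x * (cnj (g y) * ?K (x - y))) = (cmod (g x) * cmod (g y)) * cmod (?K (x - y))"
        by (simp add: norm_mult)
      also have "\<dots> \<le> ((cmod (g x))\<^sup>2 / 2 + (cmod (g y))\<^sup>2 / 2) * ?k (x - y)"
      proof (rule mult_mono[OF _ k])
        have "0 \<le> (cmod (g x) - cmod (g y))\<^sup>2" by simp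
        then show "cmod (g x) * cmod (g y) \<le> (cmod (g x))\<^sup>2 / 2 + (cmod (g y))\<^sup>2 / 2" by (simp add: power2_diff)
      qed auto
      finally have "ennreal (cmod (g x * (cnj (g y) * ?K (x - y)))) \<le> ennreal (((cmod (g x))\<^sup>2 / 2) * ?k (x - y) + ((cmod (g y))\<^sup>2 / 2) * ?k (x - y))"
        by (intro ennreal_leI) (simp only: distrib_right)
      also have "\<dots> = ennreal (((cmod (g x))\<^sup>2 / 2) * ?k (x - y)) + ennreal (((cmod (g y))\<^sup>2 / 2) * ?k (x - y))"
        by (rule ennreal_plus) auto
      finally show "ennreal (cmod (g x * (cnj (g y) * ?K (x - y)))) \<le> ennreal (((cmod (g x))\<^sup>2 / 2) * ?k (x - y)) + ennreal (((cmod (g y))\<^sup>2 / 2) * ?k (x - y))" .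
    qed
    finally show "ennreal (cmod (g x * (LINT y|lborel. cnj (g y) * ?K (x - y)))) \<le> (\<integral>\<^sup>+y. (ennreal (((cmod (g x))\<^sup>2 / 2) * ?k (x - y)) + ennreal (((cmod (g y))\<^sup>2 / 2) * ?k (x - y))) \<partial>lborel)" .
  qed
  also have "\<dots> = (\<integral>\<^sup>+x. (\<integral>\<^sup>+y. ennreal (((cmod (g x))\<^sup>2 / 2) * ?k (x - y)) \<partial>lborel) \<partial>lborel) + (\<integral>\<^sup>+x. (\<integral>\<^sup>+y. ennreal (((cmod (g y))\<^sup>2 / 2) * ?k (x - y)) \<partial>lborel) \<partial>lborel)"
    by (subst nn_integral_add[symmetric]) (auto intro!: nn_integral_cong nn_integral_add)
  also have "(\<integral>\<^sup>+x. (\<integral>\<^sup>+y. ennreal (((cmod (g y))\<^sup>2 / 2) * ?k (x - y)) \<partial>lborel) \<partial>lborel) = (\<integral>\<^sup>+y. (\<integral>\<^sup>+x. ennreal (((cmod (g y))\<^sup>2 / 2) * ?k (x - y)) \<partial>lborel) \<partial>lborel)"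
    by (rule lborel_pair.Fubini') simp
  also have "(\<integral>\<^sup>+y. (\<integral>\<^sup>+x. ennreal (((cmod (g y))\<^sup>2 / 2) * ?k (x - y)) \<partial>lborel) \<partial>lborel) = (\<integral>\<^sup>+x. (\<integral>\<^sup>+y. ennreal (((cmod (g x))\<^sup>2 / 2) * ?k (x - y)) \<partial>lborel) \<partial>lborel)"
    by (simp add: norm_minus_commute)
  also have "(\<integral>\<^sup>+x. (\<integral>\<^sup>+y. ennreal (((cmod (g x))\<^sup>2 / 2) * ?k (x - y)) \<partial>lborel) \<partial>lborel) = (\<integral>\<^sup>+x. ennreal ((cmod (g x))\<^sup>2 / 2) * ennreal (LINT y|lborel. ?k y) \<partial>lborel)"
  proof (rule nn_integral_cong)
    fix x :: 'a
    have "(\<integral>\<^sup>+y. ennreal (((cmod (g x))\<^sup>2 / 2) * ?k (x - y)) \<partial>lborel) = (\<integral>\<^sup>+y. ennreal ((cmod (g x))\<^sup>2 / 2) * ennreal (?k (x - y)) \<partial>lborel)"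
      by (intro nn_integral_cong ennreal_mult) auto
    also have "\<dots> = ennreal ((cmod (g x))\<^sup>2 / 2) * (\<integral>\<^sup>+y. ennreal (?k (x - y)) \<partial>lborel)"
      by (rule nn_integral_cmult) simp
    also have "(\<integral>\<^sup>+y. ennreal (?k (x - y)) \<partial>lborel) = (\<integral>\<^sup>+y. ennreal (?k y) \<partial>lborel)"
      by (rule nn_integral_lborel_translate[where h="\<lambda>y. ennreal (?k y)"]) simp
    also have "\<dots> = ennreal (LINT y|lborel. ?k y)"
      by (rule nn_integral_eq_integral[OF ki]) simp
    finally show "(\<integral>\<^sup>+y. ennreal (((cmod (g x))\<^sup>2 / 2) * ?k (x - y)) \<partial>lborel) = ennreal ((cmod (g x))\<^sup>2 / 2) * ennreal (LINT y|lborel. ?k y)" .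
  qed
  also have "\<dots> = (\<integral>\<^sup>+x. ennreal ((cmod (g x))\<^sup>2 / 2) \<partial>lborel) * ennreal (LINT y|lborel. ?k y)"
    by (rule nn_integral_multc) simp
  also have "(\<integral>\<^sup>+x. ennreal ((cmod (g x))\<^sup>2 / 2) \<partial>lborel) = ennreal (LINT x|lborel. (cmod (g x))\<^sup>2 / 2)"
    using g2 by (intro nn_integral_eq_integral) auto
  also have "ennreal (LINT x|lborel. (cmod (g x))\<^sup>2 / 2) * ennreal (LINT y|lborel. ?k y) + ennreal (LINT x|lborel. (cmod (g x))\<^sup>2 / 2) * ennreal (LINT y|lborel. ?k y)
     = ennreal ((LINT y|lborel. ?k y) * (LINT x|lborel. (cmod (g x))\<^sup>2))"
    using k0 by (simp add: ennreal_mult[symmetric] ennreal_plus[symmetric] mult.commute del: ennreal_plus)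
  finally have "\<bar>LINT \<xi>|lborel. exp (- (norm \<xi>)\<^sup>2) * (cmod (fourier g \<xi>))\<^sup>2\<bar> \<le> (LINT y|lborel. ?k y) * (LINT x|lborel. (cmod (g x))\<^sup>2)"
    unfolding e using k0 by (subst (asm) ennreal_le_iff) (auto intro!: mult_nonneg_nonneg integral_nonneg_AE)
  also have "\<dots> \<le> C * (LINT x|lborel. (cmod (g x))\<^sup>2)"
    unfolding C_def by (intro mult_right_mono integral_nonneg_AE) auto
  finally show "(LINT \<xi>|lborel. exp (- (norm \<xi>)\<^sup>2) * (cmod (fourier g \<xi>))\<^sup>2) \<le> C * (LINT x|lborel. (cmod (g x))\<^sup>2)"
    by simp
qed

section \<open>Dyadic decomposition of the smoothed sphere\<close>

text \<open>Twice the real part of 1 / (\<delta> - i t). As \<delta> tends to 0 it concentrates at t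
  = 0 with total mass 2 pi; at t = |\<xi>|^2 - 1 it stands for a multiple of surface measure on the
  unit sphere.\<close>

definition poisson :: "real \<Rightarrow> real \<Rightarrow> real" where
  "poisson \<delta> t = 2 * \<delta> / (\<delta>\<^sup>2 + t\<^sup>2)"

definition sphere_weight :: "real \<Rightarrow> 'a::euclidean_space \<Rightarrow> real" where
  "sphere_weight \<delta> \<xi> = exp (- (norm \<xi>)\<^sup>2) * poisson \<delta> ((norm \<xi>)\<^sup>2 - 1)"

definition sphere_energy :: "real \<Rightarrow> ('a::euclidean_space \<Rightarrow> complex) \<Rightarrow> real" where
  "sphere_energy \<delta> f = (LINT \<xi>|lborel. sphere_weight \<delta> \<xi> * (cmod (fourier f \<xi>))\<^sup>2)"

definition osc_rate :: "real \<Rightarrow> 'a::euclidean_space \<Rightarrow> complex" where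
  "osc_rate \<delta> \<xi> = \<i> * ((norm \<xi>)\<^sup>2 - 1) - \<delta>"

text \<open>The integral of exp (z s) over the j-th dyadic interval, z =
  \<open>osc_rate \<delta> \<xi>\<close>, in closed form: measurability is then immediate and the
  sum over j telescopes.\<close>

definition dyadic_mult :: "real \<Rightarrow> nat \<Rightarrow> 'a::euclidean_space \<Rightarrow> complex" where
  "dyadic_mult \<delta> j \<xi> = (exp (osc_rate \<delta> \<xi> * 2 ^ j) - exp (osc_rate \<delta> \<xi> * dyadic_lo j)) / osc_rate \<delta> \<xi>"

definition dyadic_weight :: "real \<Rightarrow> nat \<Rightarrow> 'a::euclidean_space \<Rightarrow> complex" where
  "dyadic_weight \<delta> j \<xi> = exp (- (norm \<xi>)\<^sup>2) * dyadic_mult \<delta> j \<xi>"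

definition dyadic_form :: "real \<Rightarrow> nat \<Rightarrow> ('a::euclidean_space \<Rightarrow> complex) \<Rightarrow> ('a \<Rightarrow> complex) \<Rightarrow> complex" where
  "dyadic_form \<delta> j f g = (LINT \<xi>|lborel. dyadic_weight \<delta> j \<xi> * fourier f \<xi> * cnj (fourier g \<xi>))"

lemma osc_rate_neq_0: "0 < \<delta> \<Longrightarrow> osc_rate \<delta> \<xi> \<noteq> 0"
  by (auto simp: osc_rate_def complex_eq_iff)

lemma Re_osc_rate [simp]: "Re (osc_rate \<delta> \<xi>) = - \<delta>" and Im_osc_rate [simp]: "Im (osc_rate \<delta> \<xi>) = (norm \<xi>)\<^sup>2 - 1"
  by (simp_all add: osc_rate_def flip: of_real_power)

lemma power2_norm_osc_rate: "(cmod (osc_rate \<delta> \<xi>))\<^sup>2 = \<delta>\<^sup>2 + ((norm \<xi>)\<^sup>2 - 1)\<^sup>2"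
  by (simp add: cmod_power2)

lemma dyadic_mult_has_integral:
  assumes "0 < \<delta>"
  shows "((\<lambda>s. exp (osc_rate \<delta> \<xi> * complex_of_real s)) has_integral dyadic_mult \<delta> j \<xi>) {dyadic_lo j..2 ^ j}"
proof -
  let ?z = "osc_rate \<delta> \<xi>"
  have z: "?z \<noteq> 0" by (rule osc_rate_neq_0[OF assms])
  have "((\<lambda>s. exp (?z * complex_of_real s) / ?z) has_vector_derivative exp (?z * complex_of_real s)) (at s)" for s
  proof -
    have "((\<lambda>w. exp (?z * w) / ?z) has_field_derivative exp (?z * complex_of_real s)) (at (complex_of_real s))"
      using z by (auto intro!: derivative_eq_intros)
    from field_vector_diff_chain_at[OF has_vector_derivative_of_real[OF DERIV_ident] this]
    show ?thesis by (simp add: o_def)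
  qed
  then have "((\<lambda>s. exp (?z * complex_of_real s)) has_integral (exp (?z * complex_of_real (2 ^ j)) / ?z - exp (?z * complex_of_real (dyadic_lo j)) / ?z)) {dyadic_lo j..2 ^ j}"
    by (intro fundamental_theorem_of_calculus dyadic_lo_bounds) (auto intro: has_vector_derivative_at_within)
  then show ?thesis by (simp add: dyadic_mult_def diff_divide_distrib)
qed

lemma norm_dyadic_mult_le:
  assumes d: "0 < \<delta>"
  shows "cmod (dyadic_mult \<delta> j \<xi>) \<le> 2 ^ j" "cmod (dyadic_mult \<delta> j \<xi>) \<le> 2 / cmod (osc_rate \<delta> \<xi>)"
proof -
  have e: "cmod (exp (osc_rate \<delta> \<xi> * complex_of_real s)) \<le> 1" if "0 \<le> s" for s
    using d that by (simp add: norm_exp_eq_Re)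
  have "cmod (integral {dyadic_lo j..2 ^ j} (\<lambda>s. exp (osc_rate \<delta> \<xi> * complex_of_real s))) \<le> 1 * (2 ^ j - dyadic_lo j)"
    using e dyadic_lo_bounds by (intro integral_bound continuous_intros) (auto intro: order_trans)
  then show "cmod (dyadic_mult \<delta> j \<xi>) \<le> 2 ^ j"
    using dyadic_mult_has_integral[OF d, of \<xi> j] dyadic_lo_bounds(3)[of j] by (simp add: integral_unique)
  have "cmod (exp (osc_rate \<delta> \<xi> * complex_of_real (2 ^ j)) - exp (osc_rate \<delta> \<xi> * complex_of_real (dyadic_lo j))) \<le> 1 + 1"
    by (rule order_trans[OF norm_triangle_ineq4]) (intro add_mono e, auto simp: dyadic_lo_bounds)
  then show "cmod (dyadic_mult \<delta> j \<xi>) \<le> 2 / cmod (osc_rate \<delta> \<xi>)"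
    by (simp add: dyadic_mult_def norm_divide divide_right_mono)
qed

lemma poisson_nonneg: "0 \<le> \<delta> \<Longrightarrow> 0 \<le> poisson \<delta> t"
  by (simp add: poisson_def)

text \<open>Of the two bounds 2^j and 2 / |z| the first is better near the sphere, the second away
  from it. After squaring they combine to 2^j times a Poisson kernel whose width is the larger of
  \<delta> and 1 / 2^j. So the square of one piece is again a weight of the kind whose energy is to
  be bounded, and no thinner than the original one; the bootstrap rests on this.\<close>

lemma norm_dyadic_mult_sq_le:
  assumes d: "0 < \<delta>"
  shows "(cmod (dyadic_mult \<delta> j \<xi>))\<^sup>2 \<le> 4 * 2 ^ j * poisson (max \<delta> (1 / 2 ^ j)) ((norm \<xi>)\<^sup>2 - 1)"
proof -
  define \<tau> where "\<tau> = (norm \<xi>)\<^sup>2 - 1"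
  define J where "J = (2::real) ^ j"
  have J: "0 < J" by (simp add: J_def)
  have p: "0 < \<delta>\<^sup>2 + \<tau>\<^sup>2" using d by (simp add: add_pos_nonneg)
  have m1: "(cmod (dyadic_mult \<delta> j \<xi>))\<^sup>2 \<le> J\<^sup>2"
    using norm_dyadic_mult_le(1)[OF d, of j \<xi>] by (intro power_mono) (auto simp: J_def)
  have "(cmod (dyadic_mult \<delta> j \<xi>))\<^sup>2 \<le> (2 / cmod (osc_rate \<delta> \<xi>))\<^sup>2"
    using norm_dyadic_mult_le(2)[OF d, of j \<xi>] by (intro power_mono) auto
  also have "\<dots> = 4 / (\<delta>\<^sup>2 + \<tau>\<^sup>2)" by (simp add: power_divide power2_norm_osc_rate \<tau>_def)
  finally have m2: "(cmod (dyadic_mult \<delta> j \<xi>))\<^sup>2 \<le> 4 / (\<delta>\<^sup>2 + \<tau>\<^sup>2)" .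
  show ?thesis
  proof (cases "1 / J \<le> \<delta>")
    case True
    have "4 / (\<delta>\<^sup>2 + \<tau>\<^sup>2) * 1 \<le> 4 / (\<delta>\<^sup>2 + \<tau>\<^sup>2) * (2 * J * \<delta>)"
      using True J p by (intro mult_left_mono) (auto simp: field_simps)
    also have "\<dots> = 4 * J * poisson \<delta> \<tau>" by (simp add: poisson_def)
    finally show ?thesis using m2 True by (simp add: max_absorb1 J_def \<tau>_def)
  next
    case False
    define \<eta> where "\<eta> = 1 / J"
    have eta: "0 < \<eta>" "J = 1 / \<eta>" using J by (auto simp: \<eta>_def)
    have q: "0 < \<eta>\<^sup>2 + \<tau>\<^sup>2" using eta by (simp add: add_pos_nonneg)
    have "(cmod (dyadic_mult \<delta> j \<xi>))\<^sup>2 \<le> 8 / (\<eta>\<^sup>2 + \<tau>\<^sup>2)"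
    proof (cases "\<tau>\<^sup>2 \<le> \<eta>\<^sup>2")
      case True
      have "J\<^sup>2 * (\<eta>\<^sup>2 + \<tau>\<^sup>2) \<le> J\<^sup>2 * (2 * \<eta>\<^sup>2)" using True by (intro mult_left_mono) auto
      also have "\<dots> = 2" using eta by (simp add: power_divide)
      finally have "J\<^sup>2 \<le> 8 / (\<eta>\<^sup>2 + \<tau>\<^sup>2)" using q by (subst pos_le_divide_eq) auto
      with m1 show ?thesis by linarith
    next
      case False
      then have "0 < \<tau>\<^sup>2" using eta by (smt (verit) zero_le_power2)
      have "(\<eta>\<^sup>2 + \<tau>\<^sup>2) / 2 \<le> \<delta>\<^sup>2 + \<tau>\<^sup>2" using False zero_le_power2[of \<delta>] by argo
      then have "4 / (\<delta>\<^sup>2 + \<tau>\<^sup>2) \<le> 4 / ((\<eta>\<^sup>2 + \<tau>\<^sup>2) / 2)"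
        using q p by (intro divide_left_mono) auto
      with m2 show ?thesis by simp
    qed
    also have "\<dots> = 4 * J * poisson \<eta> \<tau>" using eta by (simp add: poisson_def)
    finally show ?thesis using False by (simp add: max_absorb2 \<eta>_def J_def \<tau>_def)
  qed
qed

lemma osc_rate_measurable [measurable]: "osc_rate \<delta> \<in> borel_measurable borel"
  unfolding osc_rate_def by (intro borel_measurable_continuous_onI continuous_intros)

lemma dyadic_mult_measurable [measurable]: "dyadic_mult \<delta> j \<in> borel_measurable borel"
  unfolding dyadic_mult_def[abs_def] by measurable

lemma integrable_dyadic_weight:
  assumes "0 < \<delta>"
  shows "integrable lborel (dyadic_weight \<delta> j :: 'a::euclidean_space \<Rightarrow> complex)"
proof -
  have "integrable lborel (\<lambda>\<xi>::'a. complex_of_real (exp (- (norm \<xi>)\<^sup>2)) * dyadic_mult \<delta> j \<xi>)"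
    by (rule integrable_mult_bounded[OF _ _ norm_dyadic_mult_le(1)[OF assms]])
      (use integrable_gauss_n[where 'a='a] in auto)
  then show ?thesis by (simp add: dyadic_weight_def[abs_def] exp_of_real)
qed

text \<open>Fubini in s and \<xi>: for fixed s the integral over \<xi> is Gaussian and equals
  \<open>osc_kernel\<close>.\<close>

lemma dyadic_weight_fourier:
  fixes x :: "'a::euclidean_space"
  assumes d: "0 < \<delta>"
  shows "(LINT \<xi>|lborel. iexp (x \<bullet> \<xi>) * dyadic_weight \<delta> j \<xi>) = integral {dyadic_lo j..2 ^ j} (osc_kernel DIM('a) \<delta> ((norm x)\<^sup>2))"
proof -
  let ?I = "{dyadic_lo j..2 ^ j}"
  define H where "H s \<xi> = complex_of_real (indicator ?I s) * (exp (- (\<delta> + \<i>) * complex_of_real s) * gauss_osc_n s x \<xi>)" for s :: real and \<xi> :: 'a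
  have gm [measurable]: "(\<lambda>z. gauss_osc_n (fst z) x (snd z)) \<in> borel_measurable (borel \<Otimes>\<^sub>M (borel :: 'a measure))"
    unfolding borel_prod gauss_osc_n_def by (intro borel_measurable_continuous_onI continuous_intros)
  have em [measurable]: "(\<lambda>s. exp (- (\<delta> + \<i>) * complex_of_real s)) \<in> borel_measurable borel"
    by (intro borel_measurable_continuous_onI continuous_intros)
  have iI: "integrable lborel (indicator ?I :: real \<Rightarrow> real)"
    by (rule integrable_real_indicator) (simp_all add: dyadic_lo_bounds)
  have nH: "cmod (H s \<xi>) = (indicator ?I s * exp (- \<delta> * s)) * exp (- (norm \<xi>)\<^sup>2)" for s \<xi>
    by (simp add: H_def norm_mult norm_gauss_osc_n norm_exp_eq_Re)
  have "integrable (lborel \<Otimes>\<^sub>M lborel) (case_prod H)"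
  proof (rule lborel_pair.Fubini_integrable)
    show "case_prod H \<in> borel_measurable (lborel \<Otimes>\<^sub>M lborel)"
      unfolding H_def by (simp add: split_beta')
    show "integrable lborel (\<lambda>s. LINT \<xi>|lborel. norm (case (s, \<xi>) of (s, \<xi>) \<Rightarrow> H s \<xi>))"
    proof -
      have "integrable lborel (\<lambda>s. indicator ?I s * exp (- \<delta> * s) :: real)"
      proof (rule Bochner_Integration.integrable_bound[OF iI])
        show "AE s in lborel. norm (indicator ?I s * exp (- \<delta> * s) :: real) \<le> norm (indicator ?I s :: real)"
          using d dyadic_lo_bounds(1)[of j] by (auto simp: indicator_def)
      qed simp
      then show ?thesis unfolding prod.case nH integral_mult_right_zero by (rule integrable_mult_left)
    qed
    show "AE s in lborel. integrable lborel (\<lambda>\<xi>. case (s, \<xi>) of (s, \<xi>) \<Rightarrow> H s \<xi>)"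
      unfolding H_def by (auto intro!: integrable_mult_right integrable_gauss_osc_n)
  qed
  from lborel_pair.Fubini_integral[OF this]
  have F: "(LINT \<xi>|lborel. LINT s|lborel. H s \<xi>) = (LINT s|lborel. LINT \<xi>|lborel. H s \<xi>)" .
  have set_int: "(LINT s|lborel. complex_of_real (indicator ?I s) * h s) = integral ?I h"
    if c: "continuous_on ?I h" for h :: "real \<Rightarrow> complex"
  proof -
    have "set_integrable lborel ?I h" using borel_integrable_compact[of ?I h] c by (simp add: set_integrable_def)
    from set_borel_integral_eq_integral(2)[OF this] show ?thesis
      by (simp add: set_lebesgue_integral_def scaleR_conv_of_real)
  qed
  have 1: "(LINT s|lborel. H s \<xi>) = iexp (x \<bullet> \<xi>) * dyadic_weight \<delta> j \<xi>" for \<xi>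
  proof -
    have "exp (- (\<delta> + \<i>) * complex_of_real s) * gauss_osc_n s x \<xi> = (iexp (x \<bullet> \<xi>) * exp (- (norm \<xi>)\<^sup>2)) * exp (osc_rate \<delta> \<xi> * complex_of_real s)" for s
      unfolding gauss_osc_n_def osc_rate_def exp_of_real[symmetric] mult_exp_exp by (rule arg_cong[where f=exp]) (simp add: algebra_simps)
    then have "(LINT s|lborel. H s \<xi>) = (LINT s|lborel. complex_of_real (indicator ?I s) * ((iexp (x \<bullet> \<xi>) * exp (- (norm \<xi>)\<^sup>2)) * exp (osc_rate \<delta> \<xi> * complex_of_real s)))"
      by (simp add: H_def)
    also have "\<dots> = integral ?I (\<lambda>s. (iexp (x \<bullet> \<xi>) * exp (- (norm \<xi>)\<^sup>2)) * exp (osc_rate \<delta> \<xi> * complex_of_real s))"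
      by (intro set_int continuous_intros)
    also have "\<dots> = (iexp (x \<bullet> \<xi>) * exp (- (norm \<xi>)\<^sup>2)) * dyadic_mult \<delta> j \<xi>"
      by (intro integral_unique has_integral_mult_right dyadic_mult_has_integral d)
    finally show ?thesis by (simp add: dyadic_weight_def mult.assoc)
  qed
  have 2: "(LINT s|lborel. LINT \<xi>|lborel. H s \<xi>) = integral ?I (osc_kernel DIM('a) \<delta> ((norm x)\<^sup>2))"
  proof -
    have "(LINT \<xi>|lborel. H s \<xi>) = complex_of_real (indicator ?I s) * osc_kernel DIM('a) \<delta> ((norm x)\<^sup>2) s" for s
      by (simp add: H_def integral_gauss_osc_n osc_kernel_def mult.assoc)
    then show ?thesis by (simp add: set_int continuous_osc_kernel)
  qed
  show ?thesis using F unfolding 1 2 .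
qed

section \<open>The two competing bounds on one dyadic piece\<close>

lemma dyadic_form_L1_bound:
  obtains C where "0 < C" "\<And>\<delta> j (f::'a::euclidean_space \<Rightarrow> complex) g. 0 < \<delta> \<Longrightarrow> integrable lborel f \<Longrightarrow> integrable lborel g \<Longrightarrow>
    cmod (dyadic_form \<delta> j f g) \<le> C * (sqrt 2 ^ j / (sqrt 2 ^ j) ^ DIM('a)) * (LINT x|lborel. cmod (f x)) * (LINT x|lborel. cmod (g x))"
proof -
  obtain C where C: "0 < C" "\<And>j \<delta> R. 0 \<le> \<delta> \<Longrightarrow> 0 \<le> R \<Longrightarrow>
    cmod (integral {dyadic_lo j..2 ^ j} (osc_kernel DIM('a) \<delta> R)) \<le> C * (sqrt 2 ^ j) / (sqrt 2 ^ j) ^ DIM('a)"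
    by (rule osc_kernel_dyadic_bound) blast
  show ?thesis
  proof (rule that[OF C(1)])
    fix \<delta> :: real and j and f g :: "'a \<Rightarrow> complex" assume a: "0 < \<delta>" "integrable lborel f" "integrable lborel g"
    show "cmod (dyadic_form \<delta> j f g) \<le> C * (sqrt 2 ^ j / (sqrt 2 ^ j) ^ DIM('a)) * (LINT x|lborel. cmod (f x)) * (LINT x|lborel. cmod (g x))"
      unfolding dyadic_form_def
      by (rule fourier_form_bound[OF integrable_dyadic_weight a(2,3)]) (use a C(2)[of \<delta> _ j] in \<open>simp_all add: dyadic_weight_fourier\<close>)
  qed
qed

text \<open>Optimising in t gives Cauchy--Schwarz. A family of bounds with a free t is what the
  pointwise inequality x y \<le> t x^2 / 2 + y^2 / (2 t) provides under an integral. For A = 0 there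
  is no optimal t, and a large one leads to a contradiction unless X = 0.\<close>

lemma le_sqrt_of_amgm:
  fixes X A B :: real
  assumes "0 \<le> X" "0 \<le> A" "0 \<le> B" and am: "\<And>t. 0 < t \<Longrightarrow> X \<le> t / 2 * A + B / (2 * t)"
  shows "X\<^sup>2 \<le> A * B"
proof (cases "X = 0")
  case False
  then have X: "0 < X" using assms by simp
  show ?thesis
  proof (cases "A = 0")
    case True
    have "X \<le> B / (2 * ((B + 1) / X))" using am[of "(B + 1) / X"] True X assms by simp
    also have "\<dots> = X * (B / (2 * (B + 1)))" by simp
    also have "\<dots> < X * 1"
      using X assms by (intro mult_strict_left_mono) (auto simp: divide_less_eq)
    finally show ?thesis by simp
  next
    case False
    then have A: "0 < A" using assms by simp
    have "X \<le> X / A / 2 * A + B / (2 * (X / A))" using am[of "X / A"] A X by simp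
    also have "\<dots> = X / 2 + A * B / (2 * X)" using A X by (simp add: field_simps)
    finally have "X / 2 \<le> A * B / (2 * X)" by simp
    then show ?thesis using X by (simp add: field_simps power2_eq_square)
  qed
qed (use assms in simp)

lemma fourier_measurable [measurable]:
  "f \<in> borel_measurable borel \<Longrightarrow> fourier f \<in> borel_measurable borel" for f :: "'a::euclidean_space \<Rightarrow> complex"
  using fourier_integral_measurable[of f 1] fourier_lborel[of f] by (simp cong: measurable_cong)

text \<open>A non-integrable f is no exception: both Bochner integrals then take the default value
  0.\<close>

lemma norm_fourier_le:
  "f \<in> borel_measurable borel \<Longrightarrow> cmod (fourier f \<xi>) \<le> (LINT x|lborel. cmod (f x))" for f :: "'a::euclidean_space \<Rightarrow> complex"
  using norm_fourier_integral_le[of 1 \<xi> f] by (simp add: fourier_lborel)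

lemma poisson_le: "0 < \<delta> \<Longrightarrow> poisson \<delta> t \<le> 2 / \<delta>"
  by (simp add: poisson_def divide_simps add_pos_nonneg power2_eq_square)

lemma poisson_measurable [measurable]: "poisson \<delta> \<in> borel_measurable borel"
  unfolding poisson_def[abs_def] by measurable

lemma sphere_weight_measurable [measurable]: "sphere_weight \<delta> \<in> borel_measurable borel"
  unfolding sphere_weight_def[abs_def] by measurable

lemma sphere_weight_nonneg: "0 < \<delta> \<Longrightarrow> 0 \<le> sphere_weight \<delta> \<xi>"
  by (simp add: sphere_weight_def poisson_nonneg)

lemma sphere_weight_le: "0 < \<delta> \<Longrightarrow> sphere_weight \<delta> \<xi> \<le> exp (- (norm \<xi>)\<^sup>2) * (2 / \<delta>)"
  unfolding sphere_weight_def by (intro mult_left_mono poisson_le) auto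

lemma integrable_gauss_fourier:
  fixes f g :: "'a::euclidean_space \<Rightarrow> complex"
  assumes [measurable]: "f \<in> borel_measurable borel" "h \<in> borel_measurable borel" and h: "\<And>\<xi>. \<bar>h \<xi>\<bar> \<le> exp (- (norm \<xi>)\<^sup>2) * B"
  shows "integrable lborel (\<lambda>\<xi>. h \<xi> * (cmod (fourier f \<xi>))\<^sup>2)"
proof -
  let ?N = "LINT x|lborel. cmod (f x)"
  have B: "0 \<le> B" using h[of 0] by simp
  show ?thesis
  proof (rule Bochner_Integration.integrable_bound[OF integrable_mult_left[OF integrable_gauss_n, of "B * ?N\<^sup>2"]])
    show "AE \<xi> in lborel. norm (h \<xi> * (cmod (fourier f \<xi>))\<^sup>2) \<le> norm (exp (- (norm \<xi>)\<^sup>2) * (B * ?N\<^sup>2))"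
    proof (rule AE_I2)
      fix \<xi> :: 'a
      have "(cmod (fourier f \<xi>))\<^sup>2 \<le> ?N\<^sup>2" by (intro power_mono norm_fourier_le) auto
      then have "\<bar>h \<xi>\<bar> * (cmod (fourier f \<xi>))\<^sup>2 \<le> (exp (- (norm \<xi>)\<^sup>2) * B) * ?N\<^sup>2"
        using h[of \<xi>] by (intro mult_mono) (auto intro: order_trans[OF abs_ge_zero])
      then show "norm (h \<xi> * (cmod (fourier f \<xi>))\<^sup>2) \<le> norm (exp (- (norm \<xi>)\<^sup>2) * (B * ?N\<^sup>2))"
        using B by (simp add: abs_mult mult.assoc)
    qed
  qed simp
qed

lemma integrable_sphere_energy:
  fixes f :: "'a::euclidean_space \<Rightarrow> complex"
  assumes "f \<in> borel_measurable borel" "0 < \<delta>"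
  shows "integrable lborel (\<lambda>\<xi>. sphere_weight \<delta> \<xi> * (cmod (fourier f \<xi>))\<^sup>2)"
  using assms
  by (intro integrable_gauss_fourier[where B="2 / \<delta>"]) (simp_all only: abs_of_nonneg sphere_weight_nonneg sphere_weight_le sphere_weight_measurable)

lemma sphere_energy_nonneg: "0 < \<delta> \<Longrightarrow> 0 \<le> sphere_energy \<delta> f"
  unfolding sphere_energy_def by (intro integral_nonneg_AE) (simp add: sphere_weight_nonneg)

lemma integrable_dyadic_form:
  fixes f g :: "'a::euclidean_space \<Rightarrow> complex"
  assumes f [measurable]: "f \<in> borel_measurable borel" and g [measurable]: "g \<in> borel_measurable borel" and d: "0 < \<delta>"
  shows "integrable lborel (\<lambda>\<xi>. dyadic_weight \<delta> j \<xi> * fourier f \<xi> * cnj (fourier g \<xi>))"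
proof -
  have "integrable lborel (\<lambda>\<xi>. dyadic_weight \<delta> j \<xi> * fourier f \<xi>)"
    by (rule integrable_mult_bounded[OF integrable_dyadic_weight[OF d] _ norm_fourier_le[OF f]]) simp
  moreover have "(\<lambda>\<xi>. cnj (fourier g \<xi>)) \<in> borel_measurable borel"
    by (rule measurable_compose[OF fourier_measurable[OF g]]) (intro borel_measurable_continuous_onI continuous_intros)
  ultimately show ?thesis
    by (rule integrable_mult_bounded[where B="LINT x|lborel. cmod (g x)"]) (simp add: norm_fourier_le g)
qed

text \<open>Cauchy--Schwarz for the measure exp (-|\<xi>|^2) d\<xi>, with the whole multiplier given
  to f: its square turns the f-factor into an energy of coarser thickness, and the g-factor is
  bounded by the L^2 norm of g. The form is not Hermitian, as the multiplier is complex, so both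
  orders of the arguments are recorded.\<close>

lemma dyadic_form_energy_bound:
  obtains C where "0 < C" "\<And>\<delta> j (f::'a::euclidean_space \<Rightarrow> complex) g. 0 < \<delta> \<Longrightarrow> integrable lborel f \<Longrightarrow> integrable lborel g \<Longrightarrow>
    integrable lborel (\<lambda>x. (cmod (g x))\<^sup>2) \<Longrightarrow>
    (cmod (dyadic_form \<delta> j f g))\<^sup>2 \<le> C * 2 ^ j * sphere_energy (max \<delta> (1 / 2 ^ j)) f * (LINT x|lborel. (cmod (g x))\<^sup>2) \<and>
    (cmod (dyadic_form \<delta> j g f))\<^sup>2 \<le> C * 2 ^ j * sphere_energy (max \<delta> (1 / 2 ^ j)) f * (LINT x|lborel. (cmod (g x))\<^sup>2)"
proof -
  obtain C0 where C0: "0 < C0" "\<And>g :: 'a \<Rightarrow> complex. integrable lborel g \<Longrightarrow> integrable lborel (\<lambda>x. (cmod (g x))\<^sup>2) \<Longrightarrow>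
    (LINT \<xi>|lborel. exp (- (norm \<xi>)\<^sup>2) * (cmod (fourier g \<xi>))\<^sup>2) \<le> C0 * (LINT x|lborel. (cmod (g x))\<^sup>2)"
    by (rule gaussian_plancherel) blast
  show ?thesis
  proof (rule that[of "4 * C0"])
    fix \<delta> :: real and j and f g :: "'a \<Rightarrow> complex"
    assume d: "0 < \<delta>" and f: "integrable lborel f" and g: "integrable lborel g" and g2: "integrable lborel (\<lambda>x. (cmod (g x))\<^sup>2)"
    have fm [measurable]: "f \<in> borel_measurable borel" and gm [measurable]: "g \<in> borel_measurable borel"
      using borel_measurable_integrable[OF f] borel_measurable_integrable[OF g] by auto
    define \<eta> where "\<eta> = max \<delta> (1 / 2 ^ j)"
    have eta: "0 < \<eta>" using d by (simp add: \<eta>_def)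
    let ?A = "4 * 2 ^ j * sphere_energy \<eta> f" and ?B = "LINT \<xi>|lborel. exp (- (norm \<xi>)\<^sup>2) * (cmod (fourier g \<xi>))\<^sup>2"
    have gi: "integrable lborel (\<lambda>\<xi>. exp (- (norm \<xi>)\<^sup>2) * (cmod (fourier g \<xi>))\<^sup>2)"
      by (rule integrable_gauss_fourier[where B=1]) (auto intro!: borel_measurable_continuous_onI continuous_intros)
    have A0: "0 \<le> ?A" using sphere_energy_nonneg[OF eta, of f] by (intro mult_nonneg_nonneg) auto
    let ?W = "LINT \<xi>|lborel. cmod (dyadic_weight \<delta> j \<xi> * fourier f \<xi> * cnj (fourier g \<xi>))"
    have W0: "0 \<le> ?W" by (intro integral_nonneg_AE) simp
    have W1: "cmod (dyadic_form \<delta> j f g) \<le> ?W"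
      unfolding dyadic_form_def by (rule integral_norm_bound)
    have "cmod (dyadic_form \<delta> j g f) \<le> (LINT \<xi>|lborel. cmod (dyadic_weight \<delta> j \<xi> * fourier g \<xi> * cnj (fourier f \<xi>)))"
      unfolding dyadic_form_def by (rule integral_norm_bound)
    also have "\<dots> = ?W" by (simp add: norm_mult mult_ac)
    finally have W2: "cmod (dyadic_form \<delta> j g f) \<le> ?W" .
    have "?W\<^sup>2 \<le> ?A * ?B"
    proof (rule le_sqrt_of_amgm)
      show "0 \<le> ?B" by (intro integral_nonneg_AE) simp
      fix t :: real assume t: "0 < t"
      have "?W \<le> (LINT \<xi>|lborel. t / 2 * (4 * 2 ^ j) * (sphere_weight \<eta> \<xi> * (cmod (fourier f \<xi>))\<^sup>2) + 1 / (2 * t) * (exp (- (norm \<xi>)\<^sup>2) * (cmod (fourier g \<xi>))\<^sup>2))"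
      proof (rule integral_mono)
        show "integrable lborel (\<lambda>\<xi>. cmod (dyadic_weight \<delta> j \<xi> * fourier f \<xi> * cnj (fourier g \<xi>)))"
          by (intro integrable_norm integrable_dyadic_form fm gm d)
        show "integrable lborel (\<lambda>\<xi>. t / 2 * (4 * 2 ^ j) * (sphere_weight \<eta> \<xi> * (cmod (fourier f \<xi>))\<^sup>2) + 1 / (2 * t) * (exp (- (norm \<xi>)\<^sup>2) * (cmod (fourier g \<xi>))\<^sup>2))"
          by (intro Bochner_Integration.integrable_add integrable_mult_right gi integrable_sphere_energy fm eta)
        fix \<xi> :: 'a
        let ?m = "cmod (dyadic_mult \<delta> j \<xi>)" and ?F = "cmod (fourier f \<xi>)" and ?G = "cmod (fourier g \<xi>)" and ?e = "exp (- (norm \<xi>)\<^sup>2)"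
        have am: "x * y \<le> t / 2 * x\<^sup>2 + 1 / (2 * t) * y\<^sup>2" for x y :: real
        proof -
          have "0 \<le> (t * x - y)\<^sup>2" by simp
          then have "2 * t * (x * y) \<le> t\<^sup>2 * x\<^sup>2 + y\<^sup>2" by (simp add: power2_diff power_mult_distrib)
          then show ?thesis using t by (simp add: field_simps power2_eq_square)
        qed
        have "cmod (dyadic_weight \<delta> j \<xi> * fourier f \<xi> * cnj (fourier g \<xi>)) = ?e * ((?m * ?F) * ?G)"
          by (simp add: dyadic_weight_def norm_mult flip: exp_of_real)
        also have "\<dots> \<le> ?e * (t / 2 * (?m * ?F)\<^sup>2 + 1 / (2 * t) * ?G\<^sup>2)"
          by (intro mult_left_mono am) auto
        also have "\<dots> = t / 2 * (?e * ?F\<^sup>2) * ?m\<^sup>2 + 1 / (2 * t) * (?e * ?G\<^sup>2)"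
          by (simp add: algebra_simps power_mult_distrib)
        also have "\<dots> \<le> t / 2 * (?e * ?F\<^sup>2) * (4 * 2 ^ j * poisson \<eta> ((norm \<xi>)\<^sup>2 - 1)) + 1 / (2 * t) * (?e * ?G\<^sup>2)"
          using norm_dyadic_mult_sq_le[OF d, of j \<xi>] t by (intro add_right_mono mult_left_mono) (auto simp: \<eta>_def)
        also have "\<dots> = t / 2 * (4 * 2 ^ j) * (sphere_weight \<eta> \<xi> * ?F\<^sup>2) + 1 / (2 * t) * (?e * ?G\<^sup>2)"
          by (simp add: sphere_weight_def mult_ac)
        finally show "cmod (dyadic_weight \<delta> j \<xi> * fourier f \<xi> * cnj (fourier g \<xi>)) \<le> t / 2 * (4 * 2 ^ j) * (sphere_weight \<eta> \<xi> * ?F\<^sup>2) + 1 / (2 * t) * (?e * ?G\<^sup>2)" .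
      qed
      also have "\<dots> = t / 2 * (4 * 2 ^ j) * sphere_energy \<eta> f + 1 / (2 * t) * ?B"
        unfolding sphere_energy_def
        by (subst Bochner_Integration.integral_add) (auto intro!: integrable_mult_right gi integrable_sphere_energy fm eta)
      finally show "?W \<le> t / 2 * ?A + ?B / (2 * t)" by (simp add: mult_ac)
    qed (use A0 W0 in auto)
    also have "\<dots> \<le> ?A * (C0 * (LINT x|lborel. (cmod (g x))\<^sup>2))"
      using C0(2)[OF g g2] A0 by (rule mult_left_mono)
    finally have fin: "?W\<^sup>2 \<le> 4 * C0 * 2 ^ j * sphere_energy (max \<delta> (1 / 2 ^ j)) f * (LINT x|lborel. (cmod (g x))\<^sup>2)"
      by (simp add: \<eta>_def mult_ac)
    from order_trans[OF power_mono[OF W1 norm_ge_zero, of 2] fin] order_trans[OF power_mono[OF W2 norm_ge_zero, of 2] fin]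
    show "(cmod (dyadic_form \<delta> j f g))\<^sup>2 \<le> 4 * C0 * 2 ^ j * sphere_energy (max \<delta> (1 / 2 ^ j)) f * (LINT x|lborel. (cmod (g x))\<^sup>2) \<and>
      (cmod (dyadic_form \<delta> j g f))\<^sup>2 \<le> 4 * C0 * 2 ^ j * sphere_energy (max \<delta> (1 / 2 ^ j)) f * (LINT x|lborel. (cmod (g x))\<^sup>2)"
      by blast
  qed (use C0 in simp)
qed

lemma sum_dyadic_mult:
  "(\<Sum>j\<le>N. dyadic_mult \<delta> j \<xi>) = (exp (osc_rate \<delta> \<xi> * 2 ^ N) - 1) / osc_rate \<delta> \<xi>"
proof (induction N)
  case 0
  then show ?case by (simp add: dyadic_mult_def dyadic_lo_def)
next
  case (Suc N)
  then show ?case by (simp add: dyadic_mult_def dyadic_lo_bounds(4) diff_divide_distrib del: power_Suc)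
qed

text \<open>The multipliers up to index N add up to (exp (z 2^N) - 1) / z. Twice its real part is
  the Poisson kernel up to an error of at most 2 / \<delta> * exp (- \<delta> 2^N), which vanishes
  for fixed \<delta> as N grows. A bound on the partial sums that is uniform in N is therefore
  enough, and the integral over the whole half-line in s is never formed.\<close>

lemma sphere_energy_le_dyadic_forms:
  fixes f :: "'a::euclidean_space \<Rightarrow> complex"
  assumes f: "f \<in> borel_measurable borel" and d: "0 < \<delta>" and X: "\<And>N. cmod (\<Sum>j\<le>N. dyadic_form \<delta> j f f) \<le> X"
  shows "sphere_energy \<delta> f \<le> 2 * X"
proof -
  note [measurable] = f
  let ?e = "\<lambda>\<xi>::'a. exp (- (norm \<xi>)\<^sup>2)"
  define G where "G = (LINT \<xi>|lborel. ?e \<xi> * (cmod (fourier f \<xi>))\<^sup>2)"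
  have gi: "integrable lborel (\<lambda>\<xi>. ?e \<xi> * (cmod (fourier f \<xi>))\<^sup>2)"
    by (rule integrable_gauss_fourier[where B=1]) (auto intro!: borel_measurable_continuous_onI continuous_intros)
  have b: "sphere_energy \<delta> f \<le> 2 * X + 2 * G / \<delta> * exp (- \<delta> * 2 ^ N)" for N
  proof -
    define S where "S \<xi> = (\<Sum>j\<le>N. dyadic_weight \<delta> j \<xi> * fourier f \<xi> * cnj (fourier f \<xi>))" for \<xi>
    have Si: "integrable lborel S" unfolding S_def by (intro Bochner_Integration.integrable_sum integrable_dyadic_form f d)
    have SL: "(LINT \<xi>|lborel. S \<xi>) = (\<Sum>j\<le>N. dyadic_form \<delta> j f f)"
      unfolding S_def dyadic_form_def by (intro Bochner_Integration.integral_sum integrable_dyadic_form f d)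
    have Se: "S \<xi> = complex_of_real (?e \<xi> * (cmod (fourier f \<xi>))\<^sup>2) * ((exp (osc_rate \<delta> \<xi> * 2 ^ N) - 1) / osc_rate \<delta> \<xi>)" for \<xi>
      unfolding S_def sum_dyadic_mult[symmetric] dyadic_weight_def
      by (simp add: sum_distrib_left sum_distrib_right complex_norm_square exp_of_real[symmetric] mult_ac del: of_real_power of_real_exp)
    have "sphere_weight \<delta> \<xi> * (cmod (fourier f \<xi>))\<^sup>2 \<le> 2 * Re (S \<xi>) + 2 / \<delta> * exp (- \<delta> * 2 ^ N) * (?e \<xi> * (cmod (fourier f \<xi>))\<^sup>2)" for \<xi>
    proof -
      let ?z = "osc_rate \<delta> \<xi>"
      have z: "?z \<noteq> 0" by (rule osc_rate_neq_0[OF d])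
      \<comment> \<open>Minus twice this real part is the Poisson kernel; the other term, exp (z
        2^N) / z, is the error.\<close>
      have "Re (1 / ?z) = - poisson \<delta> ((norm \<xi>)\<^sup>2 - 1) / 2"
      proof -
        have "Re (1 / w) = Re w / ((Re w)\<^sup>2 + (Im w)\<^sup>2)" for w :: complex by (simp add: Re_divide)
        moreover have "- d / D = - (2 * d / D) / 2" for d D :: real by simp
        ultimately show ?thesis by (simp only: Re_osc_rate Im_osc_rate poisson_def power2_minus)
      qed
      moreover have "cmod (exp (?z * 2 ^ N) / ?z) \<le> exp (- \<delta> * 2 ^ N) / \<delta>"
      proof -
        have "\<delta> \<le> cmod ?z" using abs_Re_le_cmod[of ?z] d by simp
        moreover have "Re (?z * 2 ^ N) = - \<delta> * 2 ^ N"
        proof -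
          have "?z * 2 ^ N = complex_of_real (2 ^ N) * ?z" by simp
          then show ?thesis by (simp only: times_complex.simps Re_complex_of_real Im_complex_of_real Re_osc_rate) simp
        qed
        ultimately show ?thesis using d by (auto simp: norm_divide norm_exp_eq_Re intro!: divide_left_mono mult_pos_pos)
      qed
      then have "Re (exp (?z * 2 ^ N) / ?z) \<ge> - (exp (- \<delta> * 2 ^ N) / \<delta>)"
        using abs_Re_le_cmod[of "exp (?z * 2 ^ N) / ?z"] by linarith
      ultimately have r: "poisson \<delta> ((norm \<xi>)\<^sup>2 - 1) \<le> 2 * Re ((exp (?z * 2 ^ N) - 1) / ?z) + 2 / \<delta> * exp (- \<delta> * 2 ^ N)"
        by (simp add: diff_divide_distrib)
      let ?w = "?e \<xi> * (cmod (fourier f \<xi>))\<^sup>2"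
      have "?w * poisson \<delta> ((norm \<xi>)\<^sup>2 - 1) \<le> ?w * (2 * Re ((exp (?z * 2 ^ N) - 1) / ?z) + 2 / \<delta> * exp (- \<delta> * 2 ^ N))"
        by (intro mult_left_mono r) auto
      moreover have "Re (S \<xi>) = ?w * Re ((exp (?z * 2 ^ N) - 1) / ?z)" unfolding Se Re_complex_of_real times_complex.simps(1) by simp
      ultimately show ?thesis by (simp add: sphere_weight_def algebra_simps)
    qed
    then have "sphere_energy \<delta> f \<le> (LINT \<xi>|lborel. 2 * Re (S \<xi>) + 2 / \<delta> * exp (- \<delta> * 2 ^ N) * (?e \<xi> * (cmod (fourier f \<xi>))\<^sup>2))"
      unfolding sphere_energy_def
      by (intro integral_mono integrable_sphere_energy f d Bochner_Integration.integrable_add integrable_mult_right gi integrable_Re Si)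
    also have "\<dots> = 2 * Re (LINT \<xi>|lborel. S \<xi>) + 2 / \<delta> * exp (- \<delta> * 2 ^ N) * G"
      using Si gi unfolding G_def by (subst Bochner_Integration.integral_add) (auto intro!: integrable_mult_right integrable_Re)
    also have "Re (LINT \<xi>|lborel. S \<xi>) \<le> X"
      using X[of N] complex_Re_le_cmod[of "LINT \<xi>|lborel. S \<xi>"] unfolding SL by linarith
    finally show ?thesis by (simp add: mult_ac)
  qed
  have "(\<lambda>N. 2 * X + 2 * G / \<delta> * exp (- \<delta> * 2 ^ N)) \<longlonglongrightarrow> 2 * X + 2 * G / \<delta> * 0"
  proof (intro tendsto_intros filterlim_compose[OF exp_at_bot])
    have "filterlim (\<lambda>N. \<delta> * 2 ^ N) at_top sequentially"
      using d by real_asymp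
    then show "filterlim (\<lambda>N. - \<delta> * 2 ^ N) at_bot sequentially"
      by (simp add: filterlim_uminus_at_top)
  qed
  then have l: "(\<lambda>N. 2 * X + 2 * G / \<delta> * exp (- \<delta> * 2 ^ N)) \<longlonglongrightarrow> 2 * X" by simp
  show ?thesis by (rule LIMSEQ_le_const[OF l]) (use b in auto)
qed

lemma fourier_sum:
  fixes F :: "'k \<Rightarrow> 'a::euclidean_space \<Rightarrow> complex"
  assumes "\<And>k. k \<in> K \<Longrightarrow> integrable lborel (F k)"
  shows "fourier (\<lambda>x. \<Sum>k\<in>K. F k x) \<xi> = (\<Sum>k\<in>K. fourier (F k) \<xi>)"
proof -
  have m: "k \<in> K \<Longrightarrow> F k \<in> borel_measurable borel" for k
    using borel_measurable_integrable[OF assms] by simp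
  then have "(\<lambda>x. \<Sum>k\<in>K. F k x) \<in> borel_measurable borel" by simp
  then show ?thesis
    using integrable_iexp_mult[OF assms, of _ 1] m
    by (simp add: fourier_lborel sum_distrib_left Bochner_Integration.integral_sum)
qed

lemma dyadic_form_sum:
  fixes F :: "'k \<Rightarrow> 'a::euclidean_space \<Rightarrow> complex"
  assumes F: "\<And>k. k \<in> K \<Longrightarrow> integrable lborel (F k)" and d: "0 < \<delta>"
  shows "dyadic_form \<delta> j (\<lambda>x. \<Sum>k\<in>K. F k x) (\<lambda>x. \<Sum>k\<in>K. F k x) = (\<Sum>k\<in>K. \<Sum>l\<in>K. dyadic_form \<delta> j (F k) (F l))"
proof -
  have m: "k \<in> K \<Longrightarrow> F k \<in> borel_measurable borel" for k
    using borel_measurable_integrable[OF F] by simp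
  have "dyadic_weight \<delta> j \<xi> * (\<Sum>k\<in>K. fourier (F k) \<xi>) * cnj (\<Sum>k\<in>K. fourier (F k) \<xi>)
      = (\<Sum>k\<in>K. \<Sum>l\<in>K. dyadic_weight \<delta> j \<xi> * fourier (F k) \<xi> * cnj (fourier (F l) \<xi>))" for \<xi>
    unfolding cnj_sum sum_distrib_left sum_distrib_right by (rule sum.swap)
  moreover have "fourier (\<lambda>x. \<Sum>k\<in>K. F k x) \<xi> = (\<Sum>k\<in>K. fourier (F k) \<xi>)" for \<xi>
    by (rule fourier_sum) (rule F)
  ultimately show ?thesis
    unfolding dyadic_form_def
    by (simp only:) (simp add: Bochner_Integration.integral_sum Bochner_Integration.integrable_sum integrable_dyadic_form m d)
qed

section \<open>Dyadic sums and level sets\<close>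

text \<open>What matters is uniformity in the centre \<theta>, which is real and varies with the
  data. Replacing \<theta> by its floor costs the factor 2 powr \<epsilon>, and on either side of
  the floor the distances are distinct integers, so each half is dominated by one geometric
  series.\<close>

lemma sum_two_sided_geometric:
  fixes \<epsilon> :: real
  assumes e: "0 < \<epsilon>"
  obtains S where "0 < S" "\<And>(\<theta>::real) K. finite (K :: int set) \<Longrightarrow> (\<Sum>k\<in>K. 2 powr (- \<epsilon> * \<bar>k - \<theta>\<bar>)) \<le> S"
proof -
  define q where "q = 2 powr (- \<epsilon>)"
  have q: "0 < q" "q < 1" using e by (auto simp: q_def powr_less_one)
  define S0 where "S0 = (\<Sum>i. q ^ i)"
  have sm: "summable (\<lambda>i. q ^ i)" using q by (simp add: summable_geometric)
  have S0: "0 < S0" unfolding S0_def using sm q by (intro suminf_pos) auto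
  have half: "(\<Sum>k\<in>K. 2 powr (- \<epsilon> * \<bar>real_of_int (k - m)\<bar>)) \<le> S0"
    if K: "finite K" and i: "inj_on (\<lambda>k. nat \<bar>k - m\<bar>) K" for K :: "int set" and m
  proof -
    have "(\<Sum>k\<in>K. 2 powr (- \<epsilon> * \<bar>real_of_int (k - m)\<bar>)) = (\<Sum>k\<in>K. q ^ nat \<bar>k - m\<bar>)"
      by (intro sum.cong) (auto simp: q_def powr_realpow[symmetric] powr_powr)
    also have "\<dots> = (\<Sum>i\<in>(\<lambda>k. nat \<bar>k - m\<bar>) ` K. q ^ i)" using i by (simp add: sum.reindex)
    also have "\<dots> \<le> S0" unfolding S0_def using K q sm by (intro sum_le_suminf) auto
    finally show ?thesis .
  qed
  show ?thesis
  proof (rule that[of "2 powr \<epsilon> * (S0 + S0)"])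
    fix \<theta> :: real and K :: "int set" assume K: "finite K"
    define m where "m = \<lfloor>\<theta>\<rfloor>"
    have "(\<Sum>k\<in>K. 2 powr (- \<epsilon> * \<bar>k - \<theta>\<bar>)) \<le> (\<Sum>k\<in>K. 2 powr \<epsilon> * 2 powr (- \<epsilon> * \<bar>real_of_int (k - m)\<bar>))"
    proof (rule sum_mono)
      fix k
      have "\<bar>real_of_int (k - m)\<bar> \<le> 1 + \<bar>k - \<theta>\<bar>" unfolding m_def by linarith
      then have "\<epsilon> * \<bar>real_of_int (k - m)\<bar> \<le> \<epsilon> * (1 + \<bar>k - \<theta>\<bar>)" using e by (intro mult_left_mono) auto
      then show "2 powr (- \<epsilon> * \<bar>k - \<theta>\<bar>) \<le> 2 powr \<epsilon> * 2 powr (- \<epsilon> * \<bar>real_of_int (k - m)\<bar>)"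
        by (simp add: powr_add[symmetric] algebra_simps)
    qed
    also have "\<dots> = 2 powr \<epsilon> * ((\<Sum>k\<in>{k\<in>K. m \<le> k}. 2 powr (- \<epsilon> * \<bar>real_of_int (k - m)\<bar>)) + (\<Sum>k\<in>{k\<in>K. k < m}. 2 powr (- \<epsilon> * \<bar>real_of_int (k - m)\<bar>)))"
      unfolding sum_distrib_left[symmetric]
      by (subst sum.union_disjoint[symmetric]) (use K in \<open>auto intro!: sum.cong\<close>)
    also have "\<dots> \<le> 2 powr \<epsilon> * (S0 + S0)"
      using K by (intro mult_left_mono add_mono half) (auto simp: inj_on_def)
    finally show "(\<Sum>k\<in>K. 2 powr (- \<epsilon> * \<bar>k - \<theta>\<bar>)) \<le> 2 powr \<epsilon> * (S0 + S0)" .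
  qed (use S0 in auto)
qed

text \<open>A decaying and a growing geometric bound cross at one real index, and the sum is
  comparable to their common value there. The weights 1/n and 1 - 1/n are those that eliminate j
  from the product of the two bounds. By 2 \<le> n both rates are at least 1/2, so the previous
  lemma applies on either side of the crossing.\<close>

lemma sum_dyadic_min_bound:
  fixes n :: real
  assumes n: "2 \<le> n"
  obtains S where "0 < S" "\<And>N X Y t. 0 \<le> X \<Longrightarrow> 0 \<le> Y \<Longrightarrow>
     (\<And>j. t j \<le> X * 2 powr (- j * ((n - 1) / 2))) \<Longrightarrow> (\<And>j. t j \<le> Y * 2 powr (j / 2)) \<Longrightarrow>
     (\<Sum>j\<le>(N::nat). t j) \<le> S * (X powr (1 / n) * Y powr (1 - 1 / n))"
proof -
  obtain S where S: "0 < S" "\<And>(\<theta>::real) K. finite (K :: int set) \<Longrightarrow> (\<Sum>k\<in>K. 2 powr (- (1/2) * \<bar>k - \<theta>\<bar>)) \<le> S"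
    using sum_two_sided_geometric[of "1/2"] by auto
  show ?thesis
  proof (rule that[OF S(1)])
    fix N :: nat and X Y :: real and t :: "nat \<Rightarrow> real"
    assume X0: "0 \<le> X" and Y0: "0 \<le> Y" and tX: "\<And>j. t j \<le> X * 2 powr (- j * ((n - 1) / 2))" and tY: "\<And>j. t j \<le> Y * 2 powr (j / 2)"
    show "(\<Sum>j\<le>N. t j) \<le> S * (X powr (1 / n) * Y powr (1 - 1 / n))"
    proof (cases "X = 0 \<or> Y = 0")
      case True
      then have "t j \<le> 0" for j using tX[of j] tY[of j] by auto
      then have "(\<Sum>j\<le>N. t j) \<le> 0" by (rule sum_nonpos)
      also have "0 \<le> S * (X powr (1 / n) * Y powr (1 - 1 / n))" using S by simp
      finally show ?thesis .
    next
      case False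
      then have XY: "0 < X" "0 < Y" using X0 Y0 by auto
      define Z where "Z = X powr (1 / n) * Y powr (1 - 1 / n)"
      \<comment> \<open>The crossing point, the solution of X 2^(- \<theta> (n - 1) / 2) = Y
        2^(\<theta> / 2); the common value there is \<open>Z\<close>.\<close>
      define \<theta> where "\<theta> = 2 / n * log 2 (X / Y)"
      have Z: "0 < Z" using XY by (simp add: Z_def)
      have W: "X / Y = 2 powr (\<theta> * n / 2)" using XY n by (simp add: \<theta>_def)
      have XZ: "X = Z * 2 powr (\<theta> * (n - 1) / 2)"
      proof -
        have "2 powr (\<theta> * (n - 1) / 2) = (X / Y) powr (1 - 1 / n)"
        proof -
          have a: "n * (1 - 1 / n) = n - 1" using n by (simp add: right_diff_distrib)
          have "\<theta> * n / 2 * (1 - 1 / n) = \<theta> * (n * (1 - 1 / n)) / 2" by (simp only: times_divide_eq_left mult.assoc)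
          then show ?thesis unfolding W powr_powr a by (simp only:)
        qed
        also have "Z * \<dots> = X" using XY by (simp add: Z_def powr_divide powr_add[symmetric])
        finally show ?thesis by simp
      qed
      have YZ: "Y = Z * 2 powr (- \<theta> / 2)"
      proof -
        have "2 powr (- \<theta> / 2) = (X / Y) powr (- (1 / n))"
          unfolding W powr_powr using n by (simp add: field_simps)
        also have "Z * \<dots> = Y"
          using XY powr_add[of Y "1 - 1 / n" "1 / n"] by (simp add: Z_def powr_divide powr_minus field_simps)
        finally show ?thesis by simp
      qed
      have "t j \<le> Z * 2 powr (- (1/2) * \<bar>real_of_int (int j) - \<theta>\<bar>)" for j
      proof (cases "\<theta> \<le> j")
        case True
        have "t j \<le> Z * 2 powr (\<theta> * (n - 1) / 2) * 2 powr (- j * ((n - 1) / 2))" using tX[of j] XZ by simp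
        also have "\<dots> = Z * 2 powr (- ((n - 1) / 2) * (j - \<theta>))"
        proof -
          have "\<theta> * (n - 1) / 2 + - j * ((n - 1) / 2) = - ((n - 1) / 2) * (j - \<theta>)" by (simp add: algebra_simps add_divide_distrib diff_divide_distrib)
          then show ?thesis by (simp only: mult.assoc powr_add[symmetric])
        qed
        also have "\<dots> \<le> Z * 2 powr (- (1/2) * (j - \<theta>))"
          using Z n True by (intro mult_left_mono powr_mono mult_right_mono) auto
        finally show ?thesis using True by simp
      next
        case False
        have "t j \<le> Z * 2 powr (- \<theta> / 2) * 2 powr (j / 2)" using tY[of j] YZ by simp
        also have "\<dots> = Z * 2 powr (- (1/2) * (\<theta> - j))"
        proof -
          have "- \<theta> / 2 + j / 2 = - (1/2) * (\<theta> - j)" by (simp add: algebra_simps add_divide_distrib diff_divide_distrib)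
          then show ?thesis by (simp only: mult.assoc powr_add[symmetric])
        qed
        finally show ?thesis using False by (simp add: abs_minus_commute)
      qed
      then have "(\<Sum>j\<le>N. t j) \<le> (\<Sum>j\<le>N. Z * 2 powr (- (1/2) * \<bar>real_of_int (int j) - \<theta>\<bar>))" by (rule sum_mono)
      also have "\<dots> = Z * (\<Sum>k\<in>int ` {..N}. 2 powr (- (1/2) * \<bar>real_of_int k - \<theta>\<bar>))"
        by (simp add: sum.reindex sum_distrib_left)
      also have "\<dots> \<le> Z * S" using Z S(2)[of "int ` {..N}" \<theta>] by (intro mult_left_mono) auto
      finally show ?thesis by (simp add: Z_def mult_ac)
    qed
  qed
qed

text \<open>The working class for f. Unlike test functions it is stable under restriction to Borel
  sets, which both the level sets and the interpolation require, and it lies in every L^p. The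
  radius R is a parameter because the a priori constant depends on it.\<close>

definition bounded_supported :: "real \<Rightarrow> ('a::euclidean_space \<Rightarrow> complex) \<Rightarrow> bool" where
  "bounded_supported R f \<longleftrightarrow> f \<in> borel_measurable borel \<and> (\<exists>M. \<forall>x. cmod (f x) \<le> M) \<and> (\<forall>x. R < norm x \<longrightarrow> f x = 0)"

lemma bounded_supported_measurable: "bounded_supported R f \<Longrightarrow> f \<in> borel_measurable borel"
  by (simp add: bounded_supported_def)

lemma bounded_supported_integrable_powr:
  assumes f: "bounded_supported R (f :: 'a::euclidean_space \<Rightarrow> complex)" and p: "0 < p"
  shows "integrable lborel (\<lambda>x. cmod (f x) powr p)"
proof -
  obtain M where M: "\<And>x. cmod (f x) \<le> M" and s: "\<And>x. R < norm x \<Longrightarrow> f x = 0" and [measurable]: "f \<in> borel_measurable borel"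
    using f by (auto simp: bounded_supported_def)
  have "integrable lborel (\<lambda>x::'a. (M powr p) * indicator (cball 0 R) x)"
    by (intro integrable_mult_right integrable_real_indicator emeasure_bounded_finite) auto
  then show ?thesis
  proof (rule Bochner_Integration.integrable_bound)
    show "AE x in lborel. norm (cmod (f x) powr p) \<le> norm (M powr p * indicator (cball 0 R) x :: real)"
      using M s p by (auto simp: indicator_def dist_norm intro!: powr_mono2)
  qed simp
qed

lemma bounded_supported_integrable:
  assumes f: "bounded_supported R (f :: 'a::euclidean_space \<Rightarrow> complex)"
  shows "integrable lborel f" "integrable lborel (\<lambda>x. (cmod (f x))\<^sup>2)"
proof -
  have "integrable lborel (\<lambda>x. cmod (f x))" using bounded_supported_integrable_powr[OF f, of 1] by simp
  then show "integrable lborel f" using bounded_supported_measurable[OF f] by (simp add: integrable_norm_iff)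
  have "cmod (f x) powr 2 = (cmod (f x))\<^sup>2" for x by simp
  then show "integrable lborel (\<lambda>x. (cmod (f x))\<^sup>2)" using bounded_supported_integrable_powr[OF f, of 2] by simp
qed

lemma bounded_supported_restrict:
  assumes "bounded_supported R f" and [measurable]: "A \<in> sets borel"
  shows "bounded_supported R (\<lambda>x. if x \<in> A then f x else 0)"
proof -
  obtain M where M: "\<And>x. cmod (f x) \<le> M" using assms(1) by (auto simp: bounded_supported_def)
  have [measurable]: "f \<in> borel_measurable borel" using assms(1) by (simp add: bounded_supported_def)
  have "\<forall>x. cmod (if x \<in> A then f x else 0) \<le> M" using M order_trans[OF norm_ge_zero M] by auto
  moreover have "(\<lambda>x. if x \<in> A then f x else 0) \<in> borel_measurable borel" by measurable
  ultimately show ?thesis using assms(1) unfolding bounded_supported_def by (intro conjI exI[of _ M]) auto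
qed

lemma holder_integral:
  fixes f g :: "'a::euclidean_space \<Rightarrow> real"
  assumes p: "1 < p" and q: "1 / p + 1 / q = 1" and f0: "\<And>x. 0 \<le> f x" and g0: "\<And>x. 0 \<le> g x"
    and [measurable]: "f \<in> borel_measurable borel" "g \<in> borel_measurable borel"
    and fp: "integrable lborel (\<lambda>x. f x powr p)" and gq: "integrable lborel (\<lambda>x. g x powr q)"
  shows "integrable lborel (\<lambda>x. f x * g x)"
    and "(LINT x|lborel. f x * g x) \<le> (LINT x|lborel. f x powr p) powr (1 / p) * (LINT x|lborel. g x powr q) powr (1 / q)"
proof -
  have q1: "1 < q"
  proof -
    have "1 / q = 1 - 1 / p" using q by simp
    moreover have "0 < 1 - 1 / p" "1 - 1 / p < 1" using p by auto
    ultimately have "0 < 1 / q" "1 / q < 1" by auto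
    then show ?thesis by (simp add: divide_less_eq split: if_splits)
  qed
  have Y: "a * b \<le> a powr p / p + b powr q / q" if "0 \<le> a" "0 \<le> b" for a b
    using Youngs_inequality[OF p q1 q that] .
  have i: "integrable lborel (\<lambda>x. f x powr p / p + g x powr q / q)" using fp gq by simp
  show int: "integrable lborel (\<lambda>x. f x * g x)"
    by (rule Bochner_Integration.integrable_bound[OF i]) (use Y f0 g0 in \<open>auto simp: abs_of_nonneg intro!: order_trans[OF Y]\<close>)
  define F G where "F = (LINT x|lborel. f x powr p)" and "G = (LINT x|lborel. g x powr q)"
  have FG: "0 \<le> F" "0 \<le> G" unfolding F_def G_def by (intro integral_nonneg_AE; simp)+
  have zero: "(LINT x|lborel. f x * g x) = 0" if "AE x in lborel. f x = 0 \<or> g x = 0"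
    using that by (subst integral_cong_AE[where g="\<lambda>_. 0"]) auto
  show "(LINT x|lborel. f x * g x) \<le> F powr (1 / p) * G powr (1 / q)"
  proof (cases "F = 0 \<or> G = 0")
    case True
    have "AE x in lborel. f x = 0 \<or> g x = 0"
    proof (cases "F = 0")
      case True
      then have "AE x in lborel. f x powr p = 0" using fp unfolding F_def by (subst (asm) integral_nonneg_eq_0_iff_AE) auto
      then show ?thesis by eventually_elim auto
    next
      case False
      then have "G = 0" using True by simp
      then have "AE x in lborel. g x powr q = 0" using gq unfolding G_def by (subst (asm) integral_nonneg_eq_0_iff_AE) auto
      then show ?thesis by eventually_elim auto
    qed
    then show ?thesis using zero by simp
  next
    case False
    then have FG': "0 < F" "0 < G" using FG by auto
    define a b where "a = F powr (1 / p)" and "b = G powr (1 / q)"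
    have ab: "0 < a" "0 < b" "a powr p = F" "b powr q = G" using FG' p q1 by (auto simp: a_def b_def powr_powr)
    have "(LINT x|lborel. f x * g x) \<le> (LINT x|lborel. a * b * (f x powr p / (p * F) + g x powr q / (q * G)))"
    proof (rule integral_mono[OF int])
      show "integrable lborel (\<lambda>x. a * b * (f x powr p / (p * F) + g x powr q / (q * G)))" using fp gq by simp
      fix x
      have "(f x / a) * (g x / b) \<le> (f x / a) powr p / p + (g x / b) powr q / q" using f0 g0 ab by (intro Y) auto
      also have "\<dots> = f x powr p / (p * F) + g x powr q / (q * G)" using f0 g0 ab by (simp add: powr_divide mult.commute)
      finally have "a * b * ((f x / a) * (g x / b)) \<le> a * b * (f x powr p / (p * F) + g x powr q / (q * G))"
        using ab by (intro mult_left_mono) auto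
      then show "f x * g x \<le> a * b * (f x powr p / (p * F) + g x powr q / (q * G))" using ab by simp
    qed
    also have "\<dots> = a * b * (F / (p * F) + G / (q * G))" using fp gq by (simp add: F_def G_def)
    also have "\<dots> = a * b * (1 / p + 1 / q)" using FG' by simp
    finally show ?thesis by (simp add: q a_def b_def)
  qed
qed

section \<open>The endpoint exponent, the a priori constant and level sets\<close>

definition tomas_exponent :: "real \<Rightarrow> real" where
  "tomas_exponent n = 2 * (n + 1) / (n + 3)"

text \<open>The exponent is dual to 2 (n + 1) / (n - 1). The values of r - 1 and 2 - r are what
  makes the powers in the level-set argument collapse.\<close>

lemma tomas_exponent_facts:
  assumes "2 \<le> n"
  shows "1 < tomas_exponent n" "tomas_exponent n < 2" "tomas_exponent n - 1 = (n - 1) / (n + 3)" "2 - tomas_exponent n = 4 / (n + 3)"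
  using assms by (auto simp: tomas_exponent_def field_simps)

text \<open>The thickness is bounded away from \<open>0\<close> and the support is fixed, so that some finite constant exists
  before uniformity is known.\<close>

definition energy_bound :: "'a::euclidean_space itself \<Rightarrow> real \<Rightarrow> real \<Rightarrow> real \<Rightarrow> bool" where
  "energy_bound T \<delta>0 R A \<longleftrightarrow> (\<forall>\<delta>\<in>{\<delta>0..1}. \<forall>f::'a \<Rightarrow> complex. bounded_supported R f \<longrightarrow>
     sphere_energy \<delta> f \<le> A * (LINT x|lborel. cmod (f x) powr tomas_exponent DIM('a)) powr (2 / tomas_exponent DIM('a)))"

text \<open>The weight is at most 2 / \<delta>0 times a Gaussian, and the transform is at most the
  L^1 norm, which Hoelder's inequality on the ball of radius R bounds by the L^r norm. The constant
  degenerates as \<delta>0 tends to 0 or R to infinity; only its finiteness matters.\<close>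

lemma energy_bound_exists:
  assumes d: "0 < \<delta>0" and n: "2 \<le> DIM('a::euclidean_space)"
  shows "\<exists>A. energy_bound TYPE('a) \<delta>0 R A"
proof -
  define r where "r = tomas_exponent DIM('a)"
  have r: "1 < r" using tomas_exponent_facts(1)[of "DIM('a)"] n by (simp add: r_def)
  define V where "V = measure lborel (cball (0::'a) R)"
  define E where "E = (LINT \<xi>::'a|lborel. exp (- (norm \<xi>)\<^sup>2))"
  define q where "q = 1 / (1 - 1 / r)"
  have E0: "0 \<le> E" unfolding E_def by (intro integral_nonneg_AE) simp
  have "energy_bound TYPE('a) \<delta>0 R (2 / \<delta>0 * E * (V powr (1 / q))\<^sup>2)"
    unfolding energy_bound_def r_def[symmetric]
  proof (intro ballI allI impI)
    fix \<delta> :: real and f :: "'a \<Rightarrow> complex" assume dd: "\<delta> \<in> {\<delta>0..1}" and f: "bounded_supported R f"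
    have d0: "0 < \<delta>" using dd d by simp
    have [measurable]: "f \<in> borel_measurable borel" by (rule bounded_supported_measurable[OF f])
    let ?N = "LINT x|lborel. cmod (f x)"
    have "?N = (LINT x|lborel. cmod (f x) * indicator (cball 0 R) x)"
      using f by (intro Bochner_Integration.integral_cong) (auto simp: bounded_supported_def indicator_def)
    also have "\<dots> \<le> (LINT x|lborel. cmod (f x) powr r) powr (1 / r) * (LINT x|lborel. (indicator (cball (0::'a) R) x) powr q) powr (1 / q)"
    proof (rule holder_integral(2)[OF r])
      have "integrable lborel (indicator (cball 0 R) :: 'a \<Rightarrow> real)"
        by (intro integrable_real_indicator emeasure_bounded_finite) auto
      moreover have "(\<lambda>x. (indicator (cball 0 R) x :: real) powr q) = (indicator (cball 0 R) :: 'a \<Rightarrow> real)"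
        by (auto simp: fun_eq_iff indicator_def)
      ultimately show "integrable lborel (\<lambda>x::'a. (indicator (cball 0 R) x :: real) powr q)" by simp
    qed (use r bounded_supported_integrable_powr[OF f] in \<open>auto simp: q_def intro!: borel_measurable_indicator\<close>)
    also have "(\<lambda>x. (indicator (cball 0 R) x :: real) powr q) = (indicator (cball 0 R) :: 'a \<Rightarrow> real)"
      by (auto simp: fun_eq_iff indicator_def)
    finally have N: "?N \<le> (LINT x|lborel. cmod (f x) powr r) powr (1 / r) * V powr (1 / q)"
      by (simp add: V_def)
    have N0: "0 \<le> ?N" by (intro integral_nonneg_AE) simp
    have "sphere_energy \<delta> f \<le> (LINT \<xi>::'a|lborel. exp (- (norm \<xi>)\<^sup>2) * (2 / \<delta>0 * ?N\<^sup>2))"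
      unfolding sphere_energy_def
    proof (rule integral_mono[OF integrable_sphere_energy])
      show "integrable lborel (\<lambda>\<xi>::'a. exp (- (norm \<xi>)\<^sup>2) * (2 / \<delta>0 * ?N\<^sup>2))"
        by (intro integrable_mult_left integrable_gauss_n)
      fix \<xi> :: 'a
      have "2 / \<delta> \<le> 2 / \<delta>0" using dd d by (intro divide_left_mono) auto
      then have "sphere_weight \<delta> \<xi> \<le> exp (- (norm \<xi>)\<^sup>2) * (2 / \<delta>0)"
        by (intro order_trans[OF sphere_weight_le[OF d0]] mult_left_mono) auto
      moreover have "(cmod (fourier f \<xi>))\<^sup>2 \<le> ?N\<^sup>2" by (intro power_mono norm_fourier_le) auto
      ultimately have "sphere_weight \<delta> \<xi> * (cmod (fourier f \<xi>))\<^sup>2 \<le> (exp (- (norm \<xi>)\<^sup>2) * (2 / \<delta>0)) * ?N\<^sup>2"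
        using d by (intro mult_mono) auto
      then show "sphere_weight \<delta> \<xi> * (cmod (fourier f \<xi>))\<^sup>2 \<le> exp (- (norm \<xi>)\<^sup>2) * (2 / \<delta>0 * ?N\<^sup>2)" by simp
    qed (use d0 in auto)
    also have "\<dots> = 2 / \<delta>0 * E * ?N\<^sup>2" by (simp add: E_def)
    also have "\<dots> \<le> 2 / \<delta>0 * E * ((LINT x|lborel. cmod (f x) powr r) powr (1 / r) * V powr (1 / q))\<^sup>2"
      using N N0 d E0 by (intro mult_left_mono power_mono) auto
    also have "\<dots> = 2 / \<delta>0 * E * (V powr (1 / q))\<^sup>2 * (LINT x|lborel. cmod (f x) powr r) powr (2 / r)"
    proof -
      have "(b powr (1 / r))\<^sup>2 = b powr (2 / r)" for b :: real
        by (simp add: power2_eq_square powr_add[symmetric])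
      then show ?thesis by (simp add: power_mult_distrib)
    qed
    finally show "sphere_energy \<delta> f \<le> 2 / \<delta>0 * E * (V powr (1 / q))\<^sup>2 * (LINT x|lborel. cmod (f x) powr r) powr (2 / r)" .
  qed
  then show ?thesis by blast
qed

text \<open>\<open>c\<close> and \<open>d\<close> are the contributions of the level sets \<open>|f| \<approx> 2\<^sup>k\<close> and \<open>|f| \<approx> 2\<^sup>l\<close> to \<open>\<integral> |f|\<^sup>r\<close>;
  the two factors on the left are the \<open>L\<^sup>1\<close> bound and the \<open>L\<^sup>2\<close> bound (with the a priori constant \<open>A\<close>)
  at the scale where they balance.\<close>

lemma level_form_bound_arith:
  fixes n k l A c d C1 C2 :: real
  defines "r \<equiv> tomas_exponent n"
  assumes n: "2 \<le> n" and lk: "l \<le> k" and A: "1 \<le> A" and c: "0 \<le> c" "c \<le> 1" and d: "0 \<le> d" "d \<le> 1" and C: "0 < C1" "0 < C2"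
  shows "(C1 * (2 powr (k * (1 - r)) * c) * (2 powr (l * (1 - r)) * d)) powr (1 / n)
      * (sqrt (C2 * A * c powr (2 / r) * (2 powr ((l + 1) * (2 - r)) * d))) powr (1 - 1 / n)
    \<le> C1 powr (1 / n) * (sqrt C2 * 2) powr (1 - 1 / n) * sqrt A * 2 powr (- ((r - 1) / n) * (k - l)) * (c + d)"
proof (cases "c = 0 \<or> d = 0")
  case False
  then have c0: "0 < c" and d0: "0 < d" using c d by auto
  define m where "m = 1 - 1 / n"
  have m: "0 \<le> m" "m \<le> 1" "1 / n = 1 - m" using n by (auto simp: m_def)
  note r = tomas_exponent_facts[OF n, folded r_def]
  have r0: "0 < r" using r by simp
  have sq: "sqrt (C2 * A * c powr (2 / r) * (2 powr ((l + 1) * (2 - r)) * d)) = sqrt C2 * sqrt A * c powr (1 / r) * 2 powr ((l + 1) * (2 - r) / 2) * d powr (1 / 2)"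
  proof -
    have h: "sqrt (x powr y) = x powr (y / 2)" if "0 < x" for x y :: real
      using that by (simp add: powr_half_sqrt[symmetric] powr_powr)
    show ?thesis using c0 d0 by (simp add: real_sqrt_mult h powr_half_sqrt)
  qed
  \<comment> \<open>Here the value of r enters: (2 - r) / 2 * (1 - 1 / n) equals 2 (r - 1) / n, so
    the lower level retains the exponent + l (r - 1) / n and the higher one - k (r - 1) / n. The
    leftover (2 - r) / 2 * m comes from the upper end 2^(l + 1) of the lower level.\<close>
  have e2: "k * (1 - r) * (1 / n) + l * (1 - r) * (1 / n) + (l + 1) * (2 - r) / 2 * m = - ((r - 1) / n) * (k - l) + (2 - r) / 2 * m"
  proof -
    have mn: "m = (n - 1) / n" using n by (simp add: m_def diff_divide_distrib)
    have "(4 / a) / 2 * ((n - 1) / n) = 2 * ((n - 1) / a) / n" for a by simp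
    then have "(2 - r) / 2 * m = 2 * (r - 1) / n" unfolding r(3,4) mn .
    moreover have "(l + 1) * (2 - r) / 2 * m = l * ((2 - r) / 2 * m) + (2 - r) / 2 * m"
      by (simp add: algebra_simps add_divide_distrib diff_divide_distrib)
    ultimately have "(l + 1) * (2 - r) / 2 * m = l * (2 * (r - 1) / n) + (2 - r) / 2 * m" by metis
    moreover have "k * (1 - r) * (1 / n) + l * (1 - r) * (1 / n) + l * (2 * (r - 1) / n) = - ((r - 1) / n) * (k - l)"
      by (simp add: algebra_simps add_divide_distrib diff_divide_distrib)
    ultimately show ?thesis by (metis add.assoc)
  qed
  have lhs: "(C1 * (2 powr (k * (1 - r)) * c) * (2 powr (l * (1 - r)) * d)) powr (1 / n)
      * (sqrt (C2 * A * c powr (2 / r) * (2 powr ((l + 1) * (2 - r)) * d))) powr m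
    = C1 powr (1 / n) * (sqrt C2) powr m * (sqrt A) powr m * 2 powr (k * (1 - r) * (1 / n) + l * (1 - r) * (1 / n) + (l + 1) * (2 - r) / 2 * m)
       * c powr (1 / n + 1 / r * m) * d powr (1 / n + 1 / 2 * m)"
    unfolding sq using c0 d0 C A by (simp add: powr_mult powr_powr powr_add mult_ac)
  \<comment> \<open>Since c and d are at most 1 and both exponents at least 1/2, the product is at
    most sqrt (c d). The bound c + d makes the double sum over levels linear in the masses.\<close>
  have cd: "c powr (1 / n + 1 / r * m) * d powr (1 / n + 1 / 2 * m) \<le> c + d"
  proof -
    have "1 / 2 \<le> 1 / r" using r r0 by (simp add: field_simps)
    then have "1 / 2 * m \<le> 1 / r * m" using m by (intro mult_right_mono) auto
    then have x: "1 / 2 \<le> 1 / n + 1 / r * m" "1 / 2 \<le> 1 / n + 1 / 2 * m" using m by auto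
    have "c powr (1 / n + 1 / r * m) * d powr (1 / n + 1 / 2 * m) \<le> c powr (1 / 2) * d powr (1 / 2)"
      using c0 d0 c d x by (intro mult_mono powr_mono') auto
    also have "\<dots> = sqrt (c * d)" using c d by (simp add: powr_half_sqrt real_sqrt_mult)
    also have "\<dots> \<le> c + d" using arith_geo_mean_sqrt[of c d] c d by simp
    finally show ?thesis .
  qed
  have "2 powr (- ((r - 1) / n) * (k - l) + (2 - r) / 2 * m) = 2 powr (- ((r - 1) / n) * (k - l)) * 2 powr ((2 - r) / 2 * m)"
    by (rule powr_add)
  also have "\<dots> \<le> 2 powr (- ((r - 1) / n) * (k - l)) * 2 powr m"
  proof -
    have "(2 - r) / 2 * m \<le> 1 * m" using r(1,2) m by (intro mult_right_mono) auto
    then show ?thesis by (intro mult_left_mono powr_mono) auto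
  qed
  finally have p2: "2 powr (- ((r - 1) / n) * (k - l) + (2 - r) / 2 * m) \<le> 2 powr (- ((r - 1) / n) * (k - l)) * 2 powr m" .
  have "(sqrt A) powr m \<le> (sqrt A) powr 1" using A m by (intro powr_mono) auto
  then have sA: "(sqrt A) powr m \<le> sqrt A" using A by simp
  have "C1 powr (1 / n) * (sqrt C2) powr m * (sqrt A) powr m * 2 powr (- ((r - 1) / n) * (k - l) + (2 - r) / 2 * m)
       * (c powr (1 / n + 1 / r * m) * d powr (1 / n + 1 / 2 * m))
     \<le> C1 powr (1 / n) * (sqrt C2) powr m * sqrt A * (2 powr (- ((r - 1) / n) * (k - l)) * 2 powr m) * (c + d)"
    using A c d by (intro mult_mono cd p2 sA) (auto intro!: mult_nonneg_nonneg)
  also have "\<dots> = C1 powr (1 / n) * (sqrt C2 * 2) powr m * sqrt A * 2 powr (- ((r - 1) / n) * (k - l)) * (c + d)"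
    using C by (simp add: powr_mult mult_ac)
  finally show ?thesis unfolding lhs[unfolded e2] m_def[symmetric] by (simp add: mult.assoc)
qed (use A c d in auto)

text \<open>On a level set a power of |f| may be traded for a power of 2^k. As 1 - r < 0 < 2 - r,
  the first exchange uses the lower end 2^k of the level, the second the upper end 2^(k +
  1).\<close>

lemma level_integrals:
  assumes f: "bounded_supported R (f :: 'a::euclidean_space \<Rightarrow> complex)" and r: "1 < r" "r < 2"
    and lev: "\<And>x. f x \<noteq> 0 \<Longrightarrow> 2 powr k < cmod (f x) \<and> cmod (f x) \<le> 2 powr (k + 1)"
  shows "(LINT x|lborel. cmod (f x)) \<le> 2 powr (k * (1 - r)) * (LINT x|lborel. cmod (f x) powr r)"
    and "(LINT x|lborel. (cmod (f x))\<^sup>2) \<le> 2 powr ((k + 1) * (2 - r)) * (LINT x|lborel. cmod (f x) powr r)"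
proof -
  have ip: "integrable lborel (\<lambda>x. cmod (f x) powr r)" using f r by (intro bounded_supported_integrable_powr) auto
  have 1: "cmod (f x) \<le> 2 powr (k * (1 - r)) * cmod (f x) powr r" for x
  proof (cases "f x = 0")
    case False
    note l = lev[OF False]
    have "cmod (f x) = cmod (f x) powr (1 - r) * cmod (f x) powr r" using False by (simp add: powr_add[symmetric])
    also have "\<dots> \<le> (2 powr k) powr (1 - r) * cmod (f x) powr r"
      using l r by (intro mult_right_mono powr_mono2') auto
    finally show ?thesis by (simp add: powr_powr)
  qed simp
  have 2: "(cmod (f x))\<^sup>2 \<le> 2 powr ((k + 1) * (2 - r)) * cmod (f x) powr r" for x
  proof (cases "f x = 0")
    case False
    note l = lev[OF False]
    have "(cmod (f x))\<^sup>2 = cmod (f x) powr (2 - r) * cmod (f x) powr r" using False by (simp add: powr_add[symmetric])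
    also have "\<dots> \<le> (2 powr (k + 1)) powr (2 - r) * cmod (f x) powr r"
      using l r by (intro mult_right_mono powr_mono2) auto
    finally show ?thesis by (simp add: powr_powr)
  qed simp
  have "(LINT x|lborel. cmod (f x)) \<le> (LINT x|lborel. 2 powr (k * (1 - r)) * cmod (f x) powr r)"
    using bounded_supported_integrable(1)[OF f] ip by (intro integral_mono 1) auto
  then show "(LINT x|lborel. cmod (f x)) \<le> 2 powr (k * (1 - r)) * (LINT x|lborel. cmod (f x) powr r)" by simp
  have "(LINT x|lborel. (cmod (f x))\<^sup>2) \<le> (LINT x|lborel. 2 powr ((k + 1) * (2 - r)) * cmod (f x) powr r)"
    using bounded_supported_integrable(2)[OF f] ip by (intro integral_mono 2) auto
  then show "(LINT x|lborel. (cmod (f x))\<^sup>2) \<le> 2 powr ((k + 1) * (2 - r)) * (LINT x|lborel. cmod (f x) powr r)" by simp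
qed

text \<open>One turn of the bootstrap, for f with finitely many levels and norm at most 1. Each pair
  of levels is summed over all scales j by balancing its two bounds; the decay in |k - l| then sums
  over the pairs to a multiple of the total mass. The constant depends on the dimension only, not on
  \<delta>0, R, A or the number of levels, and this makes iteration possible.\<close>

lemma energy_bound_step_levels:
  assumes n2: "2 \<le> DIM('a::euclidean_space)"
  obtains C where "0 < C" "\<And>\<delta>0 R A \<delta> M (f :: 'a \<Rightarrow> complex). 0 < \<delta>0 \<Longrightarrow> 1 \<le> A \<Longrightarrow> energy_bound TYPE('a) \<delta>0 R A \<Longrightarrow> \<delta> \<in> {\<delta>0..1} \<Longrightarrow>
     bounded_supported R f \<Longrightarrow> (\<And>x. f x = 0 \<or> 2 powr (- real M) < cmod (f x) \<and> cmod (f x) \<le> 2 powr real M) \<Longrightarrow>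
     (LINT x|lborel. cmod (f x) powr tomas_exponent DIM('a)) \<le> 1 \<Longrightarrow> sphere_energy \<delta> f \<le> C * sqrt A"
proof -
  define n where "n = real DIM('a)"
  have n: "2 \<le> n" using n2 by (simp add: n_def)
  define r where "r = tomas_exponent n"
  note r = tomas_exponent_facts[OF n, folded r_def]
  obtain C1 where C1: "0 < C1" and b1: "\<And>\<delta> j (f::'a \<Rightarrow> complex) g. 0 < \<delta> \<Longrightarrow> integrable lborel f \<Longrightarrow> integrable lborel g \<Longrightarrow>
    cmod (dyadic_form \<delta> j f g) \<le> C1 * (sqrt 2 ^ j / (sqrt 2 ^ j) ^ DIM('a)) * (LINT x|lborel. cmod (f x)) * (LINT x|lborel. cmod (g x))"
    by (rule dyadic_form_L1_bound) blast
  obtain C2 where C2: "0 < C2" and b2: "\<And>\<delta> j (f::'a \<Rightarrow> complex) g. 0 < \<delta> \<Longrightarrow> integrable lborel f \<Longrightarrow> integrable lborel g \<Longrightarrow>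
    integrable lborel (\<lambda>x. (cmod (g x))\<^sup>2) \<Longrightarrow>
    (cmod (dyadic_form \<delta> j f g))\<^sup>2 \<le> C2 * 2 ^ j * sphere_energy (max \<delta> (1 / 2 ^ j)) f * (LINT x|lborel. (cmod (g x))\<^sup>2) \<and>
    (cmod (dyadic_form \<delta> j g f))\<^sup>2 \<le> C2 * 2 ^ j * sphere_energy (max \<delta> (1 / 2 ^ j)) f * (LINT x|lborel. (cmod (g x))\<^sup>2)"
    by (rule dyadic_form_energy_bound) blast
  obtain S where S: "0 < S" and sS: "\<And>N X Y t. 0 \<le> X \<Longrightarrow> 0 \<le> Y \<Longrightarrow>
     (\<And>j. t j \<le> X * 2 powr (- real j * ((n - 1) / 2))) \<Longrightarrow> (\<And>j. t j \<le> Y * 2 powr (real j / 2)) \<Longrightarrow>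
     (\<Sum>j\<le>(N::nat). t j) \<le> S * (X powr (1 / n) * Y powr (1 - 1 / n))"
    by (rule sum_dyadic_min_bound[OF n]) blast
  define \<epsilon> where "\<epsilon> = (r - 1) / n"
  have eps: "0 < \<epsilon>" using r n by (simp add: \<epsilon>_def)
  obtain G where G: "0 < G" and sG: "\<And>(\<theta>::real) K. finite (K :: int set) \<Longrightarrow> (\<Sum>k\<in>K. 2 powr (- \<epsilon> * \<bar>k - \<theta>\<bar>)) \<le> G"
    by (rule sum_two_sided_geometric[OF eps]) blast
  define C3 where "C3 = S * (C1 powr (1 / n) * (sqrt C2 * 2) powr (1 - 1 / n))"
  have C3: "0 < C3" using S C1 C2 by (simp add: C3_def)
  show ?thesis
  proof (rule that[of "2 * (C3 * (2 * G))"])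
    show "0 < 2 * (C3 * (2 * G))" using C3 G by simp
    fix \<delta>0 R A \<delta> :: real and M :: nat and f :: "'a \<Rightarrow> complex"
    assume d0: "0 < \<delta>0" and A: "1 \<le> A" and E: "energy_bound TYPE('a) \<delta>0 R A" and \<delta>: "\<delta> \<in> {\<delta>0..1}"
      and f: "bounded_supported R f" and lev: "\<And>x. f x = 0 \<or> 2 powr (- real M) < cmod (f x) \<and> cmod (f x) \<le> 2 powr real M"
      and N1: "(LINT x|lborel. cmod (f x) powr tomas_exponent DIM('a)) \<le> 1"
    have dp: "0 < \<delta>" using d0 \<delta> by simp
    \<comment> \<open>Level k is the half-open range (2^k, 2^(k + 1)], so the values in (2^-M, 2^M]
      need k from - M to M - 1.\<close>
    define K where "K = {- int M..<int M}"
    define E where "E k = {x. 2 powr real_of_int k < cmod (f x) \<and> cmod (f x) \<le> 2 powr (real_of_int k + 1)}" for k :: int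
    have fm [measurable]: "f \<in> borel_measurable borel" by (rule bounded_supported_measurable[OF f])
    have Em [measurable]: "E k \<in> sets borel" for k unfolding E_def by measurable
    define F where "F k x = (if x \<in> E k then f x else 0)" for k x
    have Fb: "bounded_supported R (F k)" for k unfolding F_def[abs_def] by (rule bounded_supported_restrict[OF f Em])
    have Fl: "F k x \<noteq> 0 \<Longrightarrow> 2 powr real_of_int k < cmod (F k x) \<and> cmod (F k x) \<le> 2 powr (real_of_int k + 1)" for k x
      by (auto simp: F_def E_def split: if_splits)
    define c where "c k = (LINT x|lborel. cmod (F k x) powr r)" for k
    have c0: "0 \<le> c k" for k unfolding c_def by (intro integral_nonneg_AE) simp
    have disj: "x \<in> E k \<Longrightarrow> x \<in> E l \<Longrightarrow> k = l" for x k l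
    proof -
      assume "x \<in> E k" "x \<in> E l"
      then have "2 powr real_of_int k < 2 powr (real_of_int l + 1)" "2 powr real_of_int l < 2 powr (real_of_int k + 1)"
        unfolding E_def by (auto simp del: powr_less_cancel_iff intro: less_le_trans)
      then show "k = l" by simp
    qed
    have cover: "\<exists>k\<in>K. x \<in> E k" if "f x \<noteq> 0" for x
    proof -
      define k where "k = \<lceil>log 2 (cmod (f x))\<rceil> - 1"
      have p: "0 < cmod (f x)" using that by simp
      have l1: "real_of_int k < log 2 (cmod (f x))" "log 2 (cmod (f x)) \<le> real_of_int k + 1"
        unfolding k_def by linarith+
      have l2: "- real M < log 2 (cmod (f x))" "log 2 (cmod (f x)) \<le> real M"
        using lev[of x] that p by (auto simp: less_log_iff log_le_iff)
      have "k \<in> K" unfolding K_def using l1 l2 by auto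
      moreover have "x \<in> E k" unfolding E_def using l1 p by (auto simp: less_log_iff log_le_iff)
      ultimately show ?thesis by blast
    qed
    \<comment> \<open>At each point at most one level is occupied. The identity for h recovers f;
      the r-th power of the modulus shows that the masses \<open>c k\<close> add up to that of
      f.\<close>
    have Fsum: "(\<Sum>k\<in>K. h (F k x)) = h (f x)" if "h 0 = 0" for h :: "complex \<Rightarrow> 'b::comm_monoid_add" and x
    proof (cases "f x = 0")
      case True
      then show ?thesis using that by (simp add: F_def cong: if_cong)
    next
      case False
      then obtain k where k: "k \<in> K" "x \<in> E k" using cover by blast
      have "(\<Sum>l\<in>K. h (F l x)) = (\<Sum>l\<in>K. if l = k then h (f x) else 0)"
        by (intro sum.cong refl) (use k disj that in \<open>auto simp: F_def\<close>)
      then show ?thesis using k by (simp add: K_def)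
    qed
    have csum: "(\<Sum>k\<in>K. c k) \<le> 1"
    proof -
      have "(\<Sum>k\<in>K. c k) = (LINT x|lborel. (\<Sum>k\<in>K. cmod (F k x) powr r))"
        unfolding c_def by (rule Bochner_Integration.integral_sum[symmetric]) (use bounded_supported_integrable_powr[OF Fb] r in auto)
      also have "\<dots> = (LINT x|lborel. cmod (f x) powr r)"
        using Fsum[of "\<lambda>z. cmod z powr r"] by simp
      finally show ?thesis using N1 by (simp add: r_def n_def)
    qed
    have c1: "k \<in> K \<Longrightarrow> c k \<le> 1" for k
      using member_le_sum[of k K c] c0 csum by (force simp: K_def)
    \<comment> \<open>Both orders of the arguments are bounded at once, with the energy always taken
      of the higher level k and the L^2 norm of the lower level l.\<close>
    have T: "(\<Sum>j\<le>N. cmod (dyadic_form \<delta> j (F k) (F l))) \<le> C3 * sqrt A * 2 powr (- \<epsilon> * \<bar>real_of_int k - real_of_int l\<bar>) * (c k + c l)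
        \<and> (\<Sum>j\<le>N. cmod (dyadic_form \<delta> j (F l) (F k))) \<le> C3 * sqrt A * 2 powr (- \<epsilon> * \<bar>real_of_int k - real_of_int l\<bar>) * (c k + c l)"
      if kl: "l \<le> k" and K: "k \<in> K" "l \<in> K" for k l N
    proof -
      define X where "X = C1 * (2 powr (k * (1 - r)) * c k) * (2 powr (l * (1 - r)) * c l)"
      define Y where "Y = sqrt (C2 * A * c k powr (2 / r) * (2 powr ((real_of_int l + 1) * (2 - r)) * c l))"
      have X0: "0 \<le> X" and Y0: "0 \<le> Y" using C1 C2 A c0 by (auto simp: X_def Y_def)
      note Fi = bounded_supported_integrable[OF Fb]
      have La: "(LINT x|lborel. cmod (F k x)) \<le> 2 powr (k * (1 - r)) * c k" for k
        unfolding c_def by (rule level_integrals(1)[OF Fb r(1,2) Fl])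
      have Lb: "(LINT x|lborel. (cmod (F k x))\<^sup>2) \<le> 2 powr ((real_of_int k + 1) * (2 - r)) * c k" for k
        unfolding c_def using level_integrals(2)[OF Fb r(1,2) Fl[of k]] by simp
      have I0: "0 \<le> (LINT x|lborel. cmod (F k x))" for k by (intro integral_nonneg_AE) simp
      have s: "sqrt 2 ^ j / (sqrt 2 ^ j) ^ DIM('a) = 2 powr (- real j * ((n - 1) / 2))" for j
      proof -
        have "sqrt 2 ^ j = 2 powr (real j / 2)" by (simp add: powr_half_sqrt[symmetric] powr_realpow[symmetric] powr_powr)
        moreover have "(2 powr (real j / 2)) ^ DIM('a) = 2 powr (real j / 2 * n)" by (simp add: powr_realpow[symmetric] powr_powr n_def)
        ultimately have "sqrt 2 ^ j / (sqrt 2 ^ j) ^ DIM('a) = 2 powr (real j / 2 - real j / 2 * n)" by (simp add: powr_diff)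
        also have "real j / 2 - real j / 2 * n = - real j * ((n - 1) / 2)" by (simp add: algebra_simps diff_divide_distrib)
        finally show ?thesis .
      qed
      have x: "cmod (dyadic_form \<delta> j (F a) (F b)) \<le> X * 2 powr (- real j * ((n - 1) / 2))"
        if ab: "a = k \<and> b = l \<or> a = l \<and> b = k" for j a b
      proof -
        have "cmod (dyadic_form \<delta> j (F a) (F b)) \<le> C1 * 2 powr (- real j * ((n - 1) / 2)) * (LINT x|lborel. cmod (F a x)) * (LINT x|lborel. cmod (F b x))"
          using b1[OF dp Fi(1) Fi(1), of j a b] unfolding s .
        also have "\<dots> \<le> C1 * 2 powr (- real j * ((n - 1) / 2)) * (2 powr (a * (1 - r)) * c a) * (2 powr (b * (1 - r)) * c b)"
          using C1 I0 c0 by (intro mult_mono La) auto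
        also have "\<dots> = X * 2 powr (- real j * ((n - 1) / 2))" using ab by (auto simp: X_def)
        finally show ?thesis .
      qed
      have y: "cmod (dyadic_form \<delta> j (F k) (F l)) \<le> Y * 2 powr (real j / 2) \<and> cmod (dyadic_form \<delta> j (F l) (F k)) \<le> Y * 2 powr (real j / 2)" for j
      proof -
        \<comment> \<open>The coarser thickness is still admissible, so the a priori bound applies
          to it with the same A.\<close>
        have "max \<delta> (1 / 2 ^ j) \<in> {\<delta>0..1}" using \<delta> by auto
        then have e: "sphere_energy (max \<delta> (1 / 2 ^ j)) (F k) \<le> A * c k powr (2 / r)"
          using E Fb unfolding energy_bound_def c_def r_def n_def by blast
        have e0: "0 \<le> sphere_energy (max \<delta> (1 / 2 ^ j)) (F k)" using dp by (intro sphere_energy_nonneg) auto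
        have "C2 * 2 ^ j * sphere_energy (max \<delta> (1 / 2 ^ j)) (F k) * (LINT x|lborel. (cmod (F l x))\<^sup>2)
           \<le> C2 * 2 ^ j * (A * c k powr (2 / r)) * (2 powr ((real_of_int l + 1) * (2 - r)) * c l)"
          using C2 e0 A Lb[of l] by (intro mult_mono e) auto
        also have "\<dots> = Y\<^sup>2 * (2 powr (real j / 2))\<^sup>2"
          using C2 A c0[of l] by (simp add: Y_def power2_eq_square powr_add[symmetric] powr_realpow mult_ac)
        also have "\<dots> = (Y * 2 powr (real j / 2))\<^sup>2" by (simp add: power_mult_distrib)
        finally have q: "C2 * 2 ^ j * sphere_energy (max \<delta> (1 / 2 ^ j)) (F k) * (LINT x|lborel. (cmod (F l x))\<^sup>2) \<le> (Y * 2 powr (real j / 2))\<^sup>2" .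
        have "0 \<le> Y * 2 powr (real j / 2)" using Y0 by simp
        then show ?thesis
          using b2[OF dp Fi(1) Fi(1) Fi(2), of j k l] q by (meson order_trans power2_le_imp_le)
      qed
      have "S * (X powr (1 / n) * Y powr (1 - 1 / n)) \<le> S * (C1 powr (1 / n) * (sqrt C2 * 2) powr (1 - 1 / n) * sqrt A * 2 powr (- ((r - 1) / n) * (real_of_int k - real_of_int l)) * (c k + c l))"
        unfolding X_def Y_def r_def using S kl K c0 c1 A C1 C2 n
        by (intro mult_left_mono level_form_bound_arith) auto
      also have "\<dots> = C3 * sqrt A * 2 powr (- \<epsilon> * \<bar>real_of_int k - real_of_int l\<bar>) * (c k + c l)"
        using kl by (simp add: C3_def \<epsilon>_def mult_ac)
      finally have z: "S * (X powr (1 / n) * Y powr (1 - 1 / n)) \<le> C3 * sqrt A * 2 powr (- \<epsilon> * \<bar>real_of_int k - real_of_int l\<bar>) * (c k + c l)" .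
      show ?thesis
        using order_trans[OF sS[OF X0 Y0, of "\<lambda>j. cmod (dyadic_form \<delta> j (F k) (F l))" N] z]
          order_trans[OF sS[OF X0 Y0, of "\<lambda>j. cmod (dyadic_form \<delta> j (F l) (F k))" N] z] x y by blast
    qed
    have T': "(\<Sum>j\<le>N. cmod (dyadic_form \<delta> j (F k) (F l))) \<le> C3 * sqrt A * 2 powr (- \<epsilon> * \<bar>real_of_int k - real_of_int l\<bar>) * (c k + c l)"
      if "k \<in> K" "l \<in> K" for k l N
      using T[of l k N] T[of k l N] that by (cases "l \<le> k") (auto simp: abs_minus_commute add.commute)
    have fK: "finite K" by (simp add: K_def)
    have "cmod (\<Sum>j\<le>N. dyadic_form \<delta> j f f) \<le> C3 * (2 * G) * sqrt A" for N
    proof -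
      have fe: "(\<lambda>x. \<Sum>k\<in>K. F k x) = f" using Fsum[of "\<lambda>z. z"] by simp
      have "(\<Sum>j\<le>N. dyadic_form \<delta> j f f) = (\<Sum>j\<le>N. \<Sum>k\<in>K. \<Sum>l\<in>K. dyadic_form \<delta> j (F k) (F l))"
        by (intro sum.cong refl dyadic_form_sum[of K F \<delta>, unfolded fe]) (use bounded_supported_integrable[OF Fb] dp in auto)
      also have "cmod \<dots> \<le> (\<Sum>j\<le>N. \<Sum>k\<in>K. \<Sum>l\<in>K. cmod (dyadic_form \<delta> j (F k) (F l)))"
        by (intro sum_norm_le order_refl)
      also have "\<dots> = (\<Sum>k\<in>K. \<Sum>l\<in>K. \<Sum>j\<le>N. cmod (dyadic_form \<delta> j (F k) (F l)))"
        by (subst sum.swap, rule sum.cong[OF refl], rule sum.swap)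
      also have "\<dots> \<le> (\<Sum>k\<in>K. \<Sum>l\<in>K. C3 * sqrt A * 2 powr (- \<epsilon> * \<bar>real_of_int k - real_of_int l\<bar>) * (c k + c l))"
        by (intro sum_mono T')
      also have "\<dots> = C3 * sqrt A * ((\<Sum>k\<in>K. \<Sum>l\<in>K. c k * 2 powr (- \<epsilon> * \<bar>real_of_int k - real_of_int l\<bar>)) + (\<Sum>k\<in>K. \<Sum>l\<in>K. c l * 2 powr (- \<epsilon> * \<bar>real_of_int k - real_of_int l\<bar>)))"
        unfolding sum.distrib[symmetric] sum_distrib_left by (intro sum.cong refl) (simp add: algebra_simps)
      \<comment> \<open>The decay factor is symmetric in k and l, so both halves agree; summing the
        index that the mass does not involve costs G, and what remains is the total mass.\<close>
      also have "(\<Sum>k\<in>K. \<Sum>l\<in>K. c l * 2 powr (- \<epsilon> * \<bar>real_of_int k - real_of_int l\<bar>)) = (\<Sum>k\<in>K. \<Sum>l\<in>K. c k * 2 powr (- \<epsilon> * \<bar>real_of_int k - real_of_int l\<bar>))"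
        by (subst sum.swap) (simp add: abs_minus_commute)
      also have "(\<Sum>k\<in>K. \<Sum>l\<in>K. c k * 2 powr (- \<epsilon> * \<bar>real_of_int k - real_of_int l\<bar>)) \<le> (\<Sum>k\<in>K. c k * G)"
      proof (rule sum_mono)
        fix k
        have "(\<Sum>l\<in>K. c k * 2 powr (- \<epsilon> * \<bar>real_of_int k - real_of_int l\<bar>)) = c k * (\<Sum>l\<in>K. 2 powr (- \<epsilon> * \<bar>real_of_int l - real_of_int k\<bar>))"
          by (simp add: sum_distrib_left abs_minus_commute)
        also have "\<dots> \<le> c k * G" by (intro mult_left_mono sG fK c0)
        finally show "(\<Sum>l\<in>K. c k * 2 powr (- \<epsilon> * \<bar>real_of_int k - real_of_int l\<bar>)) \<le> c k * G" .
      qed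
      also have "(\<Sum>k\<in>K. c k * G) \<le> 1 * G"
        unfolding sum_distrib_right[symmetric] using csum G by (intro mult_right_mono) auto
      finally show ?thesis using C3 A by (simp add: mult_ac)
    qed
    from sphere_energy_le_dyadic_forms[OF fm dp this]
    show "sphere_energy \<delta> f \<le> 2 * (C3 * (2 * G)) * sqrt A" by (simp add: mult_ac)
  qed
qed

section \<open>The endpoint restriction theorem for thin shells\<close>

lemma fourier_cmult: "fourier (\<lambda>x. c * f x) \<xi> = c * fourier f \<xi>"
  unfolding fourier_def by (simp add: mult.left_commute[of _ c])

lemma sphere_energy_cmult: "sphere_energy \<delta> (\<lambda>x. c * f x) = (cmod c)\<^sup>2 * sphere_energy \<delta> f"
  unfolding sphere_energy_def fourier_cmult
  by (simp add: norm_mult power_mult_distrib mult.left_commute[of _ "(cmod c)\<^sup>2"])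

lemma fourier_eq_0:
  assumes f: "bounded_supported R (f :: 'a::euclidean_space \<Rightarrow> complex)" and p: "0 < p" and z: "(LINT x|lborel. cmod (f x) powr p) = 0"
  shows "fourier f \<xi> = 0"
proof -
  have "AE x in lborel. cmod (f x) powr p = 0"
    using z bounded_supported_integrable_powr[OF f p] by (subst (asm) integral_nonneg_eq_0_iff_AE) auto
  then have "AE x in lborel. iexp (x \<bullet> \<xi>) * f x = 0" by eventually_elim auto
  then show ?thesis unfolding fourier_lborel[OF bounded_supported_measurable[OF f]] by (rule integral_eq_zero_AE)
qed

lemma bounded_supported_cmult: "bounded_supported R f \<Longrightarrow> bounded_supported R (\<lambda>x. c * f x)"
proof -
  assume f: "bounded_supported R f"
  then obtain M where M: "\<And>x. cmod (f x) \<le> M" by (auto simp: bounded_supported_def)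
  have [measurable]: "f \<in> borel_measurable borel" by (rule bounded_supported_measurable[OF f])
  have "\<forall>x. cmod (c * f x) \<le> cmod c * M" using M by (auto simp: norm_mult intro!: mult_left_mono)
  with f show ?thesis unfolding bounded_supported_def by auto
qed

lemma bounded_supported_normalise:
  assumes f: "bounded_supported R (f :: 'a::euclidean_space \<Rightarrow> complex)" and p: "0 < p" and nz: "(LINT x|lborel. cmod (f x) powr p) \<noteq> 0"
  defines "N \<equiv> (LINT x|lborel. cmod (f x) powr p)"
  defines "g \<equiv> (\<lambda>x. complex_of_real (N powr (- 1 / p)) * f x)"
  shows "0 < N" "bounded_supported R g" "(LINT x|lborel. cmod (g x) powr p) = 1"
    "fourier f \<xi> = complex_of_real (N powr (1 / p)) * fourier g \<xi>"
    "f = (\<lambda>x. complex_of_real (N powr (1 / p)) * g x)"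
proof -
  have "0 \<le> N" unfolding N_def by (intro integral_nonneg_AE) simp
  then show N: "0 < N" using nz unfolding N_def by linarith
  show "bounded_supported R g" unfolding g_def by (rule bounded_supported_cmult[OF f])
  have "(LINT x|lborel. cmod (g x) powr p) = (LINT x|lborel. 1 / N * cmod (f x) powr p)"
  proof -
    have "(N powr (- 1 / p)) powr p = N powr (- 1)" using p by (simp add: powr_powr)
    also have "\<dots> = 1 / N" using N by (simp add: powr_minus_divide)
    finally have "(N powr (- 1 / p)) powr p = 1 / N" .
    then have "cmod (g x) powr p = 1 / N * cmod (f x) powr p" for x
      unfolding g_def norm_mult norm_of_real by (simp only: abs_of_nonneg powr_ge_zero powr_mult norm_ge_zero)
    then show ?thesis by (simp only:)
  qed
  also have "\<dots> = 1" using N by (simp add: N_def)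
  finally show "(LINT x|lborel. cmod (g x) powr p) = 1" .
  have c: "complex_of_real (N powr (1 / p)) * complex_of_real (N powr (- 1 / p)) = 1"
    using N by (simp flip: of_real_mult powr_add)
  show "f = (\<lambda>x. complex_of_real (N powr (1 / p)) * g x)"
    unfolding g_def mult.assoc[symmetric] c by simp
  then show "fourier f \<xi> = complex_of_real (N powr (1 / p)) * fourier g \<xi>"
    by (metis fourier_cmult)
qed

lemma energy_bound_step:
  assumes n2: "2 \<le> DIM('a::euclidean_space)"
  obtains C where "1 \<le> C" "\<And>\<delta>0 R A. 0 < \<delta>0 \<Longrightarrow> 1 \<le> A \<Longrightarrow> energy_bound TYPE('a) \<delta>0 R A \<Longrightarrow> energy_bound TYPE('a) \<delta>0 R (C * sqrt A)"
proof -
  define r where "r = tomas_exponent DIM('a)"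
  have r: "1 < r" "0 < r" using tomas_exponent_facts(1)[of "DIM('a)"] n2 by (simp_all add: r_def)
  obtain C0 where C0: "0 < C0" and step: "\<And>\<delta>0 R A \<delta> M (f :: 'a \<Rightarrow> complex). 0 < \<delta>0 \<Longrightarrow> 1 \<le> A \<Longrightarrow> energy_bound TYPE('a) \<delta>0 R A \<Longrightarrow> \<delta> \<in> {\<delta>0..1} \<Longrightarrow>
     bounded_supported R f \<Longrightarrow> (\<And>x. f x = 0 \<or> 2 powr (- real M) < cmod (f x) \<and> cmod (f x) \<le> 2 powr real M) \<Longrightarrow>
     (LINT x|lborel. cmod (f x) powr r) \<le> 1 \<Longrightarrow> sphere_energy \<delta> f \<le> C0 * sqrt A"
    unfolding r_def by (rule energy_bound_step_levels[OF n2]) blast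
  define C where "C = max 1 C0"
  show ?thesis
  proof (rule that[of C])
    show "1 \<le> C" by (simp add: C_def)
    fix \<delta>0 R A :: real assume d0: "0 < \<delta>0" and A: "1 \<le> A" and E: "energy_bound TYPE('a) \<delta>0 R A"
    have unit: "sphere_energy \<delta> f \<le> C * sqrt A"
      if \<delta>: "\<delta> \<in> {\<delta>0..1}" and f: "bounded_supported R f" and N: "(LINT x|lborel. cmod (f x) powr r) \<le> 1" for \<delta> and f :: "'a \<Rightarrow> complex"
    proof -
      have dp: "0 < \<delta>" using \<delta> d0 by simp
      have fm [measurable]: "f \<in> borel_measurable borel" by (rule bounded_supported_measurable[OF f])
      define S where "S M = {x. 2 powr (- real M) < cmod (f x) \<and> cmod (f x) \<le> 2 powr real M}" for M :: nat
      have Sm [measurable]: "S M \<in> sets borel" for M unfolding S_def by measurable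
      define F where "F M x = (if x \<in> S M then f x else 0)" for M x
      have Fb: "bounded_supported R (F M)" for M unfolding F_def[abs_def] by (rule bounded_supported_restrict[OF f Sm])
      have Fm [measurable]: "F M \<in> borel_measurable borel" for M by (rule bounded_supported_measurable[OF Fb])
      have Fle: "cmod (F M x) \<le> cmod (f x)" for M x by (simp add: F_def)
      have Flim: "(\<lambda>M. F M x) \<longlonglongrightarrow> f x" for x
      proof (cases "f x = 0")
        case True then show ?thesis by (simp add: F_def cong: if_cong)
      next
        case False
        obtain M0 :: nat where M0: "\<bar>log 2 (cmod (f x))\<bar> < real M0" using reals_Archimedean2 by blast
        have "F M x = f x" if "M0 \<le> M" for M
        proof -
          have "- real M < log 2 (cmod (f x))" "log 2 (cmod (f x)) \<le> real M" using M0 that by auto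
          then show ?thesis using False by (auto simp: F_def S_def less_log_iff log_le_iff)
        qed
        then show ?thesis by (intro tendsto_eventually) (auto simp: eventually_sequentially)
      qed
      have bound: "sphere_energy \<delta> (F M) \<le> C * sqrt A" for M
      proof -
        have "(LINT x|lborel. cmod (F M x) powr r) \<le> (LINT x|lborel. cmod (f x) powr r)"
          using bounded_supported_integrable_powr[OF Fb r(2)] bounded_supported_integrable_powr[OF f r(2)] Fle r
          by (intro integral_mono powr_mono2) auto
        then have "sphere_energy \<delta> (F M) \<le> C0 * sqrt A"
          using N by (intro step[OF d0 A E \<delta> Fb, of M]) (auto simp: F_def S_def)
        also have "\<dots> \<le> C * sqrt A" using A by (intro mult_right_mono) (auto simp: C_def)
        finally show ?thesis .
      qed
      let ?N = "LINT x|lborel. cmod (f x)"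
      have fi: "integrable lborel (\<lambda>x. cmod (f x))" using bounded_supported_integrable(1)[OF f] by simp
      have ff: "(\<lambda>M. fourier (F M) \<xi>) \<longlonglongrightarrow> fourier f \<xi>" for \<xi>
        unfolding fourier_lborel[OF fm] fourier_lborel[OF Fm]
      proof (rule integral_dominated_convergence[where w="\<lambda>x. cmod (f x)"])
        show "AE x in lborel. (\<lambda>M. iexp (x \<bullet> \<xi>) * F M x) \<longlonglongrightarrow> iexp (x \<bullet> \<xi>) * f x"
          by (intro AE_I2 tendsto_intros Flim)
        show "AE x in lborel. norm (iexp (x \<bullet> \<xi>) * F M x) \<le> cmod (f x)" for M
          using Fle by (auto simp: norm_mult)
        show "(\<lambda>x. iexp (x \<bullet> \<xi>) * f x) \<in> borel_measurable lborel"
          "(\<lambda>x. iexp (x \<bullet> \<xi>) * F M x) \<in> borel_measurable lborel" for M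
          using iexp_borel[of 1 \<xi>] by simp_all
      qed (rule fi)
      have "(\<lambda>M. sphere_energy \<delta> (F M)) \<longlonglongrightarrow> sphere_energy \<delta> f"
        unfolding sphere_energy_def
      proof (rule integral_dominated_convergence[where w="\<lambda>\<xi>::'a. exp (- (norm \<xi>)\<^sup>2) * (2 / \<delta> * ?N\<^sup>2)"])
        show "integrable lborel (\<lambda>\<xi>::'a. exp (- (norm \<xi>)\<^sup>2) * (2 / \<delta> * ?N\<^sup>2))"
          by (intro integrable_mult_left integrable_gauss_n)
        show "AE \<xi> in lborel. (\<lambda>M. sphere_weight \<delta> \<xi> * (cmod (fourier (F M) \<xi>))\<^sup>2) \<longlonglongrightarrow> sphere_weight \<delta> \<xi> * (cmod (fourier f \<xi>))\<^sup>2"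
          by (intro AE_I2 tendsto_intros ff)
        show "AE \<xi> in lborel. norm (sphere_weight \<delta> \<xi> * (cmod (fourier (F M) \<xi>))\<^sup>2) \<le> exp (- (norm \<xi>)\<^sup>2) * (2 / \<delta> * ?N\<^sup>2)" for M
        proof (rule AE_I2)
          fix \<xi> :: 'a
          have "cmod (fourier (F M) \<xi>) \<le> (LINT x|lborel. cmod (F M x))" by (rule norm_fourier_le) simp
          also have "\<dots> \<le> ?N" using bounded_supported_integrable(1)[OF Fb] fi Fle by (intro integral_mono) auto
          finally have "(cmod (fourier (F M) \<xi>))\<^sup>2 \<le> ?N\<^sup>2" by (intro power_mono) auto
          then have "sphere_weight \<delta> \<xi> * (cmod (fourier (F M) \<xi>))\<^sup>2 \<le> (exp (- (norm \<xi>)\<^sup>2) * (2 / \<delta>)) * ?N\<^sup>2"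
            using dp by (intro mult_mono sphere_weight_le) auto
          then show "norm (sphere_weight \<delta> \<xi> * (cmod (fourier (F M) \<xi>))\<^sup>2) \<le> exp (- (norm \<xi>)\<^sup>2) * (2 / \<delta> * ?N\<^sup>2)"
            using sphere_weight_nonneg[OF dp, of \<xi>] by (simp add: abs_mult)
        qed
      qed simp_all
      then show ?thesis by (rule LIMSEQ_le_const2) (use bound in auto)
    qed
    show "energy_bound TYPE('a) \<delta>0 R (C * sqrt A)"
      unfolding energy_bound_def r_def[symmetric]
    proof (intro ballI allI impI)
      fix \<delta> and f :: "'a \<Rightarrow> complex" assume \<delta>: "\<delta> \<in> {\<delta>0..1}" and f: "bounded_supported R f"
      define N where "N = (LINT x|lborel. cmod (f x) powr r)"
      show "sphere_energy \<delta> f \<le> C * sqrt A * N powr (2 / r)"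
      proof (cases "N = 0")
        case True
        then have "sphere_energy \<delta> f = 0"
          using fourier_eq_0[OF f r(2)] by (simp add: sphere_energy_def N_def)
        then show ?thesis using A by (simp add: C_def)
      next
        case False
        note nf = bounded_supported_normalise[OF f r(2), folded N_def, OF False]
        let ?g = "\<lambda>x. complex_of_real (N powr (- 1 / r)) * f x"
        have "sphere_energy \<delta> f = (cmod (complex_of_real (N powr (1 / r))))\<^sup>2 * sphere_energy \<delta> ?g"
          by (subst nf(5), rule sphere_energy_cmult)
        also have "\<dots> = N powr (2 / r) * sphere_energy \<delta> ?g"
          by (simp add: power2_eq_square powr_add[symmetric])
        also have "\<dots> \<le> N powr (2 / r) * (C * sqrt A)"
          using unit[OF \<delta> nf(2)] nf(3) by (intro mult_left_mono) auto
        finally show ?thesis by (simp add: mult_ac)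
      qed
    qed
  qed
qed

text \<open>For fixed \<delta>0 and R the admissible constants at least 1 have an infimum a, which
  is itself admissible because the inequality is linear in A. The step puts C sqrt a among them, so
  a \<le> C sqrt a and a \<le> C^2. Since C does not depend on \<delta>0 or R, neither does C^2, and
  both truncation parameters disappear.\<close>

lemma energy_bound_uniform:
  assumes n2: "2 \<le> DIM('a::euclidean_space)"
  obtains C where "0 < C" "\<And>\<delta> R (f :: 'a \<Rightarrow> complex). 0 < \<delta> \<Longrightarrow> \<delta> \<le> 1 \<Longrightarrow> bounded_supported R f \<Longrightarrow>
    sphere_energy \<delta> f \<le> C * (LINT x|lborel. cmod (f x) powr tomas_exponent DIM('a)) powr (2 / tomas_exponent DIM('a))"
proof -
  obtain C where C: "1 \<le> C" and step: "\<And>\<delta>0 R A. 0 < \<delta>0 \<Longrightarrow> 1 \<le> A \<Longrightarrow> energy_bound TYPE('a) \<delta>0 R A \<Longrightarrow> energy_bound TYPE('a) \<delta>0 R (C * sqrt A)"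
    by (rule energy_bound_step[OF n2]) blast
  have main: "energy_bound TYPE('a) \<delta>0 R (C\<^sup>2)" if d: "0 < \<delta>0" for \<delta>0 R
  proof -
    define \<A> where "\<A> = {A. 1 \<le> A \<and> energy_bound TYPE('a) \<delta>0 R A}"
    have mono: "energy_bound TYPE('a) \<delta>0 R A \<Longrightarrow> A \<le> B \<Longrightarrow> energy_bound TYPE('a) \<delta>0 R B" for A B
      unfolding energy_bound_def by (meson mult_right_mono order_trans powr_ge_zero)
    obtain A0 where "energy_bound TYPE('a) \<delta>0 R A0" using energy_bound_exists[OF d n2] by blast
    then have "max 1 A0 \<in> \<A>" using mono[of A0 "max 1 A0"] by (simp add: \<A>_def)
    then have ne: "\<A> \<noteq> {}" by auto
    have bb: "bdd_below \<A>" by (rule bdd_belowI[of _ 1]) (simp add: \<A>_def)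
    define a where "a = Inf \<A>"
    have a1: "1 \<le> a" unfolding a_def using ne by (intro cInf_greatest) (auto simp: \<A>_def)
    have "energy_bound TYPE('a) \<delta>0 R a"
      unfolding energy_bound_def
    proof (intro ballI allI impI)
      fix \<delta> and f :: "'a \<Rightarrow> complex" assume df: "\<delta> \<in> {\<delta>0..1}" "bounded_supported R f"
      let ?X = "(LINT x|lborel. cmod (f x) powr tomas_exponent DIM('a)) powr (2 / tomas_exponent DIM('a))"
      have le: "sphere_energy \<delta> f \<le> A * ?X" if "A \<in> \<A>" for A
        using that df unfolding \<A>_def energy_bound_def by blast
      show "sphere_energy \<delta> f \<le> a * ?X"
      proof (cases "?X = 0")
        case True
        then show ?thesis using le ne by auto
      next
        case False
        then have X: "0 < ?X" using powr_ge_zero[of "LINT x|lborel. cmod (f x) powr tomas_exponent DIM('a)" "2 / tomas_exponent DIM('a)"] by linarith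
        have "sphere_energy \<delta> f / ?X \<le> a"
          unfolding a_def using ne le X by (intro cInf_greatest) (auto simp: divide_le_eq)
        then show ?thesis using X by (simp add: divide_le_eq)
      qed
    qed
    then have "C * sqrt a \<in> \<A>"
      using step[OF d a1] C a1 mult_mono[of 1 C 1 "sqrt a"] by (simp add: \<A>_def)
    then have "a \<le> C * sqrt a" unfolding a_def[symmetric] using cInf_lower[OF _ bb] a_def by metis
    then have "sqrt a * sqrt a \<le> C * sqrt a" using a1 by simp
    then have "sqrt a \<le> C" by (rule mult_right_le_imp_le) (use a1 in simp)
    then have "a \<le> C\<^sup>2" using a1 by (simp add: real_sqrt_le_iff' real_le_lsqrt sqrt_le_D)
    then show ?thesis using mono[OF \<open>energy_bound TYPE('a) \<delta>0 R a\<close>] by simp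
  qed
  show ?thesis
  proof (rule that[of "C\<^sup>2"])
    show "0 < C\<^sup>2" using C by simp
  next
    fix \<delta> R :: real and f :: "'a \<Rightarrow> complex" assume "0 < \<delta>" "\<delta> \<le> 1" "bounded_supported R f"
    then show "sphere_energy \<delta> f \<le> C\<^sup>2 * (LINT x|lborel. cmod (f x) powr tomas_exponent DIM('a)) powr (2 / tomas_exponent DIM('a))"
      using main[of \<delta> R] unfolding energy_bound_def by auto
  qed
qed

section \<open>From the smoothed sphere to shells\<close>

definition shell :: "real \<Rightarrow> real \<Rightarrow> 'a::euclidean_space set" where
  "shell a b = {\<xi>. a < norm \<xi> \<and> norm \<xi> \<le> b}"

lemma shell_measurable [measurable]: "shell a b \<in> sets borel"
  unfolding shell_def by measurable

text \<open>On the shell 0 \<le> |\<xi>|^2 - 1 \<le> 3 \<delta>, so the Poisson factor is at least 2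
  \<delta> / (10 \<delta>^2), and |\<xi>| \<le> 2 bounds the Gaussian below by exp (-4).\<close>

lemma sphere_weight_lower:
  fixes \<delta> :: real
  assumes d: "0 < \<delta>" "\<delta> \<le> 1" and x: "\<xi> \<in> shell 1 (1 + \<delta>)"
  shows "1 \<le> 5 * exp 4 * \<delta> * sphere_weight \<delta> \<xi>"
proof -
  have n: "1 < norm \<xi>" "norm \<xi> \<le> 1 + \<delta>" using x by (auto simp: shell_def)
  have n2: "(norm \<xi>)\<^sup>2 \<le> (1 + \<delta>)\<^sup>2" using n by (intro power_mono) auto
  have n1: "1 \<le> (norm \<xi>)\<^sup>2" using n power_mono[of 1 "norm \<xi>" 2] by simp
  have dd: "\<delta>\<^sup>2 \<le> \<delta>" using d by (simp add: power2_eq_square mult_left_le)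
  have "(1 + \<delta>)\<^sup>2 = 1 + 2 * \<delta> + \<delta>\<^sup>2" by (simp add: power2_sum)
  then have t: "(norm \<xi>)\<^sup>2 - 1 \<le> 3 * \<delta>" "(norm \<xi>)\<^sup>2 \<le> 4" using n2 dd d by auto
  have "((norm \<xi>)\<^sup>2 - 1)\<^sup>2 \<le> (3 * \<delta>)\<^sup>2" using t n1 by (intro power_mono) auto
  then have "2 * \<delta> / (10 * \<delta>\<^sup>2) \<le> poisson \<delta> ((norm \<xi>)\<^sup>2 - 1)"
    unfolding poisson_def using d by (intro divide_left_mono) (auto simp: power_mult_distrib add_pos_nonneg)
  then have p: "1 / (5 * \<delta>) \<le> poisson \<delta> ((norm \<xi>)\<^sup>2 - 1)" using d by (simp add: power2_eq_square)
  have "exp (- 4) \<le> exp (- (norm \<xi>)\<^sup>2)" using t by simp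
  then have "exp (- 4) * (1 / (5 * \<delta>)) \<le> sphere_weight \<delta> \<xi>"
    unfolding sphere_weight_def using p d by (intro mult_mono) auto
  then have "5 * exp 4 * \<delta> * (exp (- 4) * (1 / (5 * \<delta>))) \<le> 5 * exp 4 * \<delta> * sphere_weight \<delta> \<xi>"
    using d by (intro mult_left_mono) auto
  also have "5 * exp 4 * \<delta> * (exp (- 4) * (1 / (5 * \<delta>))) = 1" using d by (simp add: exp_minus)
  finally show ?thesis .
qed

lemma shell_restriction_L2:
  assumes n2: "2 \<le> DIM('a::euclidean_space)"
  obtains C where "0 < C" "\<And>\<delta> R (f :: 'a \<Rightarrow> complex). 0 < \<delta> \<Longrightarrow> \<delta> \<le> 1 \<Longrightarrow> bounded_supported R f \<Longrightarrow>
    (\<integral>\<^sup>+\<xi>. ennreal ((cmod (fourier f \<xi>))\<^sup>2) * indicator (shell 1 (1 + \<delta>)) \<xi> \<partial>lborel)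
      \<le> ennreal (C * \<delta> * (LINT x|lborel. cmod (f x) powr tomas_exponent DIM('a)) powr (2 / tomas_exponent DIM('a)))"
proof -
  obtain C where C: "0 < C" and E: "\<And>\<delta> R (f :: 'a \<Rightarrow> complex). 0 < \<delta> \<Longrightarrow> \<delta> \<le> 1 \<Longrightarrow> bounded_supported R f \<Longrightarrow>
    sphere_energy \<delta> f \<le> C * (LINT x|lborel. cmod (f x) powr tomas_exponent DIM('a)) powr (2 / tomas_exponent DIM('a))"
    by (rule energy_bound_uniform[OF n2]) blast
  show ?thesis
  proof (rule that[of "5 * exp 4 * C"])
    show "0 < 5 * exp 4 * C" using C by simp
    fix \<delta> R :: real and f :: "'a \<Rightarrow> complex" assume d: "0 < \<delta>" "\<delta> \<le> 1" and f: "bounded_supported R f"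
    have fm: "f \<in> borel_measurable borel" by (rule bounded_supported_measurable[OF f])
    let ?X = "(LINT x|lborel. cmod (f x) powr tomas_exponent DIM('a)) powr (2 / tomas_exponent DIM('a))"
    have "(\<integral>\<^sup>+\<xi>. ennreal ((cmod (fourier f \<xi>))\<^sup>2) * indicator (shell 1 (1 + \<delta>)) \<xi> \<partial>lborel)
        \<le> (\<integral>\<^sup>+\<xi>. ennreal (5 * exp 4 * \<delta> * (sphere_weight \<delta> \<xi> * (cmod (fourier f \<xi>))\<^sup>2)) \<partial>lborel)"
    proof (rule nn_integral_mono)
      fix \<xi> :: 'a
      show "ennreal ((cmod (fourier f \<xi>))\<^sup>2) * indicator (shell 1 (1 + \<delta>)) \<xi> \<le> ennreal (5 * exp 4 * \<delta> * (sphere_weight \<delta> \<xi> * (cmod (fourier f \<xi>))\<^sup>2))"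
      proof (cases "\<xi> \<in> shell 1 (1 + \<delta>)")
        case True
        have "1 * (cmod (fourier f \<xi>))\<^sup>2 \<le> (5 * exp 4 * \<delta> * sphere_weight \<delta> \<xi>) * (cmod (fourier f \<xi>))\<^sup>2"
          by (intro mult_right_mono sphere_weight_lower d True) auto
        then show ?thesis using True by (auto simp: mult.assoc intro!: ennreal_leI)
      qed simp
    qed
    also have "\<dots> = ennreal (LINT \<xi>|lborel. 5 * exp 4 * \<delta> * (sphere_weight \<delta> \<xi> * (cmod (fourier f \<xi>))\<^sup>2))"
      using d sphere_weight_nonneg[OF d(1)]
      by (intro nn_integral_eq_integral integrable_mult_right integrable_sphere_energy fm) (auto intro!: AE_I2 mult_nonneg_nonneg)
    also have "(LINT \<xi>|lborel. 5 * exp 4 * \<delta> * (sphere_weight \<delta> \<xi> * (cmod (fourier f \<xi>))\<^sup>2)) = 5 * exp 4 * \<delta> * sphere_energy \<delta> f"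
      by (simp add: sphere_energy_def)
    also have "ennreal \<dots> \<le> ennreal (5 * exp 4 * \<delta> * (C * ?X))"
      using d by (intro ennreal_leI mult_left_mono E[OF d f]) auto
    finally show "(\<integral>\<^sup>+\<xi>. ennreal ((cmod (fourier f \<xi>))\<^sup>2) * indicator (shell 1 (1 + \<delta>)) \<xi> \<partial>lborel) \<le> ennreal (5 * exp 4 * C * \<delta> * ?X)"
      by (simp add: mult_ac)
  qed
qed

section \<open>Interpolation with the trivial $L^1$ bound\<close>

lemma nn_integral_powr_Icc:
  fixes e c :: real
  assumes "0 < e" "0 \<le> c"
  shows "(\<integral>\<^sup>+s. ennreal (s powr (e - 1)) * indicator {0..c} s \<partial>lborel) = ennreal (c powr e / e)"
proof -
  have "((\<lambda>s. s powr (e - 1)) has_integral (c powr e / e)) {0..c}"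
    using has_integral_powr_from_0[of "e - 1" c] assms by simp
  from nn_integral_has_integral_lebesgue[OF _ this]
  show ?thesis by (simp add: ennreal_mult'' ennreal_indicator mult.commute)
qed

lemma fourier_add:
  fixes f g :: "'a::euclidean_space \<Rightarrow> complex"
  assumes "integrable lborel f" "integrable lborel g"
  shows "fourier (\<lambda>x. f x + g x) \<xi> = fourier f \<xi> + fourier g \<xi>"
proof -
  have [measurable]: "f \<in> borel_measurable borel" "g \<in> borel_measurable borel"
    using assms[THEN borel_measurable_integrable] by auto
  show ?thesis
    using integrable_iexp_mult[OF assms(1), of 1 \<xi>] integrable_iexp_mult[OF assms(2), of 1 \<xi>]
    by (simp add: fourier_lborel distrib_left)
qed

text \<open>Marcinkiewicz interpolation carried out with the layer-cake formula. At height s, f is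
  cut at a value for which the upper part has L^1 norm at most s/2. The transform of that part
  cannot exceed s/2, so wherever the transform of f reaches s, that of the lower part reaches s/2,
  and Chebyshev's inequality combines with the L^2 bound. The exponent q lies on the line joining
  the two endpoint estimates.\<close>

lemma shell_restriction_critical_unit:
  fixes p :: real
  assumes n2: "2 \<le> DIM('a::euclidean_space)" and p: "1 < p" "p < tomas_exponent DIM('a)"
    and q: "q = (real DIM('a) - 1) / (real DIM('a) + 1) * (p / (p - 1))"
  obtains C where "0 < C" "\<And>\<delta> R (f :: 'a \<Rightarrow> complex). 0 < \<delta> \<Longrightarrow> \<delta> \<le> 1 \<Longrightarrow> bounded_supported R f \<Longrightarrow>
    (LINT x|lborel. cmod (f x) powr p) = 1 \<Longrightarrow>
    (\<integral>\<^sup>+\<xi>. ennreal (cmod (fourier f \<xi>) powr q) * indicator (shell 1 (1 + \<delta>)) \<xi> \<partial>lborel) \<le> ennreal (C * \<delta>)"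
proof -
  define n where "n = real DIM('a)"
  have n: "2 \<le> n" using n2 by (simp add: n_def)
  define r where "r = tomas_exponent n"
  note r = tomas_exponent_facts(1,2)[OF n, folded r_def]
  have pr: "p < r" using p by (simp add: r_def n_def)
  \<comment> \<open>The L^2 bound contains the power 2/r > 1 of the r-th moment Hr of the lower
    part. The excess 2/r - 1 is spent on the cruder bound Hr \<le> L powr (r - p); what remains is
    linear in Hr, ready for Fubini, at the price of (s/2) powr (- \<kappa>).\<close>
  define \<kappa> where "\<kappa> = (r - p) * (2 / r - 1) / (p - 1)"
  define e where "e = (r - p) / (p - 1)"
  have e: "0 < e" using p pr by (simp add: e_def)
  \<comment> \<open>Here the critical value of q enters: s^(q - 1) from the layer-cake formula, s^-2
    from Chebyshev's inequality and s^(- \<kappa>) combine to s^(e - 1).\<close>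
  have qe: "q - 3 - \<kappa> = e - 1"
  proof -
    have "2 / (2 * a / b) = b / a" for a b :: real by simp
    then have r2: "2 / r = (n + 3) / (n + 1)" unfolding r_def tomas_exponent_def .
    have "q - 2 = (r - p) * (2 / r) / (p - 1)"
    proof -
      have rr: "r * (2 / r) = 2" using r by simp
      have "(r - p) * (2 / r) = 2 - p * (2 / r)" unfolding left_diff_distrib rr ..
      also have "\<dots> = ((n - 1) * p - 2 * (p - 1) * (n + 1)) / (n + 1)"
        unfolding r2 using n by (simp add: field_simps)
      finally have "(r - p) * (2 / r) / (p - 1) = ((n - 1) * p - 2 * (p - 1) * (n + 1)) / ((n + 1) * (p - 1))" by simp
      also have "\<dots> = q - 2"
      proof -
        have "2 * (p - 1) * (n + 1) = 2 * ((n + 1) * (p - 1))" by simp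
        moreover have "(n + 1) * (p - 1) \<noteq> 0" using n p by simp
        moreover have "(B - 2 * D) / D = B / D - 2" if "D \<noteq> 0" for B D :: real
          using that by (simp add: diff_divide_distrib)
        ultimately show ?thesis unfolding q n_def[symmetric]
          by (simp only: times_divide_times_eq)
      qed
      finally show ?thesis by simp
    qed
    also have "\<dots> = e + \<kappa>" unfolding e_def \<kappa>_def add_divide_distrib[symmetric] right_diff_distrib by simp
    finally show ?thesis by simp
  qed
  have k0: "0 \<le> \<kappa>" using p pr r unfolding \<kappa>_def by (intro divide_nonneg_pos mult_nonneg_nonneg) auto
  have q0: "0 < q" using qe e k0 by linarith
  obtain C0 where C0: "0 < C0" and L2: "\<And>\<delta> R (f :: 'a \<Rightarrow> complex). 0 < \<delta> \<Longrightarrow> \<delta> \<le> 1 \<Longrightarrow> bounded_supported R f \<Longrightarrow>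
    (\<integral>\<^sup>+\<xi>. ennreal ((cmod (fourier f \<xi>))\<^sup>2) * indicator (shell 1 (1 + \<delta>)) \<xi> \<partial>lborel)
      \<le> ennreal (C0 * \<delta> * (LINT x|lborel. cmod (f x) powr r) powr (2 / r))"
    unfolding r_def n_def by (rule shell_restriction_L2[OF n2]) blast
  define K where "K = 4 * q * C0 * 2 powr \<kappa>"
  have K: "0 < K" using q0 C0 by (simp add: K_def)
  show ?thesis
  proof (rule that[of "K * 2 powr e / e"])
    show "0 < K * 2 powr e / e" using K e by simp
    fix \<delta> R :: real and f :: "'a \<Rightarrow> complex"
    assume d: "0 < \<delta>" "\<delta> \<le> 1" and f: "bounded_supported R f" and N: "(LINT x|lborel. cmod (f x) powr p) = 1"
    have fm [measurable]: "f \<in> borel_measurable borel" by (rule bounded_supported_measurable[OF f])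
    define S where "S = (shell 1 (1 + \<delta>) :: 'a set)"
    have Sm [measurable]: "S \<in> sets borel" by (simp add: S_def)
    \<comment> \<open>Chosen so that lam s powr (1 - p) = s/2, which bounds the L^1 norm of f above
      the cut when its p-th moment is 1. The cut decreases in s.\<close>
    define lam where "lam s = (s / 2) powr (- 1 / (p - 1))" for s :: real
    have lamm [measurable]: "lam \<in> borel_measurable borel" unfolding lam_def[abs_def] by measurable
    have ip: "integrable lborel (\<lambda>x. cmod (f x) powr p)" using bounded_supported_integrable_powr[OF f] p by simp
    define H where "H s = (\<integral>\<^sup>+x. ennreal (cmod (f x) powr r) * indicator {s. 0 < s \<and> cmod (f x) \<le> lam s} s \<partial>lborel)" for s
    have key: "(\<integral>\<^sup>+\<xi>. indicator {0..cmod (fourier f \<xi>)} s * indicator S \<xi> \<partial>lborel) \<le> ennreal (4 / s\<^sup>2 * (C0 * \<delta>) * (s / 2) powr (- \<kappa>)) * H s"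
      if s: "0 < s" for s
    proof -
      define L where "L = lam s"
      have L: "0 < L" using s by (simp add: L_def lam_def)
      have Lp: "L powr (1 - p) = s / 2"
      proof -
        have "- 1 / (p - 1) * (1 - p) = 1" using p by (simp add: field_simps)
        then have "L powr (1 - p) = (s / 2) powr 1" unfolding L_def lam_def powr_powr by (simp only:)
        then show ?thesis using s by simp
      qed
      define g where "g x = (if x \<in> {x. L < cmod (f x)} then f x else 0)" for x
      define h where "h x = (if x \<in> {x. cmod (f x) \<le> L} then f x else 0)" for x
      have gb: "bounded_supported R g" and hb: "bounded_supported R h"
        unfolding g_def[abs_def] h_def[abs_def] by (intro bounded_supported_restrict f; measurable)+
      have hm [measurable]: "h \<in> borel_measurable borel" by (rule bounded_supported_measurable[OF hb])
      have fgh: "f = (\<lambda>x. g x + h x)" by (auto simp: g_def h_def fun_eq_iff)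
      have "(LINT x|lborel. cmod (g x)) \<le> (LINT x|lborel. L powr (1 - p) * cmod (f x) powr p)"
      proof (rule integral_mono)
        show "integrable lborel (\<lambda>x. cmod (g x))" using bounded_supported_integrable(1)[OF gb] by simp
        show "integrable lborel (\<lambda>x. L powr (1 - p) * cmod (f x) powr p)" using ip by simp
        fix x
        show "cmod (g x) \<le> L powr (1 - p) * cmod (f x) powr p"
        proof (cases "L < cmod (f x)")
          case True
          have "cmod (f x) = cmod (f x) powr (1 - p) * cmod (f x) powr p" using True L by (simp add: powr_add[symmetric])
          also have "\<dots> \<le> L powr (1 - p) * cmod (f x) powr p"
            using True L p by (intro mult_right_mono powr_mono2') auto
          finally show ?thesis using True by (simp add: g_def)
        qed (simp add: g_def)
      qed
      then have g1: "(LINT x|lborel. cmod (g x)) \<le> s / 2" using N by (simp add: Lp)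
      have fh: "cmod (fourier f \<xi>) \<le> s / 2 + cmod (fourier h \<xi>)" for \<xi>
      proof -
        have "fourier f \<xi> = fourier g \<xi> + fourier h \<xi>"
          by (subst fgh) (rule fourier_add[OF bounded_supported_integrable(1)[OF gb] bounded_supported_integrable(1)[OF hb]])
        then show ?thesis
          using norm_triangle_ineq[of "fourier g \<xi>" "fourier h \<xi>"] norm_fourier_le[OF bounded_supported_measurable[OF gb], of \<xi>] g1 by simp
      qed
      define Hr where "Hr = (LINT x|lborel. cmod (h x) powr r)"
      have hi: "integrable lborel (\<lambda>x. cmod (h x) powr r)" using bounded_supported_integrable_powr[OF hb] r by simp
      have Hr0: "0 \<le> Hr" unfolding Hr_def by (intro integral_nonneg_AE) simp
      have HrH: "ennreal Hr = H s"
      proof -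
        have "ennreal Hr = (\<integral>\<^sup>+x. ennreal (cmod (h x) powr r) \<partial>lborel)"
          unfolding Hr_def by (rule nn_integral_eq_integral[symmetric, OF hi]) simp
        also have "\<dots> = H s" unfolding H_def using s by (intro nn_integral_cong) (auto simp: h_def L_def indicator_def)
        finally show ?thesis .
      qed
      have "Hr \<le> (LINT x|lborel. L powr (r - p) * cmod (f x) powr p)"
        unfolding Hr_def
      proof (rule integral_mono[OF hi])
        show "integrable lborel (\<lambda>x. L powr (r - p) * cmod (f x) powr p)" using ip by simp
        fix x
        show "cmod (h x) powr r \<le> L powr (r - p) * cmod (f x) powr p"
        proof (cases "cmod (f x) \<le> L \<and> f x \<noteq> 0")
          case True
          have "cmod (f x) powr r = cmod (f x) powr (r - p) * cmod (f x) powr p" using True by (simp add: powr_add[symmetric])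
          also have "\<dots> \<le> L powr (r - p) * cmod (f x) powr p"
            using True L pr by (intro mult_right_mono powr_mono2) auto
          finally show ?thesis using True by (simp add: h_def)
        qed (auto simp: h_def)
      qed
      then have HrL: "Hr \<le> L powr (r - p)" using N by simp
      have "Hr powr (2 / r) \<le> (s / 2) powr (- \<kappa>) * Hr"
      proof (cases "Hr = 0")
        case False
        have "Hr powr (2 / r) = Hr powr (2 / r - 1) * Hr powr 1" using False by (simp only: powr_add[symmetric]) simp
        also have "\<dots> \<le> (L powr (r - p)) powr (2 / r - 1) * Hr powr 1"
          using HrL Hr0 r by (intro mult_right_mono powr_mono2) auto
        also have "(L powr (r - p)) powr (2 / r - 1) = (s / 2) powr (- \<kappa>)"
          unfolding L_def lam_def powr_powr \<kappa>_def by (simp add: mult.assoc)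
        finally show ?thesis using Hr0 by simp
      qed simp
      then have Hr2: "C0 * \<delta> * Hr powr (2 / r) \<le> C0 * \<delta> * ((s / 2) powr (- \<kappa>) * Hr)"
        using C0 d by (intro mult_left_mono) auto
      have "(\<integral>\<^sup>+\<xi>. indicator {0..cmod (fourier f \<xi>)} s * indicator S \<xi> \<partial>lborel)
          \<le> (\<integral>\<^sup>+\<xi>. ennreal (4 / s\<^sup>2) * (ennreal ((cmod (fourier h \<xi>))\<^sup>2) * indicator S \<xi>) \<partial>lborel)"
      proof (rule nn_integral_mono)
        fix \<xi> :: 'a
        show "indicator {0..cmod (fourier f \<xi>)} s * indicator S \<xi> \<le> ennreal (4 / s\<^sup>2) * (ennreal ((cmod (fourier h \<xi>))\<^sup>2) * indicator S \<xi>)"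
        proof (cases "s \<le> cmod (fourier f \<xi>) \<and> \<xi> \<in> S")
          case True
          then have "s / 2 \<le> cmod (fourier h \<xi>)" using fh[of \<xi>] by simp
          then have "(s / 2)\<^sup>2 \<le> (cmod (fourier h \<xi>))\<^sup>2" using s by (intro power_mono) auto
          then have "1 \<le> 4 / s\<^sup>2 * (cmod (fourier h \<xi>))\<^sup>2" using s by (simp add: power_divide field_simps)
          then have "ennreal 1 \<le> ennreal (4 / s\<^sup>2 * (cmod (fourier h \<xi>))\<^sup>2)" by (rule ennreal_leI)
          then show ?thesis using True s by (simp add: ennreal_mult[symmetric])
        qed (auto simp: indicator_def)
      qed
      also have "\<dots> = ennreal (4 / s\<^sup>2) * (\<integral>\<^sup>+\<xi>. ennreal ((cmod (fourier h \<xi>))\<^sup>2) * indicator S \<xi> \<partial>lborel)"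
        by (rule nn_integral_cmult) simp
      also have "\<dots> \<le> ennreal (4 / s\<^sup>2) * ennreal (C0 * \<delta> * Hr powr (2 / r))"
        unfolding S_def Hr_def by (intro mult_left_mono L2[OF d hb]) auto
      also have "\<dots> \<le> ennreal (4 / s\<^sup>2) * ennreal (C0 * \<delta> * ((s / 2) powr (- \<kappa>) * Hr))"
        by (intro mult_left_mono ennreal_leI Hr2) auto
      also have "\<dots> = ennreal (4 / s\<^sup>2 * (C0 * \<delta>) * (s / 2) powr (- \<kappa>)) * ennreal Hr"
        using C0 d Hr0 by (simp add: ennreal_mult[symmetric] mult_ac)
      finally show ?thesis unfolding HrH .
    qed
    have "(\<integral>\<^sup>+\<xi>. ennreal (cmod (fourier f \<xi>) powr q) * indicator S \<xi> \<partial>lborel)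
        = (\<integral>\<^sup>+\<xi>. (\<integral>\<^sup>+s. ennreal (q * s powr (q - 1)) * (indicator {0..cmod (fourier f \<xi>)} s * indicator S \<xi>) \<partial>lborel) \<partial>lborel)"
    proof (rule nn_integral_cong)
      fix \<xi> :: 'a
      have "(\<integral>\<^sup>+s. ennreal (q * s powr (q - 1)) * (indicator {0..cmod (fourier f \<xi>)} s * indicator S \<xi>) \<partial>lborel)
          = (\<integral>\<^sup>+s. (ennreal q * indicator S \<xi>) * (ennreal (s powr (q - 1)) * indicator {0..cmod (fourier f \<xi>)} s) \<partial>lborel)"
        using q0 by (intro nn_integral_cong) (simp add: ennreal_mult mult_ac)
      also have "\<dots> = (ennreal q * indicator S \<xi>) * ennreal (cmod (fourier f \<xi>) powr q / q)"
        using q0 by (subst nn_integral_cmult) (auto simp: nn_integral_powr_Icc)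
      also have "\<dots> = ennreal (q * (cmod (fourier f \<xi>) powr q / q)) * indicator S \<xi>"
        using q0 by (subst ennreal_mult) (auto simp: mult_ac)
      also have "\<dots> = ennreal (cmod (fourier f \<xi>) powr q) * indicator S \<xi>" using q0 by simp
      finally show "ennreal (cmod (fourier f \<xi>) powr q) * indicator S \<xi> = (\<integral>\<^sup>+s. ennreal (q * s powr (q - 1)) * (indicator {0..cmod (fourier f \<xi>)} s * indicator S \<xi>) \<partial>lborel)" ..
    qed
    also have "\<dots> = (\<integral>\<^sup>+s. (\<integral>\<^sup>+\<xi>. ennreal (q * s powr (q - 1)) * (indicator {0..cmod (fourier f \<xi>)} s * indicator S \<xi>) \<partial>lborel) \<partial>lborel)"
      by (rule lborel_pair.Fubini') (simp add: indicator_def[of "{0.._}"])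
    also have "\<dots> \<le> (\<integral>\<^sup>+s. (\<integral>\<^sup>+x. ennreal (K * \<delta> * s powr (e - 1)) * (ennreal (cmod (f x) powr r) * indicator {s. 0 < s \<and> cmod (f x) \<le> lam s} s) \<partial>lborel) \<partial>lborel)"
    proof (rule nn_integral_mono)
      fix s :: real
      show "(\<integral>\<^sup>+\<xi>. ennreal (q * s powr (q - 1)) * (indicator {0..cmod (fourier f \<xi>)} s * indicator S \<xi>) \<partial>lborel)
        \<le> (\<integral>\<^sup>+x. ennreal (K * \<delta> * s powr (e - 1)) * (ennreal (cmod (f x) powr r) * indicator {s. 0 < s \<and> cmod (f x) \<le> lam s} s) \<partial>lborel)"
      proof (cases "0 < s")
        case False
        then have "indicator {0..cmod (fourier f \<xi>)} s * ennreal (q * s powr (q - 1)) = 0" for \<xi> by (cases "s = 0") auto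
        then have "ennreal (q * s powr (q - 1)) * (indicator {0..cmod (fourier f \<xi>)} s * indicator S \<xi>) = 0" for \<xi>
          by (metis mult.assoc mult.commute mult_zero_left)
        then show ?thesis by (simp only:) simp
      next
        case True
        have "(\<integral>\<^sup>+\<xi>. ennreal (q * s powr (q - 1)) * (indicator {0..cmod (fourier f \<xi>)} s * indicator S \<xi>) \<partial>lborel)
          = ennreal (q * s powr (q - 1)) * (\<integral>\<^sup>+\<xi>. indicator {0..cmod (fourier f \<xi>)} s * indicator S \<xi> \<partial>lborel)"
          by (rule nn_integral_cmult) (simp add: indicator_def[of "{0.._}"])
        also have "\<dots> \<le> ennreal (q * s powr (q - 1)) * (ennreal (4 / s\<^sup>2 * (C0 * \<delta>) * (s / 2) powr (- \<kappa>)) * H s)"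
          by (intro mult_left_mono key True) auto
        also have "\<dots> = ennreal (q * s powr (q - 1) * (4 / s\<^sup>2 * (C0 * \<delta>) * (s / 2) powr (- \<kappa>))) * H s"
          using q0 C0 d True by (subst ennreal_mult) (auto simp: mult.assoc)
        also have "q * s powr (q - 1) * (4 / s\<^sup>2 * (C0 * \<delta>) * (s / 2) powr (- \<kappa>)) = K * \<delta> * s powr (e - 1)"
        proof -
          have "(s / 2) powr (- \<kappa>) = 2 powr \<kappa> * s powr (- \<kappa>)"           proof -
            have "(s / 2) powr (- \<kappa>) = s powr (- \<kappa>) / 2 powr (- \<kappa>)" by (rule powr_divide)
            also have "(2::real) powr (- \<kappa>) = 1 / 2 powr \<kappa>" by (rule powr_minus_divide)
            finally show ?thesis by simp
          qed
          moreover have "1 / s\<^sup>2 = s powr (- 2)" using True by (simp add: powr_minus_divide)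
          moreover have "s powr (q - 1) * s powr (- 2) * s powr (- \<kappa>) = s powr (e - 1)"
            using qe by (simp add: powr_add[symmetric] algebra_simps)
          moreover have "q * x * (4 / s\<^sup>2 * (C0 * \<delta>) * (y * z)) = 4 * q * C0 * y * \<delta> * (x * (1 / s\<^sup>2) * z)" for x y z :: real
            by simp
          ultimately show ?thesis unfolding K_def by (simp only:)
        qed
        also have "ennreal (K * \<delta> * s powr (e - 1)) * H s = (\<integral>\<^sup>+x. ennreal (K * \<delta> * s powr (e - 1)) * (ennreal (cmod (f x) powr r) * indicator {s. 0 < s \<and> cmod (f x) \<le> lam s} s) \<partial>lborel)"
          unfolding H_def by (rule nn_integral_cmult[symmetric]) (simp add: indicator_def)
        finally show ?thesis .
      qed
    qed
    also have "\<dots> = (\<integral>\<^sup>+x. (\<integral>\<^sup>+s. ennreal (K * \<delta> * s powr (e - 1)) * (ennreal (cmod (f x) powr r) * indicator {s. 0 < s \<and> cmod (f x) \<le> lam s} s) \<partial>lborel) \<partial>lborel)"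
      by (rule lborel_pair.Fubini') (simp add: indicator_def)
    also have "\<dots> \<le> (\<integral>\<^sup>+x. ennreal (K * 2 powr e / e * \<delta> * cmod (f x) powr p) \<partial>lborel)"
    proof (rule nn_integral_mono)
      fix x :: 'a
      show "(\<integral>\<^sup>+s. ennreal (K * \<delta> * s powr (e - 1)) * (ennreal (cmod (f x) powr r) * indicator {s. 0 < s \<and> cmod (f x) \<le> lam s} s) \<partial>lborel)
        \<le> ennreal (K * 2 powr e / e * \<delta> * cmod (f x) powr p)"
      proof (cases "f x = 0")
        case False
        define F where "F = cmod (f x)"
        have F: "0 < F" using False by (simp add: F_def)
        \<comment> \<open>The condition F \<le> lam s solved for s. Integrating s^(e - 1) up to 2
          F^(1 - p) produces F^((1 - p) e) = F^(p - r), which turns F^r into F^p.\<close>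
        have sle: "s \<le> 2 * F powr (1 - p)" if "0 < s" "F \<le> lam s" for s
        proof -
          have "- 1 / (p - 1) * (1 - p) = 1" using p by (simp add: field_simps)
          then have "lam s powr (1 - p) = (s / 2) powr 1" unfolding lam_def powr_powr by (simp only:)
          then have "s / 2 = lam s powr (1 - p)" using that by simp
          also have "\<dots> \<le> F powr (1 - p)" using that F p by (intro powr_mono2') auto
          finally show ?thesis by simp
        qed
        have "(\<integral>\<^sup>+s. ennreal (K * \<delta> * s powr (e - 1)) * (ennreal (F powr r) * indicator {s. 0 < s \<and> F \<le> lam s} s) \<partial>lborel)
          \<le> (\<integral>\<^sup>+s. ennreal (K * \<delta> * F powr r) * (ennreal (s powr (e - 1)) * indicator {0..2 * F powr (1 - p)} s) \<partial>lborel)"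
        proof (rule nn_integral_mono)
          fix s
          show "ennreal (K * \<delta> * s powr (e - 1)) * (ennreal (F powr r) * indicator {s. 0 < s \<and> F \<le> lam s} s)
            \<le> ennreal (K * \<delta> * F powr r) * (ennreal (s powr (e - 1)) * indicator {0..2 * F powr (1 - p)} s)"
            using sle[of s] K d by (cases "0 < s \<and> F \<le> lam s") (auto simp: ennreal_mult[symmetric] mult_ac)
        qed
        also have "\<dots> = ennreal (K * \<delta> * F powr r) * ennreal ((2 * F powr (1 - p)) powr e / e)"
          using e by (subst nn_integral_cmult) (auto simp: nn_integral_powr_Icc)
        also have "\<dots> = ennreal (K * \<delta> * F powr r * ((2 * F powr (1 - p)) powr e / e))"
          using K d e by (intro ennreal_mult[symmetric]) auto
        also have "K * \<delta> * F powr r * ((2 * F powr (1 - p)) powr e / e) = K * 2 powr e / e * \<delta> * F powr p"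
        proof -
          have "(1 - p) * e = - (r - p)" unfolding e_def using p by (simp add: field_simps)
          then have "(2 * F powr (1 - p)) powr e = 2 powr e * F powr (- (r - p))" using F by (simp add: powr_mult powr_powr)
          moreover have "F powr r * F powr (- (r - p)) = F powr p" by (simp add: powr_add[symmetric])
          moreover have "K * \<delta> * x * (y * z / e) = K * y / e * \<delta> * (x * z)" for x y z :: real
            by simp
          ultimately show ?thesis by (simp only:)
        qed
        finally show ?thesis by (simp add: F_def)
      qed (use p r in simp)
    qed
    also have "\<dots> = ennreal (LINT x|lborel. K * 2 powr e / e * \<delta> * cmod (f x) powr p)"
      using ip K d e by (intro nn_integral_eq_integral integrable_mult_right) auto
    also have "(LINT x|lborel. K * 2 powr e / e * \<delta> * cmod (f x) powr p) = K * 2 powr e / e * \<delta>"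
      using N by simp
    finally show "(\<integral>\<^sup>+\<xi>. ennreal (cmod (fourier f \<xi>) powr q) * indicator (shell 1 (1 + \<delta>)) \<xi> \<partial>lborel) \<le> ennreal (K * 2 powr e / e * \<delta>)"
      by (simp add: S_def)
  qed
qed

section \<open>Restriction to shells of arbitrary radius\<close>

lemma power_diff_le_mult:
  fixes a b :: real
  assumes "0 \<le> a" "a \<le> b"
  shows "b ^ n - a ^ n \<le> real n * b ^ (n - 1) * (b - a)"
proof (induction n)
  case (Suc n)
  have "b ^ Suc n - a ^ Suc n = b * (b ^ n - a ^ n) + a ^ n * (b - a)" by (simp add: algebra_simps)
  also have "\<dots> \<le> b * (real n * b ^ (n - 1) * (b - a)) + b ^ n * (b - a)"
    using assms Suc by (intro add_mono mult_left_mono mult_right_mono power_mono) auto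
  also have "\<dots> = real (Suc n) * b ^ (Suc n - 1) * (b - a)"
    by (cases n) (simp_all add: algebra_simps)
  finally show ?case .
qed simp

text \<open>A difference of two balls. The restriction b \<le> 2 a allows the outer radius in the
  derivative of the volume to be replaced by the inner one.\<close>

lemma emeasure_shell_le:
  obtains C where "0 < C" "\<And>a b. 0 < a \<Longrightarrow> a \<le> b \<Longrightarrow> b \<le> 2 * a \<Longrightarrow>
    emeasure lborel (shell a b :: 'a::euclidean_space set) \<le> ennreal (C * (b - a) * a powr (real DIM('a) - 1))"
proof -
  define V where "V = unit_ball_vol (real DIM('a))"
  have V: "0 < V" by (simp add: V_def)
  show ?thesis
  proof (rule that[of "V * (DIM('a) * 2 ^ (DIM('a) - 1))"])
    show "0 < V * (DIM('a) * 2 ^ (DIM('a) - 1))" using V by simp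
    fix a b :: real assume ab: "0 < a" "a \<le> b" "b \<le> 2 * a"
    have "shell a b = (cball 0 b - cball 0 a :: 'a set)" by (auto simp: shell_def)
    moreover have "emeasure lborel (cball 0 b - cball 0 a :: 'a set) = emeasure lborel (cball (0::'a) b) - emeasure lborel (cball (0::'a) a)"
      using ab by (intro emeasure_Diff) (auto simp: emeasure_cball)
    ultimately have "emeasure lborel (shell a b :: 'a set) = ennreal (V * b ^ DIM('a) - V * a ^ DIM('a))"
      using ab V by (simp add: emeasure_cball V_def ennreal_minus)
    also have "\<dots> \<le> ennreal (V * (DIM('a) * 2 ^ (DIM('a) - 1)) * (b - a) * a powr (real DIM('a) - 1))"
    proof (rule ennreal_leI)
      have "b ^ DIM('a) - a ^ DIM('a) \<le> real DIM('a) * b ^ (DIM('a) - 1) * (b - a)"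
        using ab by (intro power_diff_le_mult) auto
      also have "\<dots> \<le> real DIM('a) * (2 * a) ^ (DIM('a) - 1) * (b - a)"
        using ab by (intro mult_right_mono mult_left_mono power_mono) auto
      also have "(2 * a) ^ (DIM('a) - 1) = 2 ^ (DIM('a) - 1) * a powr (real DIM('a) - 1)"
        using ab by (simp add: power_mult_distrib powr_realpow[symmetric] of_nat_diff)
      finally have "V * (b ^ DIM('a) - a ^ DIM('a)) \<le> V * (real DIM('a) * (2 ^ (DIM('a) - 1) * a powr (real DIM('a) - 1)) * (b - a))"
        using V by (intro mult_left_mono) auto
      then show "V * b ^ DIM('a) - V * a ^ DIM('a) \<le> V * (DIM('a) * 2 ^ (DIM('a) - 1)) * (b - a) * a powr (real DIM('a) - 1)"
        by (simp add: right_diff_distrib mult_ac)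
    qed
    finally show "emeasure lborel (shell a b :: 'a set) \<le> ennreal (V * (DIM('a) * 2 ^ (DIM('a) - 1)) * (b - a) * a powr (real DIM('a) - 1))" .
  qed
qed

text \<open>An exponent q \<ge> 2 below the critical one exists only for p at most the endpoint
  exponent r, and at p = r it must be 2. So every admissible pair is either the endpoint estimate
  itself or is reached by interpolation.\<close>

lemma restriction_exponent_le:
  fixes n p :: real
  assumes n: "2 \<le> n" and p: "1 < p" and q: "2 \<le> (n - 1) / (n + 1) * (p / (p - 1))"
  shows "p \<le> tomas_exponent n" "p = tomas_exponent n \<Longrightarrow> (n - 1) / (n + 1) * (p / (p - 1)) = 2"
proof -
  have "2 * ((n + 1) * (p - 1)) \<le> (n - 1) * p"
    using q n p by (simp add: pos_le_divide_eq)
  then have "p * (n + 3) \<le> 2 * (n + 1)" by (simp add: algebra_simps)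
  then show "p \<le> tomas_exponent n" using n by (simp add: tomas_exponent_def pos_le_divide_eq)
  assume e: "p = tomas_exponent n"
  have "p - 1 = (n - 1) / (n + 3)" using tomas_exponent_facts(3)[OF n] e by simp
  then have "p / (p - 1) = 2 * (n + 1) / (n - 1)" unfolding e tomas_exponent_def using n by simp
  moreover have "x / y * (2 * y / x) = 2" if "x \<noteq> 0" "y \<noteq> 0" for x y :: real using that by simp
  ultimately show "(n - 1) / (n + 1) * (p / (p - 1)) = 2" using n by (simp only:)
qed

text \<open>Below the critical exponent \<open>qc\<close> the inequality t^q \<le> t^qc + 1
  suffices: once f is normalised, the summand 1 is integrated over a shell whose measure is itself
  of order \<delta>.\<close>

lemma shell_restriction_unit:
  fixes p q :: real
  assumes n2: "2 \<le> DIM('a::euclidean_space)" and p: "1 < p" and q: "2 \<le> q" "q \<le> (real DIM('a) - 1) / (real DIM('a) + 1) * (p / (p - 1))"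
  obtains C where "0 < C" "\<And>\<delta> R (f :: 'a \<Rightarrow> complex). 0 < \<delta> \<Longrightarrow> \<delta> \<le> 1 \<Longrightarrow> bounded_supported R f \<Longrightarrow>
    (\<integral>\<^sup>+\<xi>. ennreal (cmod (fourier f \<xi>) powr q) * indicator (shell 1 (1 + \<delta>)) \<xi> \<partial>lborel)
      \<le> ennreal (C * \<delta> * (LINT x|lborel. cmod (f x) powr p) powr (q / p))"
proof -
  define r where "r = tomas_exponent DIM('a)"
  define qc where "qc = (real DIM('a) - 1) / (real DIM('a) + 1) * (p / (p - 1))"
  have nn: "2 \<le> real DIM('a)" using n2 by simp
  have pr: "p \<le> r" using restriction_exponent_le(1)[OF nn p] q by (simp add: r_def)
  have p0: "0 < p" using p by simp
  show ?thesis
  proof (cases "p = r")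
    case True
    then have q2: "q = 2" using restriction_exponent_le(2)[OF nn p] q by (simp add: r_def)
    obtain C where C: "0 < C" and L2: "\<And>\<delta> R (f :: 'a \<Rightarrow> complex). 0 < \<delta> \<Longrightarrow> \<delta> \<le> 1 \<Longrightarrow> bounded_supported R f \<Longrightarrow>
      (\<integral>\<^sup>+\<xi>. ennreal ((cmod (fourier f \<xi>))\<^sup>2) * indicator (shell 1 (1 + \<delta>)) \<xi> \<partial>lborel)
        \<le> ennreal (C * \<delta> * (LINT x|lborel. cmod (f x) powr r) powr (2 / r))"
      unfolding r_def by (rule shell_restriction_L2[OF n2]) blast
    show ?thesis
      by (rule that[OF C]) (use L2 True q2 in simp)
  next
    case False
    then have prs: "p < r" using pr by simp
    obtain C1 where C1: "0 < C1" and crit: "\<And>\<delta> R (f :: 'a \<Rightarrow> complex). 0 < \<delta> \<Longrightarrow> \<delta> \<le> 1 \<Longrightarrow> bounded_supported R f \<Longrightarrow>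
      (LINT x|lborel. cmod (f x) powr p) = 1 \<Longrightarrow>
      (\<integral>\<^sup>+\<xi>. ennreal (cmod (fourier f \<xi>) powr qc) * indicator (shell 1 (1 + \<delta>)) \<xi> \<partial>lborel) \<le> ennreal (C1 * \<delta>)"
      by (rule shell_restriction_critical_unit[OF n2 p prs[unfolded r_def] qc_def]) blast
    obtain C2 where C2: "0 < C2" and vol: "\<And>a b. 0 < a \<Longrightarrow> a \<le> b \<Longrightarrow> b \<le> 2 * a \<Longrightarrow>
      emeasure lborel (shell a b :: 'a set) \<le> ennreal (C2 * (b - a) * a powr (real DIM('a) - 1))"
      by (rule emeasure_shell_le) blast
    show ?thesis
    proof (rule that[of "C1 + C2"])
      show "0 < C1 + C2" using C1 C2 by simp
      fix \<delta> R :: real and f :: "'a \<Rightarrow> complex" assume d: "0 < \<delta>" "\<delta> \<le> 1" and f: "bounded_supported R f"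
      define N where "N = (LINT x|lborel. cmod (f x) powr p)"
      let ?S = "shell 1 (1 + \<delta>) :: 'a set"
      show "(\<integral>\<^sup>+\<xi>. ennreal (cmod (fourier f \<xi>) powr q) * indicator ?S \<xi> \<partial>lborel) \<le> ennreal ((C1 + C2) * \<delta> * N powr (q / p))"
      proof (cases "N = 0")
        case True
        then have "fourier f \<xi> = 0" for \<xi> using fourier_eq_0[OF f p0] by (simp add: N_def)
        then show ?thesis using q by simp
      next
        case False
        define g where "g x = complex_of_real (N powr (- 1 / p)) * f x" for x
        note nf = bounded_supported_normalise[OF f p0, folded N_def, OF False, folded g_def[abs_def] g_def]
        have gm [measurable]: "g \<in> borel_measurable borel" by (rule bounded_supported_measurable[OF nf(2)])
        have "(\<integral>\<^sup>+\<xi>. ennreal (cmod (fourier f \<xi>) powr q) * indicator ?S \<xi> \<partial>lborel)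
           \<le> (\<integral>\<^sup>+\<xi>. ennreal (N powr (q / p)) * (ennreal (cmod (fourier g \<xi>) powr qc) * indicator ?S \<xi> + indicator ?S \<xi>) \<partial>lborel)"
        proof (rule nn_integral_mono)
          fix \<xi> :: 'a
          define t where "t = cmod (fourier g \<xi>)"
          have "(N powr (1 / p) * t) powr q = N powr (q / p) * t powr q"
            by (simp add: powr_mult powr_powr)
          moreover have "t powr q \<le> t powr qc + 1"
          proof (cases "t \<le> 1")
            case True
            then have "t powr q \<le> 1 powr q" using q by (intro powr_mono2) (auto simp: t_def)
            then have "t powr q \<le> 1" by simp
            then show ?thesis using powr_ge_zero[of t qc] by linarith
          next
            case False
            then have "t powr q \<le> t powr qc" using q by (intro powr_mono) (auto simp: qc_def)
            then show ?thesis by simp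
          qed
          ultimately have "(N powr (1 / p) * t) powr q \<le> N powr (q / p) * (t powr qc + 1)" by (simp add: mult_left_mono)
          then have "ennreal ((N powr (1 / p) * t) powr q) \<le> ennreal (N powr (q / p)) * (ennreal (t powr qc) + 1)"
          proof -
            assume "(N powr (1 / p) * t) powr q \<le> N powr (q / p) * (t powr qc + 1)"
            then have "ennreal ((N powr (1 / p) * t) powr q) \<le> ennreal (N powr (q / p) * (t powr qc + 1))" by (rule ennreal_leI)
            also have "\<dots> = ennreal (N powr (q / p)) * ennreal (t powr qc + 1)" by (rule ennreal_mult) auto
            also have "ennreal (t powr qc + 1) = ennreal (t powr qc) + ennreal 1" by (rule ennreal_plus) auto
            finally show ?thesis by simp
          qed
          then show "ennreal (cmod (fourier f \<xi>) powr q) * indicator ?S \<xi> \<le> ennreal (N powr (q / p)) * (ennreal (cmod (fourier g \<xi>) powr qc) * indicator ?S \<xi> + indicator ?S \<xi>)"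
            unfolding nf(4) norm_mult norm_of_real t_def by (auto simp: indicator_def)
        qed
        also have "\<dots> = ennreal (N powr (q / p)) * ((\<integral>\<^sup>+\<xi>. ennreal (cmod (fourier g \<xi>) powr qc) * indicator ?S \<xi> \<partial>lborel) + emeasure lborel ?S)"
          by (subst nn_integral_cmult, simp, subst nn_integral_add) auto
        also have "\<dots> \<le> ennreal (N powr (q / p)) * (ennreal (C1 * \<delta>) + ennreal (C2 * \<delta>))"
          using vol[of 1 "1 + \<delta>"] d by (intro mult_left_mono add_mono crit[OF d nf(2) nf(3)]) auto
        also have "\<dots> = ennreal ((C1 + C2) * \<delta> * N powr (q / p))"
          using C1 C2 d by (simp add: ennreal_plus[symmetric] ennreal_mult[symmetric] algebra_simps del: ennreal_plus)
        finally show ?thesis .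
      qed
    qed
  qed
qed

section \<open>Dilation to spheres of arbitrary radius\<close>

lemma nn_integral_lborel_scale:
  fixes h :: "'a::euclidean_space \<Rightarrow> ennreal"
  assumes [measurable]: "h \<in> borel_measurable borel" and a: "0 < a"
  shows "(\<integral>\<^sup>+y. h y \<partial>lborel) = ennreal (a ^ DIM('a)) * (\<integral>\<^sup>+y. h (a *\<^sub>R y) \<partial>lborel)"
proof -
  have "(\<integral>\<^sup>+y. h y \<partial>lborel) = (\<integral>\<^sup>+y. h y \<partial>density (distr lborel borel (\<lambda>x. 0 + a *\<^sub>R x)) (\<lambda>_. ennreal (\<bar>a\<bar> ^ DIM('a))))"
    using lborel_affine[of a "0::'a"] a by simp
  also have "\<dots> = ennreal (a ^ DIM('a)) * (\<integral>\<^sup>+y. h (a *\<^sub>R y) \<partial>lborel)"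
    using a by (simp add: nn_integral_density nn_integral_cmult nn_integral_distr)
  finally show ?thesis .
qed

lemma integral_lborel_scale:
  fixes h :: "'a::euclidean_space \<Rightarrow> 'b::{banach, second_countable_topology}"
  assumes [measurable]: "h \<in> borel_measurable borel" and a: "0 < a"
  shows "(LINT y|lborel. h y) = (a ^ DIM('a)) *\<^sub>R (LINT y|lborel. h (a *\<^sub>R y))"
proof -
  have "(LINT y|lborel. h y) = (LINT y|density (distr lborel borel (\<lambda>x. 0 + a *\<^sub>R x)) (\<lambda>_. ennreal (\<bar>a\<bar> ^ DIM('a))). h y)"
    using lborel_affine[of a "0::'a"] a by simp
  also have "\<dots> = (a ^ DIM('a)) *\<^sub>R (LINT y|lborel. h (a *\<^sub>R y))"
    using a by (subst integral_density) (simp_all add: integral_distr)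
  finally show ?thesis .
qed

text \<open>The function a^(-n) f(x / a) has at \<eta> the transform of f at a \<eta>, and the shell
  becomes one of inner radius 1 and thickness (b - a) / a \<le> 1. The exponent of a collects n from
  the Jacobian, - 1 from the thickness and - q n / p' from the L^p norm of the dilated
  function.\<close>

lemma shell_restriction:
  fixes p q :: real
  assumes n2: "2 \<le> DIM('a::euclidean_space)" and p: "1 < p" and q: "2 \<le> q" "q \<le> (real DIM('a) - 1) / (real DIM('a) + 1) * conj_exponent p"
  obtains C where "0 < C" "\<And>a b R (f :: 'a \<Rightarrow> complex). 0 < a \<Longrightarrow> a < b \<Longrightarrow> b \<le> 2 * a \<Longrightarrow> bounded_supported R f \<Longrightarrow>
    (\<integral>\<^sup>+\<xi>. ennreal (cmod (fourier f \<xi>) powr q) * indicator (shell a b) \<xi> \<partial>lborel)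
      \<le> ennreal (C * (b - a) * a powr (real DIM('a) - 1 - q * real DIM('a) / conj_exponent p) * (LINT x|lborel. cmod (f x) powr p) powr (q / p))"
proof -
  obtain C where C: "0 < C" and unit: "\<And>\<delta> R (f :: 'a \<Rightarrow> complex). 0 < \<delta> \<Longrightarrow> \<delta> \<le> 1 \<Longrightarrow> bounded_supported R f \<Longrightarrow>
    (\<integral>\<^sup>+\<xi>. ennreal (cmod (fourier f \<xi>) powr q) * indicator (shell 1 (1 + \<delta>)) \<xi> \<partial>lborel)
      \<le> ennreal (C * \<delta> * (LINT x|lborel. cmod (f x) powr p) powr (q / p))"
    by (rule shell_restriction_unit[OF n2 p q[unfolded conj_exponent_def]]) blast
  define n where "n = real DIM('a)"
  show ?thesis
  proof (rule that[OF C])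
    fix a b R :: real and f :: "'a \<Rightarrow> complex"
    assume a: "0 < a" and ab: "a < b" "b \<le> 2 * a" and f: "bounded_supported R f"
    have fm [measurable]: "f \<in> borel_measurable borel" by (rule bounded_supported_measurable[OF f])
    define g where "g x = complex_of_real (inverse (a ^ DIM('a))) * f ((1 / a) *\<^sub>R x)" for x
    define N where "N = (LINT x|lborel. cmod (f x) powr p)"
    have gb: "bounded_supported (a * R) g"
    proof -
      obtain M where M: "\<And>x. cmod (f x) \<le> M" using f by (auto simp: bounded_supported_def)
      have "cmod (g x) \<le> \<bar>inverse (a ^ DIM('a))\<bar> * M" for x
        unfolding g_def norm_mult norm_of_real by (intro mult_left_mono M) auto
      moreover have "g x = 0" if "a * R < norm x" for x
      proof -
        have "R < norm ((1 / a) *\<^sub>R x)" using that a by (simp add: field_simps)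
        then show ?thesis using f by (simp add: g_def bounded_supported_def)
      qed
      moreover have "g \<in> borel_measurable borel" unfolding g_def[abs_def] by measurable
      ultimately show ?thesis unfolding bounded_supported_def by blast
    qed
    have gm [measurable]: "g \<in> borel_measurable borel" by (rule bounded_supported_measurable[OF gb])
    have gf: "fourier g \<eta> = fourier f (a *\<^sub>R \<eta>)" for \<eta>
    proof -
      have "fourier g \<eta> = (a ^ DIM('a)) *\<^sub>R (LINT y|lborel. iexp ((a *\<^sub>R y) \<bullet> \<eta>) * g (a *\<^sub>R y))"
        unfolding fourier_lborel[OF gm] using iexp_borel[of 1 \<eta>] a by (intro integral_lborel_scale) simp_all
      also have "\<dots> = (a ^ DIM('a)) *\<^sub>R (LINT y|lborel. complex_of_real (inverse (a ^ DIM('a))) * (iexp (y \<bullet> (a *\<^sub>R \<eta>)) * f y))"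
        unfolding g_def using a by (simp add: mult_ac)
      also have "\<dots> = fourier f (a *\<^sub>R \<eta>)"
        unfolding fourier_lborel[OF fm] using a by (simp add: scaleR_conv_of_real)
      finally show ?thesis .
    qed
    have Ng: "(LINT x|lborel. cmod (g x) powr p) = a powr (n * (1 - p)) * N"
    proof -
      have "(LINT x|lborel. cmod (g x) powr p) = (a ^ DIM('a)) *\<^sub>R (LINT y|lborel. cmod (g (a *\<^sub>R y)) powr p)"
        using a by (intro integral_lborel_scale) simp_all
      also have "cmod (g (a *\<^sub>R y)) powr p = a powr (- n * p) * cmod (f y) powr p" for y
      proof -
        have "inverse (a ^ DIM('a)) = a powr (- n)" using a by (simp add: powr_minus powr_realpow n_def)
        then show ?thesis using a by (simp add: g_def norm_mult powr_mult powr_powr)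
      qed
      then have "(a ^ DIM('a)) *\<^sub>R (LINT y|lborel. cmod (g (a *\<^sub>R y)) powr p) = a powr n * (a powr (- n * p) * N)"
        using a by (simp add: N_def powr_realpow n_def)
      also have "\<dots> = a powr (n * (1 - p)) * N" by (simp add: powr_add[symmetric] algebra_simps flip: mult.assoc)
      finally show ?thesis .
    qed
    have sh: "indicator (shell a b) (a *\<^sub>R \<eta>) = (indicator (shell 1 (1 + (b - a) / a)) \<eta> :: ennreal)" for \<eta> :: 'a
      using a by (auto simp: shell_def indicator_def field_simps)
    have "(\<integral>\<^sup>+\<xi>. ennreal (cmod (fourier f \<xi>) powr q) * indicator (shell a b) \<xi> \<partial>lborel)
       = ennreal (a ^ DIM('a)) * (\<integral>\<^sup>+\<eta>. ennreal (cmod (fourier f (a *\<^sub>R \<eta>)) powr q) * indicator (shell a b) (a *\<^sub>R \<eta>) \<partial>lborel)"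
      using a by (intro nn_integral_lborel_scale) simp_all
    also have "\<dots> = ennreal (a ^ DIM('a)) * (\<integral>\<^sup>+\<eta>. ennreal (cmod (fourier g \<eta>) powr q) * indicator (shell 1 (1 + (b - a) / a)) \<eta> \<partial>lborel)"
      by (simp only: gf sh)
    also have "\<dots> \<le> ennreal (a ^ DIM('a)) * ennreal (C * ((b - a) / a) * (a powr (n * (1 - p)) * N) powr (q / p))"
      unfolding Ng[symmetric] using a ab by (intro mult_left_mono unit[OF _ _ gb]) (auto simp: field_simps)
    also have "\<dots> = ennreal (a ^ DIM('a) * (C * ((b - a) / a) * (a powr (n * (1 - p)) * N) powr (q / p)))"
      using a ab C by (intro ennreal_mult[symmetric]) auto
    also have "a ^ DIM('a) * (C * ((b - a) / a) * (a powr (n * (1 - p)) * N) powr (q / p))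
       = C * (b - a) * a powr (n - 1 - q * n / conj_exponent p) * N powr (q / p)"
    proof -
      have N0: "0 \<le> N" unfolding N_def by (intro integral_nonneg_AE) simp
      have 1: "(a powr (n * (1 - p)) * N) powr (q / p) = a powr (n * (1 - p) * (q / p)) * N powr (q / p)"
        using N0 by (simp add: powr_mult powr_powr)
      have 2: "a ^ DIM('a) = a powr n" using a by (simp add: powr_realpow n_def)
      have 3: "1 / a = a powr (- 1)" using a by (simp add: powr_minus_divide)
      have 4: "n * (1 - p) * (q / p) = - (q * n / conj_exponent p)" using p by (simp add: conj_exponent_def field_simps)
      have 5: "a powr n * a powr (- 1) * a powr (- (q * n / conj_exponent p)) = a powr (n - 1 - q * n / conj_exponent p)"
        by (simp only: powr_add[symmetric]) simp
      have 6: "x * (C * ((b - a) / a) * (y * z)) = C * (b - a) * (x * (1 / a) * y) * z" for x y z by simp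
      show ?thesis unfolding 1 2 4 6 3 5 ..
    qed
    finally show "(\<integral>\<^sup>+\<xi>. ennreal (cmod (fourier f \<xi>) powr q) * indicator (shell a b) \<xi> \<partial>lborel)
      \<le> ennreal (C * (b - a) * a powr (real DIM('a) - 1 - q * real DIM('a) / conj_exponent p) * (LINT x|lborel. cmod (f x) powr p) powr (q / p))"
      by (simp only: n_def N_def)
  qed
qed

section \<open>Power weights\<close>

lemma power_weight_pos: "x \<noteq> 0 \<Longrightarrow> 0 < power_weight \<alpha> \<beta> x"
  by (simp add: power_weight_def)

lemma power_weight_nonneg: "0 \<le> power_weight \<alpha> \<beta> x"
  by (simp add: power_weight_def)

lemma power_weight_measurable [measurable]: "power_weight \<alpha> \<beta> \<in> borel_measurable (borel :: 'a::euclidean_space measure)"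
  unfolding power_weight_def[abs_def] by measurable

lemma max_weight_pos: "0 < a \<Longrightarrow> 0 < max_weight \<alpha> \<beta> a"
  by (simp add: max_weight_def less_max_iff_disj)

text \<open>On the dyadic shell of outer radius R 2^-j the integrand is bounded by a constant
  multiple of its value at that radius, and the contributions form a geometric series of ratio 2
  powr (\<kappa> - n) < 1. The factor \<open>M\<close> covers both signs of \<kappa>.\<close>

lemma nn_integral_norm_powr_cball_le:
  fixes \<kappa> :: real
  assumes k: "\<kappa> < DIM('a::euclidean_space)"
  obtains C where "0 < C" "\<And>R. 0 < R \<Longrightarrow>
    (\<integral>\<^sup>+x. ennreal (norm (x::'a) powr (- \<kappa>)) * indicator (cball 0 R) x \<partial>lborel) \<le> ennreal (C * R powr (DIM('a) - \<kappa>))"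
proof -
  define n where "n = real DIM('a)"
  define q where "q = 2 powr (- (n - \<kappa>))"
  have q: "0 < q" "q < 1" using k by (auto simp: q_def n_def powr_less_one)
  obtain C2 where C2: "0 < C2" and vol: "\<And>a b. 0 < a \<Longrightarrow> a \<le> b \<Longrightarrow> b \<le> 2 * a \<Longrightarrow>
    emeasure lborel (shell a b :: 'a set) \<le> ennreal (C2 * (b - a) * a powr (real DIM('a) - 1))"
    by (rule emeasure_shell_le) blast
  define M where "M = max 1 (2 powr \<kappa>)"
  define K where "K = M * C2 * 2 powr (- n)"
  have M: "0 < M" by (simp add: M_def)
  have K: "0 < K" using C2 M by (simp add: K_def)
  show ?thesis
  proof (rule that[of "K / (1 - q)"])
    show "0 < K / (1 - q)" using K q by simp
    fix R :: real assume R: "0 < R"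
    define \<rho> where "\<rho> j = R * 2 powr (- real j)" for j :: nat
    have rho: "0 < \<rho> j" for j using R by (simp add: \<rho>_def)
    have "(\<integral>\<^sup>+x. ennreal (norm (x::'a) powr (- \<kappa>)) * indicator (cball 0 R) x \<partial>lborel)
      \<le> (\<integral>\<^sup>+x. (\<Sum>j. ennreal (M * \<rho> j powr (- \<kappa>)) * indicator (shell (\<rho> j / 2) (\<rho> j)) (x::'a)) \<partial>lborel)"
    proof (rule nn_integral_mono)
      fix x :: 'a
      show "ennreal (norm x powr (- \<kappa>)) * indicator (cball 0 R) x \<le> (\<Sum>j. ennreal (M * \<rho> j powr (- \<kappa>)) * indicator (shell (\<rho> j / 2) (\<rho> j)) x)"
      proof (cases "x \<in> cball 0 R \<and> x \<noteq> 0")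
        case True
        then have x: "0 < norm x" "norm x \<le> R" by (auto simp: dist_norm)
        define j where "j = nat \<lfloor>log 2 (R / norm x)\<rfloor>"
        have l0: "0 \<le> log 2 (R / norm x)" using x R by simp
        have j: "real j \<le> log 2 (R / norm x)" "log 2 (R / norm x) < real j + 1"
          using l0 unfolding j_def by linarith+
        have e: "R / norm x = 2 powr (log 2 (R / norm x))" using x R by simp
        have "2 powr real j \<le> R / norm x" by (subst e) (use j in \<open>simp del: powr_log_cancel\<close>)
        then have u: "norm x \<le> \<rho> j" using x by (simp add: \<rho>_def powr_minus field_simps)
        have "R / norm x < 2 powr (real j + 1)" by (subst e) (use j in \<open>simp del: powr_log_cancel\<close>)
        then have l: "\<rho> j / 2 < norm x" using x by (simp add: \<rho>_def powr_minus powr_add field_simps)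
        have "norm x powr (- \<kappa>) \<le> M * \<rho> j powr (- \<kappa>)"
        proof (cases "0 \<le> \<kappa>")
          case True
          have "norm x powr (- \<kappa>) \<le> (\<rho> j / 2) powr (- \<kappa>)"
            using l rho[of j] True by (intro powr_mono2') auto
          also have "\<dots> = 2 powr \<kappa> * \<rho> j powr (- \<kappa>)"
            unfolding powr_divide by (simp add: powr_minus_divide)
          also have "\<dots> \<le> M * \<rho> j powr (- \<kappa>)" by (intro mult_right_mono) (auto simp: M_def)
          finally show ?thesis .
        next
          case False
          then have "norm x powr (- \<kappa>) \<le> 1 * \<rho> j powr (- \<kappa>)" using u x by (simp add: powr_mono2)
          also have "\<dots> \<le> M * \<rho> j powr (- \<kappa>)" by (intro mult_right_mono) (auto simp: M_def)
          finally show ?thesis .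
        qed
        then have "ennreal (norm x powr (- \<kappa>)) \<le> ennreal (M * \<rho> j powr (- \<kappa>)) * indicator (shell (\<rho> j / 2) (\<rho> j)) x"
          using u l by (simp add: shell_def ennreal_leI)
        also have "\<dots> \<le> (\<Sum>j. ennreal (M * \<rho> j powr (- \<kappa>)) * indicator (shell (\<rho> j / 2) (\<rho> j)) x)"
        proof -
          have "T j \<le> suminf T" for T :: "nat \<Rightarrow> ennreal" using sum_le_suminf[of T "{j}"] by simp
          then show ?thesis .
        qed
        finally show ?thesis using True by simp
      qed auto
    qed
    also have "\<dots> = (\<Sum>j. \<integral>\<^sup>+x. ennreal (M * \<rho> j powr (- \<kappa>)) * indicator (shell (\<rho> j / 2) (\<rho> j)) (x::'a) \<partial>lborel)"
      by (rule nn_integral_suminf) simp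
    also have "\<dots> \<le> (\<Sum>j. ennreal (K * R powr (n - \<kappa>) * q ^ j))"
    proof (intro suminf_le allI)
      fix j
      have "(\<integral>\<^sup>+x. ennreal (M * \<rho> j powr (- \<kappa>)) * indicator (shell (\<rho> j / 2) (\<rho> j)) (x::'a) \<partial>lborel)
        = ennreal (M * \<rho> j powr (- \<kappa>)) * emeasure lborel (shell (\<rho> j / 2) (\<rho> j) :: 'a set)"
        by (rule nn_integral_cmult_indicator) simp
      also have "\<dots> \<le> ennreal (M * \<rho> j powr (- \<kappa>)) * ennreal (C2 * (\<rho> j - \<rho> j / 2) * (\<rho> j / 2) powr (n - 1))"
        unfolding n_def using rho[of j] by (intro mult_left_mono vol) auto
      also have "\<dots> = ennreal (M * \<rho> j powr (- \<kappa>) * (C2 * (\<rho> j - \<rho> j / 2) * (\<rho> j / 2) powr (n - 1)))"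
        using M C2 rho[of j] by (intro ennreal_mult[symmetric]) auto
      also have "M * \<rho> j powr (- \<kappa>) * (C2 * (\<rho> j - \<rho> j / 2) * (\<rho> j / 2) powr (n - 1)) = K * R powr (n - \<kappa>) * q ^ j"
      proof -
        have a: "(\<rho> j - \<rho> j / 2) * (\<rho> j / 2) powr (n - 1) = (\<rho> j / 2) powr n"
          using rho[of j] powr_add[of "\<rho> j / 2" 1 "n - 1"] by simp
        have b: "(\<rho> j / 2) powr n = 2 powr (- n) * \<rho> j powr n" unfolding powr_divide by (simp add: powr_minus_divide)
        have c: "\<rho> j powr (- \<kappa>) * \<rho> j powr n = \<rho> j powr (n - \<kappa>)" by (simp add: powr_add[symmetric])
        have d: "\<rho> j powr (n - \<kappa>) = R powr (n - \<kappa>) * q ^ j"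
        proof -
          have "q ^ j = q powr real j" using q by (simp add: powr_realpow)
          also have "\<dots> = 2 powr (- real j * (n - \<kappa>))"
            unfolding q_def powr_powr by (rule arg_cong[where f="\<lambda>z. 2 powr z"]) (simp add: algebra_simps)
          finally show ?thesis using R by (simp add: \<rho>_def powr_mult powr_powr)
        qed
        have "M * \<rho> j powr (- \<kappa>) * (C2 * (\<rho> j - \<rho> j / 2) * (\<rho> j / 2) powr (n - 1)) = M * C2 * (\<rho> j powr (- \<kappa>) * ((\<rho> j - \<rho> j / 2) * (\<rho> j / 2) powr (n - 1)))"
          by simp
        also have "\<dots> = M * C2 * (\<rho> j powr (- \<kappa>) * (2 powr (- n) * \<rho> j powr n))" unfolding a b ..
        also have "\<dots> = M * C2 * 2 powr (- n) * (\<rho> j powr (- \<kappa>) * \<rho> j powr n)" by simp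
        also have "\<dots> = K * R powr (n - \<kappa>) * q ^ j" unfolding c d K_def by simp
        finally show ?thesis .
      qed
      finally show "(\<integral>\<^sup>+x. ennreal (M * \<rho> j powr (- \<kappa>)) * indicator (shell (\<rho> j / 2) (\<rho> j)) (x::'a) \<partial>lborel) \<le> ennreal (K * R powr (n - \<kappa>) * q ^ j)" .
    qed auto
    also have "\<dots> = ennreal (\<Sum>j. K * R powr (n - \<kappa>) * q ^ j)"
      using K q by (intro suminf_ennreal2 summable_mult summable_geometric) auto
    also have "(\<Sum>j. K * R powr (n - \<kappa>) * q ^ j) = K / (1 - q) * R powr (n - \<kappa>)"
      using q by (subst suminf_mult) (auto simp: suminf_geometric summable_geometric)
    finally show "(\<integral>\<^sup>+x. ennreal (norm (x::'a) powr (- \<kappa>)) * indicator (cball 0 R) x \<partial>lborel) \<le> ennreal (K / (1 - q) * R powr (DIM('a) - \<kappa>))"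
      by (simp only: n_def)
  qed
qed

text \<open>Outside the unit ball the exponent \<beta> gives (a |x|)^\<beta> \<ge> 1. Inside it, a
  |x| > 1 forces a > 1; then \<alpha> \<ge> 0 gives (a |x|)^\<alpha> \<ge> 1, while for \<alpha> < 0
  both a^\<beta> and |x|^\<alpha> are at least 1. The maximum in the weight lets each case take the
  power it needs.\<close>

lemma max_weight_mult_power_weight_ge:
  assumes b: "0 \<le> \<beta>" and a: "0 < a" and x: "1 / a < norm x"
  shows "1 \<le> max_weight \<alpha> \<beta> a * power_weight \<alpha> \<beta> x"
proof -
  have x0: "0 < norm x" using x a by (smt (verit) divide_pos_pos)
  have ax: "1 < a * norm x" using x a by (simp add: field_simps)
  have key: "1 \<le> a powr c * norm x powr c" if "0 \<le> c" for c
    using ax that a x0 ge_one_powr_ge_zero[of "a * norm x" c] by (simp add: powr_mult)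
  have ma: "a powr \<alpha> \<le> max_weight \<alpha> \<beta> a" and mb: "a powr \<beta> \<le> max_weight \<alpha> \<beta> a"
    by (auto simp: max_weight_def)
  show ?thesis
  proof (cases "norm x \<le> 1")
    case False
    have "1 \<le> a powr \<beta> * norm x powr \<beta>" by (rule key[OF b])
    also have "\<dots> \<le> max_weight \<alpha> \<beta> a * norm x powr \<beta>" by (intro mult_right_mono mb) auto
    finally show ?thesis using False by (simp add: power_weight_def)
  next
    case True
    have "a * norm x \<le> a * 1" using a True by (intro mult_left_mono) auto
    then have a1: "1 < a" using ax by linarith
    show ?thesis
    proof (cases "0 \<le> \<alpha>")
      case t: True
      have "1 \<le> a powr \<alpha> * norm x powr \<alpha>" by (rule key[OF t])
      also have "\<dots> \<le> max_weight \<alpha> \<beta> a * norm x powr \<alpha>" by (intro mult_right_mono ma) auto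
      finally show ?thesis using True by (simp add: power_weight_def)
    next
      case False
      have "1 \<le> a powr \<beta>" using a1 b by (simp add: ge_one_powr_ge_zero)
      then have "1 \<le> max_weight \<alpha> \<beta> a" using mb by simp
      moreover have "1 \<le> norm x powr \<alpha>" using False True x0 powr_mono2'[of "- \<alpha>" "norm x" 1] powr_mono'[of \<alpha> 0 "norm x"] by simp
      ultimately have "1 * 1 \<le> max_weight \<alpha> \<beta> a * norm x powr \<alpha>" by (intro mult_mono) auto
      then show ?thesis using True by (simp add: power_weight_def)
    qed
  qed
qed

text \<open>For a \<ge> 1 the ball lies inside the unit ball and only \<alpha> occurs. For a < 1 the
  power belonging to \<beta> may fail to be integrable at the origin, so outside the unit ball it is
  majorised by the power belonging to \<gamma> = min \<alpha> \<beta>, which is integrable over the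
  whole ball, and a^\<gamma> is one of the two powers in \<open>max_weight\<close>. The unit ball
  adds a constant, absorbed because 1 / a > 1 carries a positive exponent.\<close>

lemma nn_integral_power_weight_cball_le:
  fixes \<alpha> \<beta> p :: real
  assumes p: "1 < p" and al: "\<alpha> < DIM('a::euclidean_space) * (p - 1)" and b: "0 \<le> \<beta>"
  obtains C where "0 < C" "\<And>a. 0 < a \<Longrightarrow>
    (\<integral>\<^sup>+x. ennreal (power_weight \<alpha> \<beta> (x::'a) powr (- 1 / (p - 1))) * indicator (cball 0 (1 / a)) x \<partial>lborel)
      \<le> ennreal (C * (a powr (- real DIM('a)) * max_weight \<alpha> \<beta> a powr (1 / (p - 1))))"
proof -
  define n where "n = real DIM('a)"
  define \<gamma> where "\<gamma> = min \<alpha> \<beta>"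
  have p1: "0 < p - 1" using p by simp
  have aln: "\<alpha> / (p - 1) < n" using al p1 by (simp add: n_def divide_less_eq)
  have "\<gamma> / (p - 1) \<le> \<alpha> / (p - 1)" using p1 by (intro divide_right_mono) (auto simp: \<gamma>_def)
  then have gan: "\<gamma> / (p - 1) < n" using aln by simp
  obtain C1 where C1: "0 < C1" and I1: "\<And>R. 0 < R \<Longrightarrow>
    (\<integral>\<^sup>+x. ennreal (norm (x::'a) powr (- (\<alpha> / (p - 1)))) * indicator (cball 0 R) x \<partial>lborel) \<le> ennreal (C1 * R powr (n - \<alpha> / (p - 1)))"
    using nn_integral_norm_powr_cball_le[of "\<alpha> / (p - 1)", where 'a='a] aln unfolding n_def by blast
  obtain C2 where C2: "0 < C2" and I2: "\<And>R. 0 < R \<Longrightarrow>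
    (\<integral>\<^sup>+x. ennreal (norm (x::'a) powr (- (\<gamma> / (p - 1)))) * indicator (cball 0 R) x \<partial>lborel) \<le> ennreal (C2 * R powr (n - \<gamma> / (p - 1)))"
    using nn_integral_norm_powr_cball_le[of "\<gamma> / (p - 1)", where 'a='a] gan unfolding n_def by blast
  have R: "(1 / a) powr (n - c / (p - 1)) = a powr (- n) * (a powr c) powr (1 / (p - 1))" if "0 < a" for a c
  proof -
    have "(1 / a) powr z = a powr (- z)" for z
      unfolding powr_divide powr_minus_divide by simp
    then have "(1 / a) powr (n - c / (p - 1)) = a powr (- (n - c / (p - 1)))" .
    also have "\<dots> = a powr (- n) * a powr (c / (p - 1))" by (simp add: powr_add[symmetric])
    finally show ?thesis by (simp add: powr_powr)
  qed
  have cb [measurable]: "cball (0::'a) r \<in> sets borel" for r by simp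
  have pw1: "power_weight \<alpha> \<beta> x powr (- 1 / (p - 1)) = norm x powr (- (\<alpha> / (p - 1)))" if "norm x \<le> 1" for x :: 'a
    using that by (simp add: power_weight_def powr_powr)
  show ?thesis
  proof (rule that[of "C1 + C2"])
    show "0 < C1 + C2" using C1 C2 by simp
    fix a :: real assume a: "0 < a"
    let ?W = "a powr (- n) * max_weight \<alpha> \<beta> a powr (1 / (p - 1))"
    have W: "0 \<le> ?W" by simp
    have mono: "a powr (- n) * (a powr c) powr (1 / (p - 1)) \<le> ?W" if "a powr c \<le> max_weight \<alpha> \<beta> a" for c
      using that p1 by (intro mult_left_mono powr_mono2) auto
    have "(\<integral>\<^sup>+x. ennreal (power_weight \<alpha> \<beta> (x::'a) powr (- 1 / (p - 1))) * indicator (cball 0 (1 / a)) x \<partial>lborel) \<le> ennreal ((C1 + C2) * ?W)"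
    proof (cases "1 \<le> a")
      case True
      have "(\<integral>\<^sup>+x. ennreal (power_weight \<alpha> \<beta> (x::'a) powr (- 1 / (p - 1))) * indicator (cball 0 (1 / a)) x \<partial>lborel)
        = (\<integral>\<^sup>+x. ennreal (norm (x::'a) powr (- (\<alpha> / (p - 1)))) * indicator (cball 0 (1 / a)) x \<partial>lborel)"
      proof (rule nn_integral_cong)
        fix x :: 'a
        have "norm x \<le> 1" if "norm x \<le> 1 / a" using that True by (rule_tac order_trans) auto
        then show "ennreal (power_weight \<alpha> \<beta> x powr (- 1 / (p - 1))) * indicator (cball 0 (1 / a)) x = ennreal (norm x powr (- (\<alpha> / (p - 1)))) * indicator (cball 0 (1 / a)) x"
          using pw1[of x] by (auto simp: indicator_def)
      qed
      also have "\<dots> \<le> ennreal (C1 * (1 / a) powr (n - \<alpha> / (p - 1)))" using a by (intro I1) simp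
      also have "\<dots> \<le> ennreal ((C1 + C2) * ?W)"
        unfolding R[OF a] using C1 C2 by (intro ennreal_leI mult_mono mono) (auto simp: max_weight_def)
      finally show ?thesis .
    next
      case False
      then have a1: "a < 1" by simp
      have mg: "a powr \<gamma> \<le> max_weight \<alpha> \<beta> a" by (auto simp: max_weight_def \<gamma>_def min_def)
      have "(\<integral>\<^sup>+x. ennreal (power_weight \<alpha> \<beta> (x::'a) powr (- 1 / (p - 1))) * indicator (cball 0 (1 / a)) x \<partial>lborel)
        \<le> (\<integral>\<^sup>+x. ennreal (norm (x::'a) powr (- (\<alpha> / (p - 1)))) * indicator (cball 0 1) x + ennreal (norm (x::'a) powr (- (\<gamma> / (p - 1)))) * indicator (cball 0 (1 / a)) x \<partial>lborel)"
      proof (rule nn_integral_mono)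
        fix x :: 'a
        show "ennreal (power_weight \<alpha> \<beta> x powr (- 1 / (p - 1))) * indicator (cball 0 (1 / a)) x
          \<le> ennreal (norm x powr (- (\<alpha> / (p - 1)))) * indicator (cball 0 1) x + ennreal (norm x powr (- (\<gamma> / (p - 1)))) * indicator (cball 0 (1 / a)) x"
        proof (cases "norm x \<le> 1")
          case True
          then show ?thesis using pw1[OF True] by (auto simp: indicator_def)
        next
          case False
          have "power_weight \<alpha> \<beta> x powr (- 1 / (p - 1)) = norm x powr (- (\<beta> / (p - 1)))"
            using False by (simp add: power_weight_def powr_powr)
          also have "\<dots> \<le> norm x powr (- (\<gamma> / (p - 1)))"
            using False p1 by (intro powr_mono) (auto simp: \<gamma>_def divide_right_mono)
          finally show ?thesis using False by (auto simp: indicator_def intro: ennreal_leI)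
        qed
      qed
      also have "\<dots> = (\<integral>\<^sup>+x. ennreal (norm (x::'a) powr (- (\<alpha> / (p - 1)))) * indicator (cball 0 1) x \<partial>lborel) + (\<integral>\<^sup>+x. ennreal (norm (x::'a) powr (- (\<gamma> / (p - 1)))) * indicator (cball 0 (1 / a)) x \<partial>lborel)"
        using cb by (intro nn_integral_add) measurable
      also have "\<dots> \<le> ennreal (C1 * 1 powr (n - \<alpha> / (p - 1))) + ennreal (C2 * (1 / a) powr (n - \<gamma> / (p - 1)))"
        using a by (intro add_mono I1 I2) auto
      also have "\<dots> = ennreal (C1 * 1 + C2 * (1 / a) powr (n - \<gamma> / (p - 1)))"
        using C1 C2 by (simp add: ennreal_plus)
      also have "\<dots> \<le> ennreal ((C1 + C2) * ?W)"
      proof (rule ennreal_leI)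
        have "1 \<le> (1 / a) powr (n - \<gamma> / (p - 1))" using a a1 gan by (intro ge_one_powr_ge_zero) auto
        moreover have "(1 / a) powr (n - \<gamma> / (p - 1)) \<le> ?W" unfolding R[OF a] by (rule mono[OF mg])
        ultimately have "C1 * 1 \<le> C1 * ?W" "C2 * (1 / a) powr (n - \<gamma> / (p - 1)) \<le> C2 * ?W"
          using C1 C2 by (auto intro!: mult_left_mono)
        then show "C1 * 1 + C2 * (1 / a) powr (n - \<gamma> / (p - 1)) \<le> (C1 + C2) * ?W" by (simp add: distrib_right)
      qed
      finally show ?thesis .
    qed
    then show "(\<integral>\<^sup>+x. ennreal (power_weight \<alpha> \<beta> (x::'a) powr (- 1 / (p - 1))) * indicator (cball 0 (1 / a)) x \<partial>lborel)
      \<le> ennreal ((C1 + C2) * (a powr (- real DIM('a)) * max_weight \<alpha> \<beta> a powr (1 / (p - 1))))"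
      by (simp only: n_def)
  qed
qed

text \<open>The inner part is bounded pointwise and multiplied by the measure of the shell, the
  outer part goes through the unweighted estimate. With the cut at 1 / a both contributions carry
  the same power of a and the same power of \<open>max_weight\<close>, which dictates the place of
  the cut. The factor 2 powr q comes from (x + y)^q \<le> 2^q (x^q + y^q).\<close>

lemma weighted_shell_restriction:
  fixes p q \<alpha> \<beta> :: real
  assumes n2: "2 \<le> DIM('a::euclidean_space)" and p: "1 < p" and q: "2 \<le> q" "q \<le> (real DIM('a) - 1) / (real DIM('a) + 1) * conj_exponent p"
    and al: "\<alpha> < DIM('a) * (p - 1)" and be: "0 \<le> \<beta>"
  obtains C where "0 < C" "\<And>a b R (f :: 'a \<Rightarrow> complex). 0 < a \<Longrightarrow> a < b \<Longrightarrow> b \<le> 2 * a \<Longrightarrow> bounded_supported R f \<Longrightarrow>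
    integrable lborel (\<lambda>x. power_weight \<alpha> \<beta> x * cmod (f x) powr p) \<Longrightarrow>
    (\<integral>\<^sup>+\<xi>. ennreal (cmod (fourier f \<xi>) powr q) * indicator (shell a b) \<xi> \<partial>lborel)
      \<le> ennreal (C * (b - a) * a powr (real DIM('a) - 1 - q * real DIM('a) / conj_exponent p) * max_weight \<alpha> \<beta> a powr (q / p)
          * (LINT x|lborel. power_weight \<alpha> \<beta> x * cmod (f x) powr p) powr (q / p))"
proof -
  define n where "n = real DIM('a)"
  define p' where "p' = conj_exponent p"
  have p': "p' = p / (p - 1)" "1 < p'" "1 / p + 1 / p' = 1" using p by (auto simp: p'_def conj_exponent_def field_simps)
  let ?v = "power_weight \<alpha> \<beta> :: 'a \<Rightarrow> real" and ?w = "max_weight \<alpha> \<beta>"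
  obtain C1 where C1: "0 < C1" and rest: "\<And>a b R (f :: 'a \<Rightarrow> complex). 0 < a \<Longrightarrow> a < b \<Longrightarrow> b \<le> 2 * a \<Longrightarrow> bounded_supported R f \<Longrightarrow>
    (\<integral>\<^sup>+\<xi>. ennreal (cmod (fourier f \<xi>) powr q) * indicator (shell a b) \<xi> \<partial>lborel)
      \<le> ennreal (C1 * (b - a) * a powr (n - 1 - q * n / p') * (LINT x|lborel. cmod (f x) powr p) powr (q / p))"
    unfolding n_def p'_def by (rule shell_restriction[OF n2 p q]) blast
  obtain C2 where C2: "0 < C2" and wint: "\<And>a. 0 < a \<Longrightarrow>
    (\<integral>\<^sup>+x. ennreal (?v x powr (- 1 / (p - 1))) * indicator (cball 0 (1 / a)) x \<partial>lborel)
      \<le> ennreal (C2 * (a powr (- n) * ?w a powr (1 / (p - 1))))"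
    unfolding n_def by (rule nn_integral_power_weight_cball_le[OF p al be]) blast
  obtain C3 where C3: "0 < C3" and vol: "\<And>a b. 0 < a \<Longrightarrow> a \<le> b \<Longrightarrow> b \<le> 2 * a \<Longrightarrow>
    emeasure lborel (shell a b :: 'a set) \<le> ennreal (C3 * (b - a) * a powr (n - 1))"
    unfolding n_def by (rule emeasure_shell_le) blast
  define C where "C = 2 powr q * (C2 powr (q / p') * C3 + C1)"
  show ?thesis
  proof (rule that[of C])
    show "0 < C" using C1 C2 C3 by (simp add: C_def add_pos_pos)
    fix a b R :: real and f :: "'a \<Rightarrow> complex"
    assume a: "0 < a" and ab: "a < b" "b \<le> 2 * a" and f: "bounded_supported R f"
      and vi: "integrable lborel (\<lambda>x. ?v x * cmod (f x) powr p)"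
    have fm [measurable]: "f \<in> borel_measurable borel" by (rule bounded_supported_measurable[OF f])
    define V where "V = (LINT x|lborel. ?v x * cmod (f x) powr p)"
    have V0: "0 \<le> V" unfolding V_def by (intro integral_nonneg_AE) (simp add: power_weight_nonneg)
    have w0: "0 < ?w a" by (rule max_weight_pos[OF a])
    define g where "g x = (if x \<in> cball 0 (1 / a) then f x else 0)" for x
    define h where "h x = (if x \<in> - cball 0 (1 / a) then f x else 0)" for x
    have gb: "bounded_supported R g" and hb: "bounded_supported R h"
      unfolding g_def[abs_def] h_def[abs_def] by (intro bounded_supported_restrict f; auto)+
    have cb [measurable]: "cball (0::'a) (1 / a) \<in> sets borel" by simp
    have gm [measurable]: "g \<in> borel_measurable borel" by (rule bounded_supported_measurable[OF gb])
    have hm [measurable]: "h \<in> borel_measurable borel" by (rule bounded_supported_measurable[OF hb])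
    have fgh: "f = (\<lambda>x. g x + h x)" by (auto simp: g_def h_def fun_eq_iff)
    define W where "W = C2 * (a powr (- n) * ?w a powr (1 / (p - 1)))"
    have W0: "0 \<le> W" using C2 by (simp add: W_def)
    have gL1: "(LINT x|lborel. cmod (g x)) \<le> V powr (1 / p) * W powr (1 / p')"
    proof -
      define A where "A x = ?v x powr (1 / p) * cmod (f x)" for x
      define B where "B x = ?v x powr (- 1 / p) * indicator (cball 0 (1 / a)) x" for x
      have Am [measurable]: "A \<in> borel_measurable borel" unfolding A_def[abs_def] by measurable
      have Bm [measurable]: "B \<in> borel_measurable borel" unfolding B_def[abs_def] by measurable
      have Ap: "A x powr p = ?v x * cmod (f x) powr p" for x
        unfolding A_def using p power_weight_nonneg[of \<alpha> \<beta> x] by (simp add: powr_mult powr_powr)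
      have Bp: "B x powr p' = ?v x powr (- 1 / (p - 1)) * indicator (cball 0 (1 / a)) x" for x
      proof -
        have "- 1 / p * p' = - 1 / (p - 1)" using p by (simp add: p'(1))
        then have "(?v x powr (- 1 / p)) powr p' = ?v x powr (- 1 / (p - 1))" unfolding powr_powr by (simp only:)
        then show ?thesis by (simp add: B_def indicator_def)
      qed
      have Bn: "(\<integral>\<^sup>+x. ennreal (B x powr p') \<partial>lborel) \<le> ennreal W"
      proof -
        have "ennreal (B x powr p') = ennreal (?v x powr (- 1 / (p - 1))) * indicator (cball 0 (1 / a)) x" for x
          unfolding Bp by (auto simp: indicator_def)
        then show ?thesis using wint[OF a] by (simp add: W_def)
      qed
      have Bi: "integrable lborel (\<lambda>x. B x powr p')"
      proof (rule integrableI_bounded)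
        show "(\<integral>\<^sup>+x. ennreal (norm (B x powr p')) \<partial>lborel) < \<infinity>" using Bn by (simp add: le_less_trans)
      qed simp
      have BW: "(LINT x|lborel. B x powr p') \<le> W"
      proof -
        have "ennreal (LINT x|lborel. B x powr p') = (\<integral>\<^sup>+x. ennreal (B x powr p') \<partial>lborel)"
          by (rule nn_integral_eq_integral[symmetric, OF Bi]) simp
        then show ?thesis using Bn W0 by (metis ennreal_le_iff)
      qed
      have "(LINT x|lborel. cmod (g x)) = (LINT x|lborel. A x * B x)"
      proof (rule integral_cong_AE)
        \<comment> \<open>At the origin the weight and all its powers are 0, so
          \<open>?v x powr (1 / p)\<close> and \<open>?v x powr (- 1 / p)\<close> do not multiply to
          1 there.\<close>
        have "AE x in lborel. x \<noteq> (0::'a)" by (rule AE_lborel_singleton)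
        then show "AE x in lborel. cmod (g x) = A x * B x"
        proof eventually_elim
          fix x :: 'a assume "x \<noteq> 0"
          then have "?v x powr (1 / p) * ?v x powr (- 1 / p) = 1"
            using power_weight_pos[of x \<alpha> \<beta>] by (simp add: powr_add[symmetric])
          moreover have "A x * B x = (?v x powr (1 / p) * ?v x powr (- 1 / p)) * (cmod (f x) * indicator (cball 0 (1 / a)) x)"
            by (simp add: A_def B_def)
          ultimately show "cmod (g x) = A x * B x" by (simp add: g_def indicator_def)
        qed
      qed simp_all
      also have "\<dots> \<le> (LINT x|lborel. A x powr p) powr (1 / p) * (LINT x|lborel. B x powr p') powr (1 / p')"
        by (rule holder_integral(2)[OF p p'(3)]) (use vi Bi in \<open>auto simp: A_def B_def Ap[unfolded A_def]\<close>)
      also have "\<dots> \<le> V powr (1 / p) * W powr (1 / p')"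
        unfolding Ap V_def using BW p'(2) by (intro mult_left_mono powr_mono2 integral_nonneg_AE) auto
      finally show ?thesis .
    qed
    have "(LINT x|lborel. cmod (h x) powr p) \<le> (LINT x|lborel. ?w a * (?v x * cmod (f x) powr p))"
    proof (rule integral_mono)
      show "integrable lborel (\<lambda>x. cmod (h x) powr p)" using bounded_supported_integrable_powr[OF hb] p by simp
      show "integrable lborel (\<lambda>x. ?w a * (?v x * cmod (f x) powr p))" using vi by simp
      fix x
      show "cmod (h x) powr p \<le> ?w a * (?v x * cmod (f x) powr p)"
      proof (cases "1 / a < norm x")
        case True
        have "1 * cmod (f x) powr p \<le> (?w a * ?v x) * cmod (f x) powr p"
          by (intro mult_right_mono max_weight_mult_power_weight_ge be a True) auto
        then show ?thesis using True by (simp add: h_def dist_norm mult.assoc)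
      next
        case False
        then show ?thesis using w0 power_weight_nonneg[of \<alpha> \<beta> x] p by (simp add: h_def dist_norm)
      qed
    qed
    also have "\<dots> = ?w a * V" by (simp add: V_def)
    finally have hLp: "(LINT x|lborel. cmod (h x) powr p) \<le> ?w a * V" .
    define G where "G = V powr (1 / p) * W powr (1 / p')"
    have G0: "0 \<le> G" by (simp add: G_def)
    have "(\<integral>\<^sup>+\<xi>. ennreal (cmod (fourier f \<xi>) powr q) * indicator (shell a b) \<xi> \<partial>lborel)
      \<le> (\<integral>\<^sup>+\<xi>. ennreal (2 powr q * G powr q) * indicator (shell a b) \<xi> + ennreal (2 powr q) * (ennreal (cmod (fourier h \<xi>) powr q) * indicator (shell a b) \<xi>) \<partial>lborel)"
    proof (rule nn_integral_mono)
      fix \<xi> :: 'a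
      let ?H = "cmod (fourier h \<xi>)"
      have "fourier f \<xi> = fourier g \<xi> + fourier h \<xi>"
        by (subst fgh) (rule fourier_add[OF bounded_supported_integrable(1)[OF gb] bounded_supported_integrable(1)[OF hb]])
      then have "cmod (fourier f \<xi>) \<le> G + ?H"
        using norm_triangle_ineq[of "fourier g \<xi>" "fourier h \<xi>"] norm_fourier_le[OF gm, of \<xi>] gL1 by (simp add: G_def)
      also have "\<dots> \<le> 2 * max G ?H" by simp
      finally have "cmod (fourier f \<xi>) powr q \<le> (2 * max G ?H) powr q" using q by (intro powr_mono2) auto
      also have "\<dots> = 2 powr q * (max G ?H) powr q" using G0 by (simp add: powr_mult)
      also have "\<dots> \<le> 2 powr q * (G powr q + ?H powr q)" by (intro mult_left_mono) (auto simp: max_def)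
      finally have "ennreal (cmod (fourier f \<xi>) powr q) \<le> ennreal (2 powr q * G powr q + 2 powr q * ?H powr q)"
        by (intro ennreal_leI) (simp add: distrib_left)
      also have "\<dots> = ennreal (2 powr q * G powr q) + ennreal (2 powr q) * ennreal (?H powr q)"
        by (simp add: ennreal_plus ennreal_mult)
      finally show "ennreal (cmod (fourier f \<xi>) powr q) * indicator (shell a b) \<xi>
        \<le> ennreal (2 powr q * G powr q) * indicator (shell a b) \<xi> + ennreal (2 powr q) * (ennreal (?H powr q) * indicator (shell a b) \<xi>)"
        by (auto simp: indicator_def)
    qed
    also have "\<dots> = ennreal (2 powr q * G powr q) * emeasure lborel (shell a b :: 'a set) + ennreal (2 powr q) * (\<integral>\<^sup>+\<xi>. ennreal (cmod (fourier h \<xi>) powr q) * indicator (shell a b) \<xi> \<partial>lborel)"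
      by (subst nn_integral_add) (auto simp: nn_integral_cmult nn_integral_cmult_indicator)
    also have "\<dots> \<le> ennreal (2 powr q * G powr q) * ennreal (C3 * (b - a) * a powr (n - 1))
        + ennreal (2 powr q) * ennreal (C1 * (b - a) * a powr (n - 1 - q * n / p') * (LINT x|lborel. cmod (h x) powr p) powr (q / p))"
      using ab by (intro add_mono mult_left_mono vol rest[OF a _ _ hb] a) auto
    also have "\<dots> \<le> ennreal (2 powr q * G powr q) * ennreal (C3 * (b - a) * a powr (n - 1))
        + ennreal (2 powr q) * ennreal (C1 * (b - a) * a powr (n - 1 - q * n / p') * (?w a * V) powr (q / p))"
      using ab C1 hLp p q by (intro add_mono order_refl mult_left_mono ennreal_leI powr_mono2 integral_nonneg_AE) auto
    also have "\<dots> = ennreal (2 powr q * G powr q * (C3 * (b - a) * a powr (n - 1)) + 2 powr q * (C1 * (b - a) * a powr (n - 1 - q * n / p') * (?w a * V) powr (q / p)))"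
      using ab C1 C3 by (simp add: ennreal_mult[symmetric] ennreal_plus[symmetric] del: ennreal_plus)
    also have "2 powr q * G powr q * (C3 * (b - a) * a powr (n - 1)) + 2 powr q * (C1 * (b - a) * a powr (n - 1 - q * n / p') * (?w a * V) powr (q / p))
      = C * (b - a) * a powr (n - 1 - q * n / p') * ?w a powr (q / p) * V powr (q / p)"
    proof -
      have x: "1 / p' * q = q / p'" "1 / p * q = q / p" by simp_all
      have y: "1 / (p - 1) * (q / p') = q / p" "- n * (q / p') = - (q * n / p')" using p by (simp_all add: p'(1))
      have "G powr q = V powr (q / p) * W powr (q / p')"
        unfolding G_def by (simp only: powr_mult powr_powr x)
      moreover have "W powr (q / p') = C2 powr (q / p') * (a powr (- (q * n / p')) * ?w a powr (q / p))"
        unfolding W_def powr_mult powr_powr y ..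
      moreover have "(?w a * V) powr (q / p) = ?w a powr (q / p) * V powr (q / p)" by (rule powr_mult)
      moreover have "a powr (- (q * n / p')) * a powr (n - 1) = a powr (n - 1 - q * n / p')"
        by (simp add: powr_add[symmetric])
      moreover have "t * (v * (c * (z * w))) * (C3 * l * y) + t * (C1 * l * (z * y) * (w * v)) = t * (c * C3 + C1) * l * (z * y) * w * v" for t v c z w l y :: real
        by (simp add: algebra_simps)
      ultimately show ?thesis unfolding C_def by metis
    qed
    finally show "(\<integral>\<^sup>+\<xi>. ennreal (cmod (fourier f \<xi>) powr q) * indicator (shell a b) \<xi> \<partial>lborel)
      \<le> ennreal (C * (b - a) * a powr (real DIM('a) - 1 - q * real DIM('a) / conj_exponent p) * max_weight \<alpha> \<beta> a powr (q / p)
          * (LINT x|lborel. power_weight \<alpha> \<beta> x * cmod (f x) powr p) powr (q / p))"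
      by (simp only: n_def p'_def V_def)
  qed
qed

section \<open>Measures dominated on short intervals\<close>

text \<open>Intervals with b \<le> 2 a are those for which the shell estimates are available. The
  comparison is first extended to open sets and then, against a density, to integrals over the
  positive half-line.\<close>

definition short_interval_dominated :: "real measure \<Rightarrow> real measure \<Rightarrow> bool" where
  "short_interval_dominated M N \<longleftrightarrow> (\<forall>a b. 0 < a \<longrightarrow> a < b \<longrightarrow> b \<le> 2 * a \<longrightarrow> emeasure M {a<..b} \<le> emeasure N {a<..b})"

text \<open>U is the increasing union of the sets \<open>W m\<close>, each a disjoint union of
  dyadic intervals of length 2^-m contained in U. An index k \<ge> 1 means (k + 1) / 2^m \<le> 2 (k
  / 2^m), so the hypothesis applies to each interval.\<close>

lemma emeasure_le_open:
  assumes sM [measurable_cong, simp]: "sets M = sets (borel :: real measure)" and sN [measurable_cong, simp]: "sets N = sets borel"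
    and le: "short_interval_dominated M N" and U: "open U" "U \<subseteq> {0<..}"
  shows "emeasure M U \<le> emeasure N U"
proof -
  define I where "I m k = {real k / 2 ^ m<..(real k + 1) / 2 ^ m}" for m k :: nat
  define D where "D m = {k. 1 \<le> k \<and> I m k \<subseteq> U}" for m
  define W where "W m = (\<Union>k\<in>D m. I m k)" for m
  have mem: "x \<in> I m k \<longleftrightarrow> \<lceil>x * 2 ^ m\<rceil> = int k + 1" for x m k
    by (auto simp: I_def ceiling_eq_iff field_simps)
  have disj: "disjoint_family_on (I m) (D m)" for m
    by (auto simp: disjoint_family_on_def mem)
  have Im [simp]: "I m k \<in> sets borel" for m k by (simp add: I_def)
  have Wle: "emeasure M (W m) \<le> emeasure N (W m)" for m
  proof -
    have "emeasure M (W m) = (\<integral>\<^sup>+k. emeasure M (I m k) \<partial>count_space (D m))"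
      unfolding W_def by (rule emeasure_UN_countable) (use disj in auto)
    also have "\<dots> \<le> (\<integral>\<^sup>+k. emeasure N (I m k) \<partial>count_space (D m))"
    proof (rule nn_integral_mono)
      fix k assume "k \<in> space (count_space (D m))"
      then have k: "1 \<le> k" by (simp add: D_def)
      have "0 < real k / 2 ^ m" "real k / 2 ^ m < (real k + 1) / 2 ^ m" "(real k + 1) / 2 ^ m \<le> 2 * (real k / 2 ^ m)"
        using k by (auto simp: field_simps)
      then show "emeasure M (I m k) \<le> emeasure N (I m k)"
        using le unfolding short_interval_dominated_def I_def by blast
    qed
    also have "\<dots> = emeasure N (W m)"
      unfolding W_def by (rule emeasure_UN_countable[symmetric]) (use disj in auto)
    finally show ?thesis .
  qed
  have Wm: "W m \<in> sets borel" for m unfolding W_def I_def by (intro sets.countable_UN') auto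
  have inc: "incseq W"
  proof (rule incseq_SucI, rule subsetI)
    fix m x assume "x \<in> W m"
    then obtain k where k: "1 \<le> k" "I m k \<subseteq> U" "x \<in> I m k" by (auto simp: W_def D_def)
    define l where "l = (if x \<in> I (Suc m) (2 * k) then 2 * k else 2 * k + 1)"
    have "x \<in> I (Suc m) l" using k(3) by (auto simp: l_def I_def field_simps)
    moreover have "I (Suc m) l \<subseteq> I m k" by (auto simp: l_def I_def field_simps)
    ultimately have "l \<in> D (Suc m)" "x \<in> I (Suc m) l" using k by (auto simp: D_def l_def)
    then show "x \<in> W (Suc m)" unfolding W_def by blast
  qed
  have un: "(\<Union>m. W m) = U"
  proof
    show "(\<Union>m. W m) \<subseteq> U" by (auto simp: W_def D_def)
    show "U \<subseteq> (\<Union>m. W m)"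
    proof
      fix x assume x: "x \<in> U"
      then have x0: "0 < x" using U by auto
      obtain e where e: "0 < e" "ball x e \<subseteq> U" using U x open_contains_ball by blast
      \<comment> \<open>A mesh below e keeps the interval around x inside U; a mesh below x / 2
        makes its index at least 1.\<close>
      obtain m where m: "(1/2::real) ^ m < min e (x / 2)" using real_arch_pow_inv[of "min e (x / 2)" "1/2"] e x0 by auto
      then have m': "1 < e * 2 ^ m" "2 < x * 2 ^ m" by (auto simp: power_one_over field_simps)
      define k where "k = nat (\<lceil>x * 2 ^ m\<rceil> - 1)"
      have ck: "\<lceil>x * 2 ^ m\<rceil> = int k + 1" using m'(2) unfolding k_def by linarith
      then have xk: "x \<in> I m k" by (simp add: mem)
      have k1: "1 \<le> k" using ck m'(2) by linarith
      have "I m k \<subseteq> ball x e"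
      proof
        fix y assume y: "y \<in> I m k"
        have "\<bar>x - y\<bar> * 2 ^ m = \<bar>x * 2 ^ m - y * 2 ^ m\<bar>" by (simp add: abs_mult left_diff_distrib[symmetric])
        also have "\<dots> \<le> 1" using xk y unfolding I_def by (auto simp: field_simps abs_le_iff)
        finally have "\<bar>x - y\<bar> * 2 ^ m \<le> 1" .
        then have "\<bar>x - y\<bar> * 2 ^ m < e * 2 ^ m" using m'(1) by linarith
        then show "y \<in> ball x e" by (simp add: dist_real_def)
      qed
      then have "k \<in> D m" using k1 e by (auto simp: D_def)
      then show "x \<in> (\<Union>m. W m)" using xk by (auto simp: W_def)
    qed
  qed
  have rM: "range W \<subseteq> sets M" and rN: "range W \<subseteq> sets N" using Wm by auto
  have "emeasure M U = (SUP m. emeasure M (W m))"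
    using SUP_emeasure_incseq[OF rM inc] unfolding un by simp
  also have "\<dots> \<le> (SUP m. emeasure N (W m))" by (intro SUP_mono) (use Wle in auto)
  also have "\<dots> = emeasure N U"
    using SUP_emeasure_incseq[OF rN inc] unfolding un by simp
  finally show ?thesis .
qed

text \<open>A substitute for polar coordinates: M will be the distribution of |\<xi>| under a
  density on the whole space, and a bound on shells becomes a bound by a multiple of g(\<rho>)
  d\<rho>. The passage from open to Borel sets is by outer regularity of a finite measure, hence the
  localisation to (1 / (m + 1), m + 1), where g is bounded, followed by a monotone limit. L measures
  how far g can drop over an interval [a, 2 a].\<close>

lemma nn_integral_le_of_interval_bound:
  fixes g :: "real \<Rightarrow> real"
  assumes sM [measurable_cong, simp]: "sets M = sets (borel :: real measure)" and g: "continuous_on {0<..} g" and g0: "\<And>x. 0 < x \<Longrightarrow> 0 \<le> g x"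
    and K: "0 \<le> K" "0 \<le> L" and gl: "\<And>a x. 0 < a \<Longrightarrow> a \<le> x \<Longrightarrow> x \<le> 2 * a \<Longrightarrow> g a \<le> L * g x"
    and int: "\<And>a b. 0 < a \<Longrightarrow> a < b \<Longrightarrow> b \<le> 2 * a \<Longrightarrow> emeasure M {a<..b} \<le> ennreal (K * (b - a) * g a)"
    and u [measurable]: "u \<in> borel_measurable borel"
  shows "(\<integral>\<^sup>+x. u x * indicator {0<..} x \<partial>M) \<le> (\<integral>\<^sup>+x. ennreal (K * L * g x) * u x * indicator {0<..} x \<partial>lborel)"
proof -
  have gm [measurable]: "(\<lambda>x. g x * indicator {0<..} x) \<in> borel_measurable borel"
  proof -
    have "(\<lambda>x. indicator {0<..} x *\<^sub>R g x) \<in> borel_measurable borel"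
      by (rule borel_measurable_continuous_on_indicator[OF _ g]) simp
    then show ?thesis by (simp add: mult.commute)
  qed
  define N where "N = density lborel (\<lambda>x. ennreal (K * L * (g x * indicator {0<..} x)))"
  have sN [measurable_cong, simp]: "sets N = sets borel" by (simp add: N_def)
  have dom: "short_interval_dominated M N"
    unfolding short_interval_dominated_def
  proof (intro allI impI)
    fix a b :: real assume ab: "0 < a" "a < b" "b \<le> 2 * a"
    have "emeasure M {a<..b} \<le> ennreal (K * (b - a) * g a)" by (rule int[OF ab])
    also have "\<dots> = ennreal (K * g a) * emeasure lborel {a<..b}"
      using ab K g0[of a] by (simp add: ennreal_mult[symmetric] mult_ac)
    also have "\<dots> = (\<integral>\<^sup>+x. ennreal (K * g a) * indicator {a<..b} x \<partial>lborel)"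
      by (rule nn_integral_cmult_indicator[symmetric]) simp
    also have "\<dots> \<le> (\<integral>\<^sup>+x. ennreal (K * L * (g x * indicator {0<..} x)) * indicator {a<..b} x \<partial>lborel)"
    proof (rule nn_integral_mono)
      fix x
      show "ennreal (K * g a) * indicator {a<..b} x \<le> ennreal (K * L * (g x * indicator {0<..} x)) * indicator {a<..b} x"
      proof (cases "x \<in> {a<..b}")
        case True
        then have "K * g a \<le> K * (L * g x)" using ab K by (intro mult_left_mono gl) auto
        then show ?thesis using True ab by (simp add: mult.assoc ennreal_leI)
      qed simp
    qed
    also have "\<dots> = emeasure N {a<..b}" unfolding N_def by (rule emeasure_density[symmetric]) auto
    finally show "emeasure M {a<..b} \<le> emeasure N {a<..b}" .
  qed
  have bnd: "emeasure M (E \<inter> {1 / real (Suc m)<..<real (Suc m)}) \<le> emeasure N E" if E [measurable]: "E \<in> sets borel" for E m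
  proof -
    let ?J = "{1 / real (Suc m)<..<real (Suc m)}"
    define N' where "N' = density N (indicator ?J)"
    have sN' [measurable_cong, simp]: "sets N' = sets borel" by (simp add: N'_def)
    have N'e: "emeasure N' A = emeasure N (?J \<inter> A)" if "A \<in> sets borel" for A
      unfolding N'_def using that by (subst emeasure_density) (auto simp: indicator_inter_arith[symmetric])
    \<comment> \<open>By continuity g is bounded on the compact closure of the interval, so the
      localised measure is finite.\<close>
    have fin: "emeasure N' (space N') \<noteq> \<infinity>"
    proof -
      let ?Jc = "{1 / real (Suc m)..real (Suc m)}"
      have "compact (g ` ?Jc)" by (intro compact_continuous_image continuous_on_subset[OF g]) (auto intro: less_le_trans[of 0 "1 / real (Suc m)"])
      then obtain B where "\<forall>y\<in>g ` ?Jc. norm y \<le> B" using compact_imp_bounded bounded_iff by blast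
      then have B: "\<bar>g x\<bar> \<le> B" if "x \<in> ?Jc" for x using that by auto
      have "emeasure N' (space N') = emeasure N ?J" using N'e[of UNIV] sets_eq_imp_space_eq[OF sN'] by simp
      also have "\<dots> = (\<integral>\<^sup>+x. ennreal (K * L * (g x * indicator {0<..} x)) * indicator ?J x \<partial>lborel)"
        unfolding N_def by (rule emeasure_density) auto
      also have "\<dots> \<le> (\<integral>\<^sup>+x. ennreal (K * L * B) * indicator ?J x \<partial>lborel)"
      proof (rule nn_integral_mono)
        fix x
        show "ennreal (K * L * (g x * indicator {0<..} x)) * indicator ?J x \<le> ennreal (K * L * B) * indicator ?J x"
        proof (cases "x \<in> ?J")
          case True
          then have "g x \<le> B" using B[of x] by (auto simp: abs_le_iff)
          moreover have "0 < x" using True by (auto intro: less_trans[of 0 "1 / real (Suc m)"])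
          ultimately show ?thesis using True K by (auto intro!: ennreal_leI mult_left_mono)
        qed simp
      qed
      also have "\<dots> = ennreal (K * L * B) * emeasure lborel ?J" by (rule nn_integral_cmult_indicator) simp
      also have "\<dots> < \<infinity>" by (cases "1 / real (Suc m) \<le> real (Suc m)") (auto simp: ennreal_mult_less_top)
      finally show ?thesis by simp
    qed
    have "emeasure M (E \<inter> ?J) \<le> emeasure N' E"
    proof (subst outer_regular[OF _ fin], simp, simp, rule INF_greatest)
      fix U assume "U \<in> {U. E \<subseteq> U \<and> open U}"
      then have U: "E \<subseteq> U" "open U" by auto
      have "emeasure M (E \<inter> ?J) \<le> emeasure M (U \<inter> ?J)" using U by (intro emeasure_mono) auto
      also have "\<dots> \<le> emeasure N (U \<inter> ?J)"
        by (rule emeasure_le_open[OF sM sN dom]) (use U in \<open>auto intro: less_trans[of 0 "1 / real (Suc m)"]\<close>)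
      also have "\<dots> = emeasure N' U" using N'e[of U] U by (simp add: Int_commute)
      finally show "emeasure M (E \<inter> ?J) \<le> emeasure N' U" .
    qed
    also have "\<dots> \<le> emeasure N E" using N'e[OF E] by (simp add: emeasure_mono)
    finally show ?thesis .
  qed
  have le: "emeasure M (E \<inter> {0<..}) \<le> emeasure N E" if E [measurable]: "E \<in> sets borel" for E
  proof -
    let ?A = "\<lambda>m. E \<inter> {1 / real (Suc m)<..<real (Suc m)}"
    have inc: "incseq ?A"
    proof (rule incseq_SucI)
      fix m
      have "1 / real (Suc (Suc m)) \<le> 1 / real (Suc m)" by (intro divide_left_mono) auto
      then show "?A m \<subseteq> ?A (Suc m)" by auto
    qed
    have "(\<Union>m. ?A m) = E \<inter> {0<..}"
    proof
      show "(\<Union>m. ?A m) \<subseteq> E \<inter> {0<..}" by (auto intro: less_trans[of 0 "1 / real (Suc _)"])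
      show "E \<inter> {0<..} \<subseteq> (\<Union>m. ?A m)"
      proof
        fix x assume "x \<in> E \<inter> {0<..}"
        then have x: "x \<in> E" "0 < x" by auto
        obtain m where m: "max x (1 / x) < real m" using reals_Archimedean2 by blast
        then have m': "1 / x < real (Suc m)" "x < real (Suc m)" by auto
        then have "1 / real (Suc m) < x" using x by (simp add: field_simps)
        then have "x \<in> ?A m" using x m'(2) by simp
        then show "x \<in> (\<Union>m. ?A m)" by (rule UN_I[OF UNIV_I])
      qed
    qed
    then have "emeasure M (E \<inter> {0<..}) = (SUP m. emeasure M (?A m))"
    proof -
      assume un: "(\<Union>m. ?A m) = E \<inter> {0<..}"
      have r: "range ?A \<subseteq> sets M" by auto
      show ?thesis using SUP_emeasure_incseq[OF r inc] unfolding un by simp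
    qed
    also have "\<dots> \<le> emeasure N E" by (intro SUP_least bnd E)
    finally show ?thesis .
  qed
  define M' where "M' = density M (indicator {0<..})"
  have sM' [simp]: "sets M' = sets borel" by (simp add: M'_def)
  have "M' \<le> N"
  proof (subst le_measure)
    show "sets M' = sets N" by simp
    show "\<forall>A\<in>sets M'. emeasure M' A \<le> emeasure N A"
    proof
      fix A assume "A \<in> sets M'"
      then have A [measurable]: "A \<in> sets borel" by simp
      have "emeasure M' A = emeasure M (A \<inter> {0<..})"
        unfolding M'_def by (subst emeasure_density) (auto simp: indicator_inter_arith[symmetric] Int_commute)
      then show "emeasure M' A \<le> emeasure N A" using le[OF A] by simp
    qed
  qed
  then have "integral\<^sup>N M' u \<le> integral\<^sup>N N u" by (intro nn_integral_mono_measure) auto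
  moreover have "integral\<^sup>N M' u = (\<integral>\<^sup>+x. u x * indicator {0<..} x \<partial>M)"
    unfolding M'_def by (subst nn_integral_density) (auto simp: mult.commute)
  moreover have "integral\<^sup>N N u = (\<integral>\<^sup>+x. ennreal (K * L * g x) * u x * indicator {0<..} x \<partial>lborel)"
  proof -
    have "integral\<^sup>N N u = (\<integral>\<^sup>+x. ennreal (K * L * (g x * indicator {0<..} x)) * u x \<partial>lborel)"
      unfolding N_def by (rule nn_integral_density) simp_all
    also have "\<dots> = (\<integral>\<^sup>+x. ennreal (K * L * g x) * u x * indicator {0<..} x \<partial>lborel)"
      by (intro nn_integral_cong) (auto simp: indicator_def)
    finally show ?thesis .
  qed
  ultimately show ?thesis by simp
qed

section \<open>Radial functions\<close>

lemma distr_norm_density_interval: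
  fixes h :: "'a::euclidean_space \<Rightarrow> ennreal"
  assumes [measurable]: "h \<in> borel_measurable borel"
  shows "emeasure (distr (density lborel h) borel norm) {a<..b} = (\<integral>\<^sup>+x. h x * indicator (shell a b) x \<partial>lborel)"
proof -
  have "emeasure (distr (density lborel h) borel norm) {a<..b} = emeasure (density lborel h) (norm -` {a<..b} \<inter> space (density lborel h))"
    by (rule emeasure_distr) auto
  also have "norm -` {a<..b} \<inter> space (density lborel h) = shell a b" by (auto simp: shell_def)
  also have "emeasure (density lborel h) (shell a b) = (\<integral>\<^sup>+x. h x * indicator (shell a b) x \<partial>lborel)"
    by (rule emeasure_density) auto
  finally show ?thesis .
qed

text \<open>By Fubini, almost every ray meets the exceptional null set of a Borel version of \<open>u\<close> in a null set.\<close>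

lemma radial_measurable_profile:
  fixes u :: "'a::euclidean_space \<Rightarrow> real" and u0 :: "real \<Rightarrow> real"
  assumes u: "u \<in> borel_measurable lebesgue" and rad: "\<And>x. u x = u0 (norm x)"
  obtains u1 where "u1 \<in> borel_measurable borel" "AE \<rho> in lborel. 0 < \<rho> \<longrightarrow> u0 \<rho> = u1 \<rho>" "AE x in lborel. u x = u1 (norm x)"
proof -
  obtain u' where u' [measurable]: "u' \<in> borel_measurable borel" and ae: "AE x in lborel. u x = u' x"
    using completion_ex_borel_measurable_real[OF u] by auto
  obtain N where N: "N \<in> null_sets lborel" and Nu: "\<And>x. x \<notin> N \<Longrightarrow> u x = u' x"
    using ae unfolding eventually_ae_filter by auto
  have Nm [measurable]: "N \<in> sets borel" using N by auto
  \<comment> \<open>Every dilate of the null set N is null; this is what Fubini in (t, x)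
    needs.\<close>
  have scl: "(\<integral>\<^sup>+x. indicator N (t *\<^sub>R x) \<partial>lborel) = 0" if "0 < t" for t
  proof -
    have "(\<integral>\<^sup>+x. indicator N x \<partial>lborel) = ennreal (t ^ DIM('a)) * (\<integral>\<^sup>+x. indicator N (t *\<^sub>R x) \<partial>lborel)"
      using that by (intro nn_integral_lborel_scale) auto
    moreover have "(\<integral>\<^sup>+x. indicator N x \<partial>lborel) = 0" using N by auto
    ultimately show ?thesis using that by simp
  qed
  have "(\<integral>\<^sup>+x. (\<integral>\<^sup>+t. indicator N (t *\<^sub>R x) * indicator {0<..} t \<partial>lborel) \<partial>lborel)
      = (\<integral>\<^sup>+t. (\<integral>\<^sup>+x. indicator N (t *\<^sub>R x) * indicator {0<..} t \<partial>lborel) \<partial>lborel)"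
    by (rule lborel_pair.Fubini') simp
  also have "\<dots> = (\<integral>\<^sup>+(t::real). 0 \<partial>lborel)"
  proof (rule nn_integral_cong)
    fix t :: real
    have "(\<integral>\<^sup>+x. indicator N (t *\<^sub>R x) * indicator {0<..} t \<partial>lborel) = (\<integral>\<^sup>+x. indicator N (t *\<^sub>R x) \<partial>lborel) * indicator {0<..} t"
      by (rule nn_integral_multc) simp
    then show "(\<integral>\<^sup>+x. indicator N (t *\<^sub>R x) * indicator {0<..} t \<partial>lborel) = 0" using scl[of t] by (cases "0 < t") auto
  qed
  finally have "(\<integral>\<^sup>+x. (\<integral>\<^sup>+t. indicator N (t *\<^sub>R x) * indicator {0<..} t \<partial>lborel) \<partial>lborel) = 0" by simp
  then have "AE x in lborel. (\<integral>\<^sup>+t. indicator N (t *\<^sub>R x) * indicator {0<..} t \<partial>lborel) = 0"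
    by (subst (asm) nn_integral_0_iff_AE) measurable
  moreover have "AE x in lborel. x \<noteq> (0::'a)" by (rule AE_lborel_singleton)
  ultimately have "AE x in lborel. (\<integral>\<^sup>+t. indicator N (t *\<^sub>R x) * indicator {0<..} t \<partial>lborel) = 0 \<and> x \<noteq> (0::'a)"
    by eventually_elim auto
  \<comment> \<open>Lebesgue measure is not zero, so the property holds at some nonzero x. The Borel
    profile \<open>u1\<close> is then read off along the ray through this x.\<close>
  moreover have "\<not> (AE x in (lborel :: 'a measure). False)"
    by (simp add: eventually_False ae_filter_eq_bot_iff)
  ultimately have "\<exists>x::'a. (\<integral>\<^sup>+t. indicator N (t *\<^sub>R x) * indicator {0<..} t \<partial>lborel) = 0 \<and> x \<noteq> 0"
    using eventually_mono[where Q="\<lambda>_. False"] by blast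
  then obtain x :: 'a where x: "(\<integral>\<^sup>+t. indicator N (t *\<^sub>R x) * indicator {0<..} t \<partial>lborel) = 0" "x \<noteq> 0"
    by blast
  define u1 where "u1 \<rho> = u' ((\<rho> / norm x) *\<^sub>R x)" for \<rho> :: real
  have u1 [measurable]: "u1 \<in> borel_measurable borel" unfolding u1_def[abs_def] by measurable
  have nx: "0 < norm x" using x by simp
  have "(\<integral>\<^sup>+\<rho>. indicator N ((\<rho> / norm x) *\<^sub>R x) * indicator {0<..} \<rho> \<partial>lborel)
     = ennreal (norm x ^ DIM(real)) * (\<integral>\<^sup>+t. indicator N (((norm x *\<^sub>R t) / norm x) *\<^sub>R x) * indicator {0<..} (norm x *\<^sub>R t) \<partial>lborel)"
    using nx by (intro nn_integral_lborel_scale) auto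
  also have "(\<integral>\<^sup>+t. indicator N (((norm x *\<^sub>R t) / norm x) *\<^sub>R x) * indicator {0<..} (norm x *\<^sub>R t) \<partial>lborel) = (\<integral>\<^sup>+t. indicator N (t *\<^sub>R x) * indicator {0<..} t \<partial>lborel)"
    using nx by (intro nn_integral_cong) (auto simp: indicator_def zero_less_mult_iff)
  finally have "(\<integral>\<^sup>+\<rho>. indicator N ((\<rho> / norm x) *\<^sub>R x) * indicator {0<..} \<rho> \<partial>lborel) = 0"
    using x by simp
  then have AEr: "AE \<rho> in lborel. indicator N ((\<rho> / norm x) *\<^sub>R x) * (indicator {0<..} \<rho> :: ennreal) = 0"
    by (subst (asm) nn_integral_0_iff_AE) auto
  have eq: "u0 \<rho> = u1 \<rho>" if "0 < \<rho>" "(\<rho> / norm x) *\<^sub>R x \<notin> N" for \<rho>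
  proof -
    have "u1 \<rho> = u ((\<rho> / norm x) *\<^sub>R x)" using Nu[OF that(2)] by (simp add: u1_def)
    also have "\<dots> = u0 \<rho>" using rad[of "(\<rho> / norm x) *\<^sub>R x"] that nx by simp
    finally show ?thesis by simp
  qed
  define Z where "Z = {\<rho>. (\<rho> / norm x) *\<^sub>R x \<in> N}"
  have Zm [measurable]: "Z \<in> sets borel" unfolding Z_def by measurable
  have AEZ: "AE \<rho> in lborel. 0 < \<rho> \<longrightarrow> \<rho> \<notin> Z"
    using AEr by eventually_elim (auto simp: Z_def indicator_def)
  \<comment> \<open>The two profiles agree off a null set Z of positive radii. That the points with
    norm in Z are null as well follows by comparing the image of Lebesgue measure under the norm
    with \<rho>^(n - 1) d\<rho>. The trivial density 1 brings this image into the form of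
    \<open>distr_norm_density_interval\<close>.\<close>
  define M where "M = distr (density lborel (\<lambda>_::'a. 1)) borel norm"
  obtain C where C: "0 < C" and vol: "\<And>a b. 0 < a \<Longrightarrow> a \<le> b \<Longrightarrow> b \<le> 2 * a \<Longrightarrow>
    emeasure lborel (shell a b :: 'a set) \<le> ennreal (C * (b - a) * a powr (real DIM('a) - 1))"
    by (rule emeasure_shell_le) blast
  have "(\<integral>\<^sup>+\<rho>. indicator Z \<rho> * indicator {0<..} \<rho> \<partial>M) \<le> (\<integral>\<^sup>+\<rho>. ennreal (C * 1 * \<rho> powr (real DIM('a) - 1)) * indicator Z \<rho> * indicator {0<..} \<rho> \<partial>lborel)"
  proof (rule nn_integral_le_of_interval_bound)
    show "sets M = sets borel" by (simp add: M_def)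
    show "continuous_on {0<..} (\<lambda>\<rho>::real. \<rho> powr (real DIM('a) - 1))" by (intro continuous_intros) auto
    show "a powr (real DIM('a) - 1) \<le> 1 * x powr (real DIM('a) - 1)" if "0 < a" "a \<le> x" for a x :: real
      using that by (simp add: powr_mono2 Suc_leI)
    show "emeasure M {a<..b} \<le> ennreal (C * (b - a) * a powr (real DIM('a) - 1))" if "0 < a" "a < b" "b \<le> 2 * a" for a b
      unfolding M_def using vol[of a b] that by (subst distr_norm_density_interval) auto
  qed (use C in auto)
  also have "\<dots> = 0"
    by (subst nn_integral_0_iff_AE) (use AEZ in \<open>auto elim!: eventually_mono simp: indicator_def\<close>)
  finally have "(\<integral>\<^sup>+\<rho>. indicator Z \<rho> * indicator {0<..} \<rho> \<partial>M) = 0" by simp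
  then have "(\<integral>\<^sup>+y. indicator Z (norm y) * indicator {0<..} (norm y) \<partial>(lborel :: 'a measure)) = 0"
    unfolding M_def density_1 by (subst (asm) nn_integral_distr) auto
  then have "AE y in (lborel :: 'a measure). indicator Z (norm y) * (indicator {0<..} (norm y) :: ennreal) = 0"
    by (subst (asm) nn_integral_0_iff_AE) auto
  moreover have "AE y in lborel. y \<noteq> (0::'a)" by (rule AE_lborel_singleton)
  ultimately have AEu: "AE y in lborel. u y = u1 (norm y)"
  proof eventually_elim
    fix y :: 'a assume "indicator Z (norm y) * (indicator {0<..} (norm y) :: ennreal) = 0" "y \<noteq> 0"
    then have "0 < norm y" "norm y \<notin> Z" by (auto simp: indicator_def split: if_splits)
    then show "u y = u1 (norm y)" using eq[of "norm y"] rad[of y] by (simp add: Z_def)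
  qed
  have "AE \<rho> in lborel. 0 < \<rho> \<longrightarrow> u0 \<rho> = u1 \<rho>"
    using AEZ by eventually_elim (auto simp: Z_def intro: eq)
  with u1 AEu show ?thesis by (intro that)
qed

section \<open>The weighted inequality\<close>

lemma powr_comparable:
  fixes a x c :: real
  assumes "0 < a" "a \<le> x" "x \<le> 2 * a"
  shows "a powr c \<le> 2 powr \<bar>c\<bar> * x powr c"
proof (cases "0 \<le> c")
  case True
  have "a powr c \<le> 1 * x powr c" using True assms by (simp add: powr_mono2)
  also have "\<dots> \<le> 2 powr \<bar>c\<bar> * x powr c" by (intro mult_right_mono) (auto simp: ge_one_powr_ge_zero)
  finally show ?thesis .
next
  case False
  have "a powr c \<le> (x / 2) powr c" using False assms powr_mono2'[of "- c" "x / 2" a] by (simp add: powr_mono2')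
  also have "\<dots> = 2 powr \<bar>c\<bar> * x powr c" using False unfolding powr_divide by (simp add: powr_minus_divide[of 2 "- c", simplified])
  finally show ?thesis .
qed

lemma max_weight_comparable:
  assumes "0 < a" "a \<le> x" "x \<le> 2 * a"
  shows "max_weight \<alpha> \<beta> a \<le> 2 powr (\<bar>\<alpha>\<bar> + \<bar>\<beta>\<bar>) * max_weight \<alpha> \<beta> x"
proof -
  have "a powr c \<le> 2 powr (\<bar>\<alpha>\<bar> + \<bar>\<beta>\<bar>) * max_weight \<alpha> \<beta> x" if "c = \<alpha> \<or> c = \<beta>" for c
  proof -
    have "a powr c \<le> 2 powr \<bar>c\<bar> * x powr c" by (rule powr_comparable[OF assms])
    also have "\<dots> \<le> 2 powr (\<bar>\<alpha>\<bar> + \<bar>\<beta>\<bar>) * max_weight \<alpha> \<beta> x"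
      using that by (intro mult_mono powr_mono) (auto simp: max_weight_def)
    finally show ?thesis .
  qed
  then show ?thesis by (simp add: max_weight_def)
qed

lemma test_function_bounded_supported:
  assumes "f \<in> (test_functions :: ('a::euclidean_space \<Rightarrow> complex) set)"
  obtains R where "bounded_supported R f"
proof -
  have c: "continuous_on UNIV f" and k: "compact (closure {x. f x \<noteq> 0})"
    using assms by (auto simp: test_functions_def dest: spec[of _ 0])
  obtain R where R: "\<And>x. f x \<noteq> 0 \<Longrightarrow> norm x \<le> R"
    using compact_imp_bounded[OF k] closure_subset[of "{x. f x \<noteq> 0}"] unfolding bounded_iff by blast
  have "compact (f ` closure {x. f x \<noteq> 0})"
    by (intro compact_continuous_image k continuous_on_subset[OF c]) auto
  then obtain M where M: "\<forall>y\<in>f ` closure {x. f x \<noteq> 0}. norm y \<le> M" using compact_imp_bounded bounded_iff by blast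
  have "cmod (f x) \<le> max M 0" for x
    using M closure_subset[of "{x. f x \<noteq> 0}"] by (cases "f x = 0") (auto simp: le_max_iff_disj)
  moreover have "f \<in> borel_measurable borel" using c by (rule borel_measurable_continuous_onI)
  moreover have "f x = 0" if "R < norm x" for x using R[of x] that by force
  ultimately have "bounded_supported R f" unfolding bounded_supported_def by blast
  then show ?thesis by (rule that)
qed

text \<open>The distribution M of |\<xi>| under the q-th power of the transform has at most (b - a)
  g(a) on a short interval, up to a constant and the weighted norm of f. Integrating the profile of
  u against M then reproduces the integral assumed finite. The constant \<open>L\<close> accounts
  for the variation of g between a and 2 a.\<close>

lemma weighted_fourier_bound:
  fixes p q \<alpha> \<beta> :: real and u :: "'a::euclidean_space \<Rightarrow> real" and u0 :: "real \<Rightarrow> real"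
  assumes n2: "2 \<le> DIM('a)" and p: "1 < p" and q: "2 \<le> q" "q \<le> (real DIM('a) - 1) / (real DIM('a) + 1) * conj_exponent p"
    and al: "\<alpha> < DIM('a) * (p - 1)" and be: "0 \<le> \<beta>"
    and um: "u \<in> borel_measurable lebesgue" and unn: "\<And>x. 0 \<le> u x" and rad: "\<And>x. u x = u0 (norm x)"
    and fin: "(\<integral>\<^sup>+\<rho>\<in>{0<..}. ennreal (\<rho> powr (real DIM('a) - 1 - q * real DIM('a) / conj_exponent p) * u0 \<rho> * max_weight \<alpha> \<beta> \<rho> powr (q / p)) \<partial>lebesgue) < \<infinity>"
  obtains K where "0 < K" "\<And>R (f :: 'a \<Rightarrow> complex). bounded_supported R f \<Longrightarrow>
    integrable lborel (\<lambda>x. power_weight \<alpha> \<beta> x * cmod (f x) powr p) \<Longrightarrow>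
    (\<integral>\<^sup>+\<xi>. ennreal (u \<xi> * cmod (fourier f \<xi>) powr q) \<partial>lborel) \<le> ennreal (K * (LINT x|lborel. power_weight \<alpha> \<beta> x * cmod (f x) powr p) powr (q / p))"
proof -
  define n where "n = real DIM('a)"
  define c where "c = n - 1 - q * n / conj_exponent p"
  define g where "g \<rho> = \<rho> powr c * max_weight \<alpha> \<beta> \<rho> powr (q / p)" for \<rho>
  have qp: "0 < q / p" using p q by simp
  obtain C where C: "0 < C" and sh: "\<And>a b R (f :: 'a \<Rightarrow> complex). 0 < a \<Longrightarrow> a < b \<Longrightarrow> b \<le> 2 * a \<Longrightarrow> bounded_supported R f \<Longrightarrow>
    integrable lborel (\<lambda>x. power_weight \<alpha> \<beta> x * cmod (f x) powr p) \<Longrightarrow>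
    (\<integral>\<^sup>+\<xi>. ennreal (cmod (fourier f \<xi>) powr q) * indicator (shell a b) \<xi> \<partial>lborel)
      \<le> ennreal (C * (b - a) * a powr c * max_weight \<alpha> \<beta> a powr (q / p) * (LINT x|lborel. power_weight \<alpha> \<beta> x * cmod (f x) powr p) powr (q / p))"
    unfolding c_def n_def by (rule weighted_shell_restriction[OF n2 p q al be]) blast
  obtain u1 where u1 [measurable]: "u1 \<in> borel_measurable borel" and ue0: "AE \<rho> in lborel. 0 < \<rho> \<longrightarrow> u0 \<rho> = u1 \<rho>"
    and ue: "AE x in lborel. u x = u1 (norm x)"
    by (rule radial_measurable_profile[OF um rad])
  define L where "L = 2 powr \<bar>c\<bar> * (2 powr (\<bar>\<alpha>\<bar> + \<bar>\<beta>\<bar>)) powr (q / p)"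
  have L: "0 < L" by (simp add: L_def)
  have g0: "0 \<le> g x" for x by (simp add: g_def)
  have gc: "continuous_on {0<..} g"
    unfolding g_def[abs_def] max_weight_def using max_weight_pos[of _ \<alpha> \<beta>, unfolded max_weight_def]
    by (intro continuous_intros) force+
  have gl: "g a \<le> L * g x" if "0 < a" "a \<le> x" "x \<le> 2 * a" for a x
  proof -
    have "max_weight \<alpha> \<beta> a powr (q / p) \<le> (2 powr (\<bar>\<alpha>\<bar> + \<bar>\<beta>\<bar>) * max_weight \<alpha> \<beta> x) powr (q / p)"
      using max_weight_comparable[OF that, of \<alpha> \<beta>] max_weight_pos[OF that(1), of \<alpha> \<beta>] qp by (intro powr_mono2) auto
    then have "g a \<le> (2 powr \<bar>c\<bar> * x powr c) * (2 powr (\<bar>\<alpha>\<bar> + \<bar>\<beta>\<bar>) * max_weight \<alpha> \<beta> x) powr (q / p)"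
      unfolding g_def by (intro mult_mono powr_comparable that) auto
    also have "\<dots> = L * g x" unfolding L_def g_def powr_mult by simp
    finally show ?thesis .
  qed
  \<comment> \<open>The integral of the hypothesis with the Borel profile \<open>u1\<close> in place
    of \<open>u0\<close>, which need not be Borel.\<close>
  define I0 where "I0 = (\<integral>\<^sup>+\<rho>. ennreal (g \<rho>) * ennreal (u1 \<rho>) * indicator {0<..} \<rho> \<partial>lborel)"
  have "I0 = (\<integral>\<^sup>+\<rho>. ennreal (\<rho> powr c * u0 \<rho> * max_weight \<alpha> \<beta> \<rho> powr (q / p)) * indicator {0<..} \<rho> \<partial>lborel)"
    unfolding I0_def
  proof (rule nn_integral_cong_AE)
    show "AE \<rho> in lborel. ennreal (g \<rho>) * ennreal (u1 \<rho>) * indicator {0<..} \<rho> = ennreal (\<rho> powr c * u0 \<rho> * max_weight \<alpha> \<beta> \<rho> powr (q / p)) * indicator {0<..} \<rho>"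
      using ue0
    proof eventually_elim
      fix \<rho> :: real assume e: "0 < \<rho> \<longrightarrow> u0 \<rho> = u1 \<rho>"
      have "ennreal (g \<rho>) * ennreal (u1 \<rho>) = ennreal (g \<rho> * u1 \<rho>)" using g0[of \<rho>] by (rule ennreal_mult'[symmetric])
      then show "ennreal (g \<rho>) * ennreal (u1 \<rho>) * indicator {0<..} \<rho> = ennreal (\<rho> powr c * u0 \<rho> * max_weight \<alpha> \<beta> \<rho> powr (q / p)) * indicator {0<..} \<rho>"
        using e by (cases "0 < \<rho>") (simp_all add: g_def mult_ac)
    qed
  qed
  also have "\<dots> < \<infinity>" using fin unfolding nn_integral_completion c_def n_def .
  finally obtain i0 where i0: "I0 = ennreal i0" "0 \<le> i0" by (cases I0) auto
  show ?thesis
  \<comment> \<open>The summand 1 keeps the constant positive when the integral is 0.\<close>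
  proof (rule that[of "C * L * i0 + 1"])
    show "0 < C * L * i0 + 1" using C L i0 by (simp add: add_nonneg_pos)
    fix R and f :: "'a \<Rightarrow> complex" assume f: "bounded_supported R f" and vi: "integrable lborel (\<lambda>x. power_weight \<alpha> \<beta> x * cmod (f x) powr p)"
    define V where "V = (LINT x|lborel. power_weight \<alpha> \<beta> x * cmod (f x) powr p) powr (q / p)"
    have V0: "0 \<le> V" by (simp add: V_def)
    have fm [measurable]: "f \<in> borel_measurable borel" by (rule bounded_supported_measurable[OF f])
    define M where "M = distr (density lborel (\<lambda>\<xi>. ennreal (cmod (fourier f \<xi>) powr q))) borel norm"
    have "(\<integral>\<^sup>+\<xi>. ennreal (u \<xi> * cmod (fourier f \<xi>) powr q) \<partial>lborel) = (\<integral>\<^sup>+\<xi>. ennreal (cmod (fourier f \<xi>) powr q) * (ennreal (u1 (norm \<xi>)) * indicator {0<..} (norm \<xi>)) \<partial>lborel)"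
    proof (rule nn_integral_cong_AE)
      have "AE x in lborel. x \<noteq> (0::'a)" by (rule AE_lborel_singleton)
      with ue show "AE \<xi> in lborel. ennreal (u \<xi> * cmod (fourier f \<xi>) powr q) = ennreal (cmod (fourier f \<xi>) powr q) * (ennreal (u1 (norm \<xi>)) * indicator {0<..} (norm \<xi>))"
        by eventually_elim (simp add: ennreal_mult'' mult.commute)
    qed
    also have "\<dots> = (\<integral>\<^sup>+\<rho>. ennreal (u1 \<rho>) * indicator {0<..} \<rho> \<partial>M)"
      unfolding M_def by (subst nn_integral_distr, simp, simp, subst nn_integral_density) simp_all
    also have "\<dots> \<le> (\<integral>\<^sup>+\<rho>. ennreal (C * V * L * g \<rho>) * ennreal (u1 \<rho>) * indicator {0<..} \<rho> \<partial>lborel)"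
    proof (rule nn_integral_le_of_interval_bound[OF _ gc])
      show "sets M = sets borel" by (simp add: M_def)
      fix a b :: real assume ab: "0 < a" "a < b" "b \<le> 2 * a"
      have "emeasure M {a<..b} \<le> ennreal (C * (b - a) * a powr c * max_weight \<alpha> \<beta> a powr (q / p) * V)"
        unfolding M_def V_def using sh[OF ab f vi] by (subst distr_norm_density_interval) simp_all
      then show "emeasure M {a<..b} \<le> ennreal (C * V * (b - a) * g a)" by (simp add: g_def mult_ac)
    qed (use C V0 L g0 gl in auto)
    also have "\<dots> = (\<integral>\<^sup>+\<rho>. ennreal (C * V * L) * (ennreal (g \<rho>) * ennreal (u1 \<rho>) * indicator {0<..} \<rho>) \<partial>lborel)"
      using C V0 L g0 by (intro nn_integral_cong) (simp add: ennreal_mult mult.assoc)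
    also have "\<dots> = ennreal (C * V * L) * I0"
    proof -
      have "(\<lambda>x. indicator {0<..} x *\<^sub>R g x) \<in> borel_measurable borel"
        by (rule borel_measurable_continuous_on_indicator[OF _ gc]) simp
      then have [measurable]: "(\<lambda>x. g x * indicator {0<..} x) \<in> borel_measurable borel" by (simp add: mult.commute)
      have e: "ennreal (g \<rho>) * ennreal (u1 \<rho>) * indicator {0<..} \<rho> = ennreal (g \<rho> * indicator {0<..} \<rho>) * ennreal (u1 \<rho>)" for \<rho>
        by (auto simp: indicator_def)
      show ?thesis unfolding I0_def e by (rule nn_integral_cmult) simp
    qed
    also have "\<dots> = ennreal (C * V * L * i0)"
      unfolding i0(1) using C V0 L i0(2) by (intro ennreal_mult[symmetric]) auto
    also have "\<dots> \<le> ennreal ((C * L * i0 + 1) * V)"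
      using V0 by (intro ennreal_leI) (simp add: algebra_simps)
    finally show "(\<integral>\<^sup>+\<xi>. ennreal (u \<xi> * cmod (fourier f \<xi>) powr q) \<partial>lborel) \<le> ennreal ((C * L * i0 + 1) * (LINT x|lborel. power_weight \<alpha> \<beta> x * cmod (f x) powr p) powr (q / p))"
      by (simp only: V_def)
  qed
qed

theorem corollary3p2:
  fixes p q \<alpha> \<beta> n :: real
    and u :: "real ^ 'n \<Rightarrow> real"
    and u0 :: "real \<Rightarrow> real"
  defines "n \<equiv> real CARD('n)"
  assumes "n \<ge> 2"
    and "1 < p" and "p \<le> 2"
    and "2 \<le> q" and "q \<le> (n - 1) / (n + 1) * conj_exponent p"
    and "\<alpha> < n * (p - 1)" and "\<beta> \<ge> 0"
    and "u \<in> borel_measurable lebesgue"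
    and "\<And>x. 0 \<le> u x"
    and "\<And>x. u x = u0 (norm x)"
    and "(\<integral>\<^sup>+ \<rho>\<in>{0<..}. ennreal (\<rho> powr (n - 1 - q * n / conj_exponent p) * u0 \<rho>
            * max_weight \<alpha> \<beta> \<rho> powr (q / p)) \<partial>lebesgue) < \<infinity>"
  shows "\<exists>C::real. C > 0 \<and> (\<forall>f \<in> (test_functions :: (real ^ 'n \<Rightarrow> complex) set).
           Lp_norm q (\<lambda>\<xi>. complex_of_real (u \<xi> powr (1 / q)) * fourier f \<xi>)
             \<le> ennreal C *
               Lp_norm p (\<lambda>x. complex_of_real (power_weight \<alpha> \<beta> x powr (1 / p)) * f x))"
proof -
  have dim: "real DIM(real ^ 'n) = n" by (simp add: n_def)
  have n2: "2 \<le> DIM(real ^ 'n)" using assms(2) dim by linarith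
  have p0: "0 < p" and q0: "0 < q" using assms by auto
  obtain K where K: "0 < K" and bound: "\<And>R (f :: real ^ 'n \<Rightarrow> complex). bounded_supported R f \<Longrightarrow>
    integrable lborel (\<lambda>x. power_weight \<alpha> \<beta> x * cmod (f x) powr p) \<Longrightarrow>
    (\<integral>\<^sup>+\<xi>. ennreal (u \<xi> * cmod (fourier f \<xi>) powr q) \<partial>lborel) \<le> ennreal (K * (LINT x|lborel. power_weight \<alpha> \<beta> x * cmod (f x) powr p) powr (q / p))"
    by (rule weighted_fourier_bound[OF n2 \<open>1 < p\<close> \<open>2 \<le> q\<close>, of \<alpha> \<beta> u u0]) (use assms dim in \<open>simp_all\<close>)
  have cp: "cmod (complex_of_real (a powr (1 / s)) * z) powr s = a * cmod z powr s" if "0 \<le> a" "0 < s" for a s z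
    using that by (simp add: norm_mult powr_mult powr_powr)
  show ?thesis
  \<comment> \<open>K bounds q-th powers of norms, so its q-th root is the constant between the
    norms.\<close>
  proof (intro exI[of _ "K powr (1 / q)"] conjI ballI)
    show "0 < K powr (1 / q)" using K by simp
    fix f assume "f \<in> (test_functions :: (real ^ 'n \<Rightarrow> complex) set)"
    then obtain R where f: "bounded_supported R f" by (rule test_function_bounded_supported)
    have fm [measurable]: "f \<in> borel_measurable borel" by (rule bounded_supported_measurable[OF f])
    define IR where "IR = (\<integral>\<^sup>+x. ennreal (power_weight \<alpha> \<beta> x * cmod (f x) powr p) \<partial>lborel)"
    define IL where "IL = (\<integral>\<^sup>+\<xi>. ennreal (u \<xi> * cmod (fourier f \<xi>) powr q) \<partial>lborel)"
    have R: "Lp_norm p (\<lambda>x. complex_of_real (power_weight \<alpha> \<beta> x powr (1 / p)) * f x) = (if IR = \<infinity> then \<infinity> else ennreal (enn2real IR powr (1 / p)))"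
      unfolding Lp_norm_def nn_integral_completion cp[OF power_weight_nonneg p0] IR_def[symmetric] by (simp add: Let_def)
    have Lq: "Lp_norm q (\<lambda>\<xi>. complex_of_real (u \<xi> powr (1 / q)) * fourier f \<xi>) = (if IL = \<infinity> then \<infinity> else ennreal (enn2real IL powr (1 / q)))"
      unfolding Lp_norm_def nn_integral_completion cp[OF assms(10) q0] IL_def[symmetric] by (simp add: Let_def)
    show "Lp_norm q (\<lambda>\<xi>. complex_of_real (u \<xi> powr (1 / q)) * fourier f \<xi>)
      \<le> ennreal (K powr (1 / q)) * Lp_norm p (\<lambda>x. complex_of_real (power_weight \<alpha> \<beta> x powr (1 / p)) * f x)"
    \<comment> \<open>When |x|^\<alpha> is not integrable at the origin, the norm on the right may
      be infinite even for a test function. A positive constant times infinity is infinity, so the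
      claim is then trivial.\<close>
    proof (cases "IR = \<infinity>")
      case True
      then show ?thesis using K by (simp add: R ennreal_mult_top)
    next
      case False
      have vi: "integrable lborel (\<lambda>x. power_weight \<alpha> \<beta> x * cmod (f x) powr p)"
      proof (rule integrableI_bounded)
        show "(\<integral>\<^sup>+x. ennreal (norm (power_weight \<alpha> \<beta> x * cmod (f x) powr p)) \<partial>lborel) < \<infinity>"
          using False unfolding IR_def by (simp add: power_weight_nonneg less_top)
      qed simp
      define V where "V = (LINT x|lborel. power_weight \<alpha> \<beta> x * cmod (f x) powr p)"
      have V0: "0 \<le> V" unfolding V_def by (intro integral_nonneg_AE) (simp add: power_weight_nonneg)
      have IRV: "IR = ennreal V"
        unfolding IR_def V_def by (rule nn_integral_eq_integral[OF vi]) (simp add: power_weight_nonneg)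
      have ILV: "IL \<le> ennreal (K * V powr (q / p))" unfolding IL_def V_def by (rule bound[OF f vi])
      then have fin: "IL \<noteq> \<infinity>" by (auto simp: top_unique)
      have "enn2real IL \<le> K * V powr (q / p)" using ILV K by (simp add: enn2real_leI)
      then have "enn2real IL powr (1 / q) \<le> (K * V powr (q / p)) powr (1 / q)" using q0 by (intro powr_mono2) auto
      also have "\<dots> = K powr (1 / q) * V powr (1 / p)" unfolding powr_mult powr_powr using q0 by simp
      finally have "ennreal (enn2real IL powr (1 / q)) \<le> ennreal (K powr (1 / q)) * ennreal (V powr (1 / p))"
        by (subst ennreal_mult[symmetric]) (auto intro: ennreal_leI)
      then show ?thesis using fin False V0 unfolding R Lq by (simp add: IRV)
    qed
  qed
qed

end
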